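(* For all $g,l\in\mathbb{N}$, the set $\mathbb{MS}_{g,l}$ of schemes of genus $g$ and grade $l$ of the quartic $U(N)\times O(D)$ multi-matrix model is finite.
   Context: Maps: connected orientable combinatorial maps, all vertices of degree $4$, vertices black or white, every edge joining a black and a white vertex. $V,E,F$: numbers of vertices, edges, faces. A straight cycle is a closed walk along edges that, entering a vertex by a half-edge $h$, leaves by the half-edge opposite to $h$ in the cyclic order; $\phi$ is their number. Genus $g$: $F-E+V=2-2g$; grade $l$: $\frac l2=1+g+E-\frac{3V}2-\phi$ (non-negative integers). A $2$-point map has one free half-edge at a black and one at a white vertex; rooted maps are maps with a marked edge (obtained by closing a $2$-point map); genus and grade are those of the underlying map. The elementary melon is the $2$-point map with a white and a black vertex joined by three edges, each with one extra free half-edge; melonic $2$-point maps are obtained from it by repeatedly replacing edges or free half-edges by copies of the elementary melon, and a melonic submap is a submap attached by two edges forming a melonic $2$-point map. A dipole is the $4$-point map obtained by cutting one of the three edges of the elementary melon; the two cut half-edges form one side, the two original free half-edges the other. Cutting the middle edge (opposite, at each vertex, to the free half-edge) gives an O-dipole (its two edges form a straight cycle of length $2$); cutting either other edge gives a U-dipole (its two edges bound a face of degree $2$). A dipole in a map is isolated if it is vertex-disjoint from all other dipoles. A chain is an isolated dipole or a sequence of $\ge2$ dipoles with one side of each joined by two edges to one side of the next; it is an O-chain, a U-chain (all dipoles of that type) or broken (both types); maximal if not contained in a longer chain. The scheme of a rooted map is obtained by replacing each melonic $2$-point submap by an edge and then each maximal chain by a chain-vertex (a $4$-valent vertex remembering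 its sides, labelled O, U or B); this preserves genus and grade, and the genus and grade of a scheme are those of its maps. *)

theory Defs
  imports Complex_Main "HOL-Combinatorics.Orbits"
begin

section \<open>Maps with free half-edges\<close>

text \<open>
  A map is given by its half-edges, the permutation \<open>rot\<close> sending a half-edge to the next one
  around its vertex, and the involution \<open>edge\<close> sending a half-edge to the other half of its edge.
  The fixed points of \<open>edge\<close> are the free half-edges.  \<open>white h\<close> is the colour of the vertex
  carrying \<open>h\<close>.  Only the values of the three functions on \<open>darts\<close> are meaningful.
\<close>

record 'a hmap =
  darts :: "'a set"
  rot :: "'a \<Rightarrow> 'a"
  edge :: "'a \<Rightarrow> 'a"
  white :: "'a \<Rightarrow> bool"

definition wf_hmap :: "'a hmap \<Rightarrow> bool" where
  "wf_hmap M \<longleftrightarrow>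
     finite (darts M) \<and>
     bij_betw (rot M) (darts M) (darts M) \<and>
     (\<forall>h\<in>darts M. card (orbit (rot M) h) = 4 \<and> white M (rot M h) = white M h) \<and>
     (\<forall>h\<in>darts M. edge M h \<in> darts M \<and> edge M (edge M h) = h \<and>
        (edge M h \<noteq> h \<longrightarrow> white M (edge M h) \<noteq> white M h))"

definition free_darts :: "'a hmap \<Rightarrow> 'a set" where
  "free_darts M = {h \<in> darts M. edge M h = h}"

definition two_point_map :: "'a hmap \<Rightarrow> bool" where
  "two_point_map M \<longleftrightarrow> wf_hmap M \<and>
     (\<exists>p q. free_darts M = {p, q} \<and> white M p \<and> \<not> white M q)"

text \<open>For a map with exactly two free half-edges, the other free half-edge.\<close>

definition other_free :: "'a hmap \<Rightarrow> 'a \<Rightarrow> 'a" where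
  "other_free M p = (THE q. q \<in> free_darts M \<and> q \<noteq> p)"

definition closure_map :: "'a hmap \<Rightarrow> 'a hmap" where
  "closure_map M =
     M\<lparr>edge := (\<lambda>h. if h \<in> free_darts M then other_free M h else edge M h)\<rparr>"

definition connected_map :: "'a hmap \<Rightarrow> bool" where
  "connected_map M \<longleftrightarrow>
     (\<forall>h\<in>darts M. \<forall>k\<in>darts M.
        (h, k) \<in> {(x, y). x \<in> darts M \<and> (y = rot M x \<or> y = edge M x)}\<^sup>*)"

text \<open>
  A rooted map is represented by the 2-point map obtained by cutting its marked edge; the
  underlying map is \<open>closure_map M\<close>.
\<close>

definition rooted_map :: "'a hmap \<Rightarrow> bool" where
  "rooted_map M \<longleftrightarrow> two_point_map M \<and> connected_map (closure_map M)"


section \<open>Genus and grade\<close>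

definition vertices :: "'a hmap \<Rightarrow> 'a set set" where
  "vertices M = {orbit (rot M) h | h. h \<in> darts M}"

definition edges :: "'a hmap \<Rightarrow> 'a set set" where
  "edges M = {{h, edge M h} | h. h \<in> darts M}"

definition faces :: "'a hmap \<Rightarrow> 'a set set" where
  "faces M = {orbit (rot M \<circ> edge M) h | h. h \<in> darts M}"

text \<open>
  The orbit of \<open>h\<close> below is the set of half-edges by which the straight walk starting along \<open>h\<close>
  leaves its vertices.  Adding their partners makes the set independent of the direction in which
  the straight cycle is traversed.
\<close>

definition straight_cycles :: "'a hmap \<Rightarrow> 'a set set" where
  "straight_cycles M =
     {(let C = orbit (rot M \<circ> rot M \<circ> edge M) h in C \<union> edge M ` C) | h. h \<in> darts M}"

text \<open>
  These are meant for maps without free half-edges; \<open>F - E + V = 2 - 2g\<close> and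
  \<open>l/2 = 1 + g + E - 3V/2 - \<phi>\<close> are solved for \<open>g\<close> and \<open>l\<close>.
\<close>

definition map_genus :: "'a hmap \<Rightarrow> real" where
  "map_genus M =
     (2 - (real (card (faces M)) - real (card (edges M)) + real (card (vertices M)))) / 2"

definition map_grade :: "'a hmap \<Rightarrow> real" where
  "map_grade M =
     2 * (1 + map_genus M + real (card (edges M)) - 3 * real (card (vertices M)) / 2
          - real (card (straight_cycles M)))"

definition rooted_genus :: "'a hmap \<Rightarrow> real" where
  "rooted_genus M = map_genus (closure_map M)"

definition rooted_grade :: "'a hmap \<Rightarrow> real" where
  "rooted_grade M = map_grade (closure_map M)"


section \<open>Melons\<close>

text \<open>The map cut out by a set of half-edges; the edges leaving it become free half-edges.\<close>

definition submap :: "'a hmap \<Rightarrow> 'a set \<Rightarrow> 'a hmap" where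
  "submap M A =
     M\<lparr>darts := A, edge := (\<lambda>h. if edge M h \<in> A then edge M h else h)\<rparr>"

text \<open>
  Replacement of a 2-point submap by an edge: the half-edges attached to its two free half-edges
  are glued together.  If one of the latter is free in \<open>M\<close>, the result is a free half-edge; if
  both are, the result is the 2-point map reduced to a bare edge, represented by the empty set of
  half-edges.
\<close>

definition contract :: "'a hmap \<Rightarrow> 'a set \<Rightarrow> 'a hmap" where
  "contract M A =
     M\<lparr>darts := darts M - A,
       edge := (\<lambda>h. if edge M h \<in> A
                    then let q = other_free (submap M A) (edge M h)
                         in if edge M q = q then h else edge M q
                    else edge M h)\<rparr>"

text \<open>
  The half-edges around the white vertex are \<open>a\<close> (free) and \<open>rot\<^sup>i a\<close> for \<open>i = 1, 2, 3\<close>, those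
  around the black vertex are \<open>b\<close> (free) and \<open>rot\<^sup>i b\<close>.  The orders in which the three edges
  appear around the two vertices are opposite: the melon is planar.  This is the arrangement
  in which cutting the middle edge leaves a straight cycle of length 2, and cutting one of the two
  others leaves a face of degree 2.
\<close>

definition elementary_melon :: "'a hmap \<Rightarrow> bool" where
  "elementary_melon M \<longleftrightarrow> two_point_map M \<and>
     (\<exists>a b. darts M = orbit (rot M) a \<union> orbit (rot M) b \<and>
        white M a \<and> \<not> white M b \<and> free_darts M = {a, b} \<and>
        (\<forall>i\<in>{1, 2, 3}. edge M ((rot M ^^ i) a) = (rot M ^^ (4 - i)) b))"

text \<open>
  In the second rule \<open>M\<close> is obtained from the melonic map \<open>contract M A\<close> by replacing an edge or
  a free half-edge by a copy of the elementary melon.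
\<close>

inductive melonic :: "'a hmap \<Rightarrow> bool" where
  elementary: "elementary_melon M \<Longrightarrow> melonic M"
| insert: "two_point_map M \<Longrightarrow> A \<subseteq> darts M \<Longrightarrow> elementary_melon (submap M A) \<Longrightarrow>
    melonic (contract M A) \<Longrightarrow> melonic M"

definition melonic_submap :: "'a hmap \<Rightarrow> 'a set \<Rightarrow> bool" where
  "melonic_submap M A \<longleftrightarrow> A \<subseteq> darts M \<and> melonic (submap M A)"

definition melon_step :: "'a hmap \<Rightarrow> 'a hmap \<Rightarrow> bool" where
  "melon_step M M' \<longleftrightarrow> (\<exists>A. melonic_submap M A \<and> M' = contract M A)"

definition melon_reduced :: "'a hmap \<Rightarrow> 'a hmap \<Rightarrow> bool" where
  "melon_reduced M M' \<longleftrightarrow> melon_step\<^sup>*\<^sup>* M M' \<and> (\<nexists>A. melonic_submap M' A)"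


section \<open>Dipoles and chains\<close>

datatype chain_type = O_type | U_type | B_type

text \<open>A side consists of a white half-edge (first) and a black half-edge (second).\<close>

type_synonym 'a side = "'a \<times> 'a"
type_synonym 'a dipole = "chain_type \<times> 'a side \<times> 'a side"

text \<open>
  In the notation of \<open>elementary_melon\<close>, the \<open>j\<close>-th edge is cut; nothing is required of the
  half-edges forming the sides.  As the edge cut by the marking of a rooted map is
  not an edge of the 2-point map, it is neither in a dipole nor among the edges joining
  two dipoles of a chain.
\<close>

definition cut_melon :: "'a hmap \<Rightarrow> chain_type \<Rightarrow> 'a side \<Rightarrow> 'a side \<Rightarrow> bool" where
  "cut_melon M t s s' \<longleftrightarrow>
     (\<exists>a b j. j \<in> {1, 2, 3} \<and> a \<in> darts M \<and> b \<in> darts M \<and> white M a \<and> \<not> white M b \<and>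
        (\<forall>i\<in>{1, 2, 3} - {j}. edge M ((rot M ^^ i) a) = (rot M ^^ (4 - i)) b) \<and>
        s = (a, b) \<and> s' = ((rot M ^^ j) a, (rot M ^^ (4 - j)) b) \<and>
        t = (if j = 2 then O_type else U_type))"

text \<open>A dipole, listed with one side first; \<open>flip\<close> gives the same dipole with its sides exchanged.\<close>

fun flip :: "'a dipole \<Rightarrow> 'a dipole" where
  "flip (t, s, s') = (t, s', s)"

fun is_dipole :: "'a hmap \<Rightarrow> 'a dipole \<Rightarrow> bool" where
  "is_dipole M (t, s, s') \<longleftrightarrow> cut_melon M t s s' \<or> cut_melon M t s' s"

fun dipole_darts :: "'a hmap \<Rightarrow> 'a dipole \<Rightarrow> 'a set" where
  "dipole_darts M (t, (a, b), s') = orbit (rot M) a \<union> orbit (rot M) b"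

definition isolated_dipole :: "'a hmap \<Rightarrow> 'a dipole \<Rightarrow> bool" where
  "isolated_dipole M d \<longleftrightarrow> is_dipole M d \<and>
     (\<forall>d'. is_dipole M d' \<and> d' \<noteq> d \<and> d' \<noteq> flip d \<longrightarrow>
        dipole_darts M d \<inter> dipole_darts M d' = {})"

fun joined :: "'a hmap \<Rightarrow> 'a dipole \<Rightarrow> 'a dipole \<Rightarrow> bool" where
  "joined M (t, s, (c, d)) (t', (a, b), s') \<longleftrightarrow> edge M c = b \<and> edge M d = a"

text \<open>
  The dipoles of a chain are the constituents of a 4-point map, hence pairwise vertex-disjoint.
\<close>

definition chain :: "'a hmap \<Rightarrow> 'a dipole list \<Rightarrow> bool" where
  "chain M ds \<longleftrightarrow> ds \<noteq> [] \<and>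
     (\<forall>d\<in>set ds. is_dipole M d) \<and>
     (length ds = 1 \<longrightarrow> isolated_dipole M (hd ds)) \<and>
     (\<forall>i. Suc i < length ds \<longrightarrow> joined M (ds ! i) (ds ! Suc i)) \<and>
     (\<forall>i j. i < j \<and> j < length ds \<longrightarrow>
        dipole_darts M (ds ! i) \<inter> dipole_darts M (ds ! j) = {})"

text \<open>A chain is listed in either direction, so both orientations of a maximal chain occur.\<close>

definition maximal_chain :: "'a hmap \<Rightarrow> 'a dipole list \<Rightarrow> bool" where
  "maximal_chain M ds \<longleftrightarrow> chain M ds \<and> (\<nexists>ds'. chain M ds' \<and> set ds \<subset> set ds')"

definition chain_label :: "'a dipole list \<Rightarrow> chain_type" where
  "chain_label ds =
     (if fst ` set ds = {O_type} then O_type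
      else if fst ` set ds = {U_type} then U_type
      else B_type)"

fun side_set :: "'a side \<Rightarrow> 'a set" where
  "side_set (a, b) = {a, b}"

definition chain_sides :: "'a dipole list \<Rightarrow> 'a set set" where
  "chain_sides ds = {side_set (fst (snd (hd ds))), side_set (snd (snd (last ds)))}"

definition chain_inner :: "'a hmap \<Rightarrow> 'a dipole list \<Rightarrow> 'a set" where
  "chain_inner M ds = (\<Union>d\<in>set ds. dipole_darts M d) - \<Union> (chain_sides ds)"


section \<open>Schemes\<close>

text \<open>
  \<open>s_chains\<close> is the set of chain-vertices, each given by its label and its two sides.
  \<open>s_edge\<close> and \<open>s_white\<close> are as for maps; the free half-edges mark the root edge.

  \<open>s_rot h\<close> and \<open>s_opp h\<close> are the half-edges by which a face, respectively a straight walk, that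
  enters a vertex by \<open>h\<close> leaves it.  At an ordinary vertex they are the next and the
  opposite half-edge in the cyclic order.  At a chain-vertex they are read off from the chain it
  replaces; this keeps track of how the half-edges of the two sides match, which depends on the
  parity of the length in the case of O- and U-chains, and which the genus and the grade depend on.
\<close>

record 'a scheme =
  s_darts :: "'a set"
  s_rot :: "'a \<Rightarrow> 'a"
  s_opp :: "'a \<Rightarrow> 'a"
  s_edge :: "'a \<Rightarrow> 'a"
  s_white :: "'a \<Rightarrow> bool"
  s_chains :: "(chain_type \<times> 'a set set) set"

text \<open>
  A walk turning by \<open>t\<close> at each vertex and entering by \<open>h\<close> leaves successively by \<open>t h\<close>,
  \<open>t (edge (t h))\<close>, ...; the first of these half-edges lying in \<open>K\<close>.
\<close>

definition walk_exit :: "('a \<Rightarrow> 'a) \<Rightarrow> ('a \<Rightarrow> 'a) \<Rightarrow> 'a set \<Rightarrow> 'a \<Rightarrow> 'a" where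
  "walk_exit t e K h =
     ((t \<circ> e) ^^ (LEAST n. ((t \<circ> e) ^^ n) (t h) \<in> K)) (t h)"

definition chain_scheme :: "'a hmap \<Rightarrow> 'a scheme" where
  "chain_scheme M =
     (let K = darts M - (\<Union>ds\<in>{ds. maximal_chain M ds}. chain_inner M ds)
      in \<lparr>s_darts = K,
          s_rot = walk_exit (rot M) (edge M) K,
          s_opp = walk_exit (rot M \<circ> rot M) (edge M) K,
          s_edge = edge M,
          s_white = white M,
          s_chains = {(chain_label ds, chain_sides ds) | ds. maximal_chain M ds}\<rparr>)"

definition is_scheme_of :: "'a scheme \<Rightarrow> 'a hmap \<Rightarrow> bool" where
  "is_scheme_of S M \<longleftrightarrow> (\<exists>M'. melon_reduced M M' \<and> S = chain_scheme M')"

definition scheme_iso :: "('a scheme \<times> 'a scheme) set" where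
  "scheme_iso = {(S, T). \<exists>f. bij_betw f (s_darts S) (s_darts T) \<and>
     (\<forall>h\<in>s_darts S.
        f (s_rot S h) = s_rot T (f h) \<and>
        f (s_opp S h) = s_opp T (f h) \<and>
        f (s_edge S h) = s_edge T (f h) \<and>
        s_white T (f h) = s_white S h) \<and>
     s_chains T = (\<lambda>(t, X). (t, (\<lambda>s. f ` s) ` X)) ` s_chains S}"

text \<open>
  Schemes are taken up to isomorphism.  Every finite map is isomorphic to one whose half-edges are
  natural numbers.
\<close>

definition MS :: "nat \<Rightarrow> nat \<Rightarrow> nat scheme set set" where
  "MS g l =
     {S. \<exists>M. rooted_map M \<and> rooted_genus M = real g \<and> rooted_grade M = real l \<and>
             is_scheme_of S M} // scheme_iso"

end

theory Submission
  imports Defs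
begin

text \<open>
  Write \<open>\<sigma> = r \<circ> e\<close> and \<open>\<tau> = r\<^sup>2 \<circ> e\<close> for the face and the straight permutation of a closed map,
  where \<open>r\<close> rotates around vertices and \<open>e\<close> crosses edges.  Every straight cycle is traced by
  two \<open>\<tau>\<close>-orbits, so that \<open>2g + l = 6c + 3V - 2 #\<sigma> - #\<tau>\<close> with \<open>c = 1\<close> component.  Cutting the two edges
  on one side of a dipole and reconnecting them the other way either disconnects the map and
  preserves this number, or lowers it by at least \<open>2\<close>.  As the number is positive when there are no
  dipoles, it is never negative, and contracting a melon does not increase it.

  In a melon-free map, close in this way both sides of all dipoles of a maximal disjoint family.
  The pieces that are left have no dipole avoiding the marked edges created by the cuts.  Counting
  face and straight orbits of length \<open>2\<close> shows that \<open>20 (2g + l) - 40 + 9 m > 0\<close> for a piece with \<open>m\<close>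
  marked half-edges, which bounds the number of pieces, the number of marks, and the number of
  dipole sides not joined to another dipole of the family.  It also bounds the number of half-edges
  on long faces and long straight cycles.  A piece is small because away from those it is covered
  by the square lattice modulo \<open>(4\<int>)\<^sup>2\<close>.  Hence all but boundedly many half-edges lie deep inside
  chains, and the scheme forgets these.
\<close>

section \<open>Counting classes\<close>

text \<open>The scheme is governed by maximal chains, whereas the count needs pairwise disjoint
  dipoles, and a maximal disjoint family is not unique since dipoles may overlap. The link is
  rigidity: a dipole joined on both sides to dipoles disjoint from it and from each other meets no
  other dipole. So a dipole in the middle of five in a row lies in every maximal disjoint family, up
  to orientation, and no maximal chain ends there.

  Whether closing a side disconnects the map depends on the sides closed before it, so only numbers
  are tracked: the drop of \<open>Psi\<close> per switch performed, and the number of switches. The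
  latter is bounded below through rings, the classes under crossing an edge and crossing a side: a
  switch creates at most one new ring, and when all sides are closed every edge is a ring of its
  own.

  The 9 per mark against 40 per piece is a compromise. Five marks must suffice by themselves (45 >
  40), and a ring that leaves the family must still weigh 40, which is 2 (20 - 9) + 2 (20 -
  11).\<close>

definition conn :: "('a \<times> 'a) set \<Rightarrow> ('a \<times> 'a) set" where
  "conn R = (R \<union> R\<inverse>)\<^sup>*"

definition cls :: "('a \<times> 'a) set \<Rightarrow> 'a \<Rightarrow> 'a set" where
  "cls R x = {y. (x, y) \<in> conn R}"

text \<open>Orbits of permutations, components of maps and rings of sides are all counted as classes
  of a generated equivalence relation. One set of lemmas on adding a single pair then serves all
  three.\<close>

definition ncl :: "'a set \<Rightarrow> ('a \<times> 'a) set \<Rightarrow> nat" where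
  "ncl D R = card (cls R ` D)"

definition gr :: "('a \<Rightarrow> 'a) \<Rightarrow> 'a set \<Rightarrow> ('a \<times> 'a) set" where
  "gr f D = {(x, f x) | x. x \<in> D}"

lemma conn_refl [simp]: "(x, x) \<in> conn R"
  by (simp add: conn_def)

lemma conn_sym: "(x, y) \<in> conn R \<Longrightarrow> (y, x) \<in> conn R"
proof -
  have "sym ((R \<union> R\<inverse>)\<^sup>*)" by (intro sym_rtrancl) (auto simp: sym_def)
  then show "(x, y) \<in> conn R \<Longrightarrow> (y, x) \<in> conn R" by (auto simp: conn_def sym_def)
qed

lemma conn_trans: "(x, y) \<in> conn R \<Longrightarrow> (y, z) \<in> conn R \<Longrightarrow> (x, z) \<in> conn R"
  by (auto simp: conn_def)

lemma conn_base: "(x, y) \<in> R \<Longrightarrow> (x, y) \<in> conn R"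
  by (auto simp: conn_def)

lemma conn_mono: assumes "R \<subseteq> conn S" shows "conn R \<subseteq> conn S"
proof clarify
  fix x y assume "(x, y) \<in> conn R"
  then have "(x, y) \<in> (R \<union> R\<inverse>)\<^sup>*" by (simp add: conn_def)
  then show "(x, y) \<in> conn S"
    by induction (use assms in \<open>auto intro: conn_trans conn_sym\<close>)
qed

lemma conn_mono': "R \<subseteq> S \<Longrightarrow> conn R \<subseteq> conn S"
  by (rule conn_mono) (auto intro: conn_base)

lemma conn_induct [consumes 1, case_names refl step bwd]:
  assumes "(x, y) \<in> conn R" "P x"
    and "\<And>y z. (x, y) \<in> conn R \<Longrightarrow> (y, z) \<in> R \<Longrightarrow> P y \<Longrightarrow> P z"
    and "\<And>y z. (x, y) \<in> conn R \<Longrightarrow> (z, y) \<in> R \<Longrightarrow> P y \<Longrightarrow> P z"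
  shows "P y"
proof -
  have "(x, y) \<in> (R \<union> R\<inverse>)\<^sup>*" using assms(1) by (simp add: conn_def)
  then show ?thesis
    by induction (use assms(2-4) in \<open>auto simp: conn_def\<close>)
qed

lemma cls_self [simp]: "x \<in> cls R x"
  by (simp add: cls_def)

lemma cls_eq_iff: "cls R x = cls R y \<longleftrightarrow> (x, y) \<in> conn R"
  unfolding cls_def by (auto intro: conn_trans conn_sym)

lemma conn_closed:
  assumes "(x, y) \<in> conn R" "\<And>u v. (u, v) \<in> R \<Longrightarrow> u \<in> X \<longleftrightarrow> v \<in> X"
  shows "x \<in> X \<longleftrightarrow> y \<in> X"
  using assms(1) by (induction rule: conn_induct) (use assms(2) in auto)

lemma cls_restrict:
  assumes "R' \<subseteq> R" "\<And>u v. (u, v) \<in> R \<Longrightarrow> u \<in> X \<longleftrightarrow> v \<in> X"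
    "\<And>u v. (u, v) \<in> R \<Longrightarrow> u \<in> X \<Longrightarrow> (u, v) \<in> R'" "x \<in> X"
  shows "cls R x = cls R' x"
proof -
  have "(x, y) \<in> conn R'" if "(x, y) \<in> conn R" for y
  proof -
    have "y \<in> X \<and> (x, y) \<in> conn R'"
      using that
    proof (induction rule: conn_induct)
      case (step y z) then show ?case using assms by (meson conn_base conn_trans)
    next
      case (bwd y z) then show ?case using assms by (meson conn_base conn_trans conn_sym)
    qed (use assms in auto)
    then show ?thesis ..
  qed
  then show ?thesis using conn_mono'[OF assms(1)] by (auto simp: cls_def)
qed

lemma ncl_mono:
  assumes "finite D" "R \<subseteq> conn S"
  shows "ncl D S \<le> ncl D R"
proof -
  let ?f = "\<lambda>C. cls S (SOME x. x \<in> C)"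
  have "?f (cls R x) = cls S x" for x
  proof -
    have "(SOME y. y \<in> cls R x) \<in> cls R x" by (rule someI[of _ x]) simp
    then have "(x, SOME y. y \<in> cls R x) \<in> conn S"
      using conn_mono[OF assms(2)] by (auto simp: cls_def)
    then show ?thesis by (simp add: cls_eq_iff conn_sym)
  qed
  then have "cls S ` D = ?f ` cls R ` D" by (auto simp: image_image)
  then show ?thesis unfolding ncl_def using assms(1) by (metis card_image_le finite_imageI)
qed

lemma conn_insert:
  assumes "(u, v) \<in> conn (insert (x, y) R)"
  shows "(u, v) \<in> conn R \<or> (u, x) \<in> conn R \<and> (y, v) \<in> conn R
    \<or> (u, y) \<in> conn R \<and> (x, v) \<in> conn R"
  using assms
proof (induction rule: conn_induct)
  case refl then show ?case by simp
next
  case (step v z)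
  from step(2) consider "v = x" "z = y" | "(v, z) \<in> conn R" by (auto intro: conn_base)
  then show ?case
    by cases (use step(3) in \<open>blast intro: conn_trans conn_sym conn_refl\<close>)+
next
  case (bwd v z)
  from bwd(2) consider "v = y" "z = x" | "(v, z) \<in> conn R" by (auto intro: conn_base conn_sym)
  then show ?case
    by cases (use bwd(3) in \<open>blast intro: conn_trans conn_sym conn_refl\<close>)+
qed

text \<open>The new pair can only fuse the classes of \<open>x\<close> and \<open>y\<close>; once
  the class of \<open>x\<close> is left out, passing from old to new classes is injective.\<close>

lemma ncl_insert:
  assumes "finite D"
  shows "ncl D R \<le> ncl D (insert (x, y) R) + 1"
proof -
  let ?S = "insert (x, y) R"
  let ?f = "\<lambda>C. cls ?S (SOME z. z \<in> C)"
  have sub: "R \<subseteq> conn ?S" by (auto intro: conn_base)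
  have f: "?f (cls R z) = cls ?S z" for z
  proof -
    have "(SOME y. y \<in> cls R z) \<in> cls R z" by (rule someI[of _ z]) simp
    then have "(z, SOME y. y \<in> cls R z) \<in> conn ?S"
      using conn_mono[OF sub] by (auto simp: cls_def)
    then show ?thesis by (simp add: cls_eq_iff conn_sym)
  qed
  have inj: "inj_on ?f (cls R ` D - {cls R x})"
  proof (rule inj_onI)
    fix A B assume A: "A \<in> cls R ` D - {cls R x}" and B: "B \<in> cls R ` D - {cls R x}"
      and eq: "?f A = ?f B"
    obtain u v where u: "A = cls R u" and v: "B = cls R v" using A B by auto
    have "(u, v) \<in> conn ?S" using eq unfolding u v f by (simp add: cls_eq_iff)
    moreover have "(u, x) \<notin> conn R" "(x, v) \<notin> conn R" using A B unfolding u v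
      by (auto simp: cls_eq_iff intro: conn_sym)
    ultimately have "(u, v) \<in> conn R" using conn_insert by fast
    then show "A = B" by (simp add: u v cls_eq_iff)
  qed
  have "card (cls R ` D) \<le> card (cls R ` D - {cls R x}) + 1"
    using assms by (metis Suc_eq_plus1 card_Diff_singleton_if diff_le_self finite_imageI
      le_SucI le_refl Suc_pred' card_gt_0_iff empty_iff Suc_leI le_diff_conv)
  also have "card (cls R ` D - {cls R x}) = card (?f ` (cls R ` D - {cls R x}))"
    by (rule card_image[OF inj, symmetric])
  also have "\<dots> \<le> card (cls ?S ` D)"
    using assms f by (intro card_mono) auto
  finally show ?thesis by (simp add: ncl_def)
qed

text \<open>The old class of \<open>x\<close> is dispensable: it ends up in the same new class as
  that of \<open>y\<close>, so the remaining old classes already reach every new one.\<close>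

lemma ncl_strict:
  assumes "finite D" "R \<subseteq> conn S" "x \<in> D" "y \<in> D" "(x, y) \<in> conn S" "(x, y) \<notin> conn R"
  shows "ncl D S + 1 \<le> ncl D R"
proof -
  let ?T = "insert (x, y) R"
  have 1: "ncl D S \<le> ncl D ?T" using assms by (intro ncl_mono) auto
  let ?f = "\<lambda>C. cls ?T (SOME z. z \<in> C)"
  have sub: "R \<subseteq> conn ?T" by (auto intro: conn_base)
  have f: "?f (cls R z) = cls ?T z" for z
  proof -
    have "(SOME y. y \<in> cls R z) \<in> cls R z" by (rule someI[of _ z]) simp
    then have "(z, SOME y. y \<in> cls R z) \<in> conn ?T"
      using conn_mono[OF sub] by (auto simp: cls_def)
    then show ?thesis by (simp add: cls_eq_iff conn_sym)
  qed
  have xy: "cls ?T x = cls ?T y" by (auto simp: cls_eq_iff intro: conn_base)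
  have "cls ?T ` D \<subseteq> ?f ` (cls R ` D - {cls R x})"
  proof clarify
    fix z assume z: "z \<in> D"
    show "cls ?T z \<in> ?f ` (cls R ` D - {cls R x})"
    proof (cases "cls R z = cls R x")
      case True
      then have "(z, x) \<in> conn R" by (simp add: cls_eq_iff)
      then have "cls ?T z = cls ?T y" using xy conn_mono[OF sub] by (auto simp: cls_eq_iff intro: conn_trans)
      moreover have "cls R y \<noteq> cls R x" using assms(6) by (auto simp: cls_eq_iff intro: conn_sym)
      ultimately show ?thesis using assms(4) f by (intro image_eqI[of _ _ "cls R y"]) auto
    next
      case False
      then show ?thesis using z f by (intro image_eqI[of _ _ "cls R z"]) auto
    qed
  qed
  then have "ncl D ?T \<le> card (cls R ` D - {cls R x})"
    unfolding ncl_def using assms(1) by (intro surj_card_le) auto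
  moreover have "card (cls R ` D - {cls R x}) + 1 = ncl D R"
    unfolding ncl_def using assms(1,3)
    by (metis Suc_eq_plus1 card_Suc_Diff1 finite_imageI imageI)
  ultimately show ?thesis using 1 by linarith
qed

lemma ncl_Un:
  assumes "finite X" "finite Y" "X \<inter> Y = {}" "\<And>u v. (u, v) \<in> R \<Longrightarrow> u \<in> X \<longleftrightarrow> v \<in> X"
  shows "ncl (X \<union> Y) R = ncl X R + ncl Y R"
proof -
  have "cls R ` X \<inter> cls R ` Y = {}"
  proof (rule ccontr)
    assume "\<not> ?thesis"
    then obtain x y where "x \<in> X" "y \<in> Y" "(x, y) \<in> conn R" by (auto simp: cls_eq_iff)
    then show False using conn_closed[of x y R X] assms by blast
  qed
  then show ?thesis unfolding ncl_def image_Un using assms by (intro card_Un_disjoint) auto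
qed

lemma ncl_UN:
  assumes "finite D" "\<And>X. X \<in> C \<Longrightarrow> X \<subseteq> D" "\<Union>C = D" "disjoint C"
    "\<And>X u v. X \<in> C \<Longrightarrow> (u, v) \<in> R \<Longrightarrow> u \<in> X \<longleftrightarrow> v \<in> X"
  shows "ncl D R = (\<Sum>X\<in>C. ncl X R)"
proof -
  have fin: "finite C" using assms by (metis finite_UnionD)
  have "cls R ` D = (\<Union>X\<in>C. cls R ` X)" using assms(3) by auto
  moreover have "card (\<Union>X\<in>C. cls R ` X) = (\<Sum>X\<in>C. card (cls R ` X))"
  proof (rule card_UN_disjoint)
    show "\<forall>i\<in>C. finite (cls R ` i)" using assms(1,2) by (meson finite_imageI finite_subset)
    show "\<forall>X\<in>C. \<forall>Y\<in>C. X \<noteq> Y \<longrightarrow> cls R ` X \<inter> cls R ` Y = {}"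
    proof (intro ballI impI, rule ccontr)
      fix X Y assume X: "X \<in> C" "Y \<in> C" "X \<noteq> Y" "cls R ` X \<inter> cls R ` Y \<noteq> {}"
      then obtain x y where xy: "x \<in> X" "y \<in> Y" "(x, y) \<in> conn R" by (auto simp: cls_eq_iff)
      then have "y \<in> X" using conn_closed[of x y R X] assms(5) X by blast
      then show False using X xy assms(4) by (auto simp: disjoint_def)
    qed
  qed (fact fin)
  ultimately show ?thesis by (simp add: ncl_def)
qed

lemma sum_cls:
  assumes "finite D" "\<And>u v. (u, v) \<in> R \<Longrightarrow> u \<in> D \<longleftrightarrow> v \<in> D"
  shows "(\<Sum>C\<in>cls R ` D. \<Sum>h\<in>C. g h) = (\<Sum>h\<in>D. g h)"
proof -
  have sub: "cls R h \<subseteq> D" if "h \<in> D" for h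
    using conn_closed[of h _ R D] assms(2) that by (auto simp: cls_def)
  have U: "\<Union>(cls R ` D) = D" using sub by (auto intro: cls_self)
  have "(\<Sum>h\<in>\<Union>(cls R ` D). g h) = (\<Sum>C\<in>cls R ` D. \<Sum>h\<in>C. g h)"
  proof (rule sum.Union_disjoint[unfolded comp_def])
    show "\<forall>A\<in>cls R ` D. finite A" using sub assms(1) by (auto intro: finite_subset)
    show "\<forall>A\<in>cls R ` D. \<forall>B\<in>cls R ` D. A \<noteq> B \<longrightarrow> A \<inter> B = {}"
    proof (intro ballI impI, rule ccontr)
      fix A B assume A: "A \<in> cls R ` D" and B: "B \<in> cls R ` D" and n: "A \<noteq> B" "A \<inter> B \<noteq> {}"
      then obtain x y z where "A = cls R x" "B = cls R y" "z \<in> cls R x" "z \<in> cls R y" by blast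
      then show False using n(1) cls_eq_iff[of R x y] unfolding cls_def
        by (auto dest: conn_trans conn_sym)
    qed
  qed
  then show ?thesis unfolding U by simp
qed

section \<open>Cycles of a permutation and transpositions\<close>

lemma funpow_in: "(\<And>x. x \<in> D \<Longrightarrow> f x \<in> D) \<Longrightarrow> x \<in> D \<Longrightarrow> (f ^^ n) x \<in> D"
  by (induction n) auto

lemma funpow_period:
  assumes "finite D" "inj_on f D" "\<And>x. x \<in> D \<Longrightarrow> f x \<in> D" "x \<in> D"
  shows "\<exists>n>0. (f ^^ n) x = x"
proof -
  have inD: "(f ^^ n) x \<in> D" for n by (rule funpow_in) (use assms in auto)
  have "\<not> inj (\<lambda>n. (f ^^ n) x)"
  proof
    assume "inj (\<lambda>n. (f ^^ n) x)"
    then have "infinite (range (\<lambda>n. (f ^^ n) x))" using finite_imageD infinite_UNIV_nat by blast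
    moreover have "range (\<lambda>n. (f ^^ n) x) \<subseteq> D" using inD by auto
    ultimately show False using assms(1) finite_subset by blast
  qed
  then obtain m n where mn: "(f ^^ m) x = (f ^^ n) x" "m < n"
    unfolding inj_def by (metis linorder_neqE_nat)
  have "(f ^^ (n - m)) x = x"
    using mn
  proof (induction m arbitrary: n)
    case (Suc m)
    then obtain n' where n': "n = Suc n'" by (cases n) auto
    have "f ((f ^^ m) x) = f ((f ^^ n') x)" using Suc(2) by (simp add: n')
    then have "(f ^^ m) x = (f ^^ n') x" using assms(2) inD by (auto dest: inj_onD)
    then show ?case using Suc.IH[of n'] Suc(3) n' by auto
  qed auto
  then show ?thesis using mn(2) by (intro exI[of _ "n - m"]) auto
qed

lemma conn_gr_funpow:
  assumes "finite D" "inj_on f D" "\<And>x. x \<in> D \<Longrightarrow> f x \<in> D" "x \<in> D" "(x, y) \<in> conn (gr f D)"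
  shows "\<exists>n. y = (f ^^ n) x"
  using assms(5)
proof (induction rule: conn_induct)
  case refl then show ?case by (intro exI[of _ 0]) simp
next
  case (step y z)
  then obtain n where "y = (f ^^ n) x" by auto
  then show ?case using step(2) by (intro exI[of _ "Suc n"]) (auto simp: gr_def)
next
  case (bwd y z)
  then obtain n where n: "y = (f ^^ n) x" by auto
  have z: "z \<in> D" "y = f z" using bwd(2) by (auto simp: gr_def)
  obtain m where m: "m > 0" "(f ^^ m) z = z" using funpow_period[OF assms(1-3) z(1)] by blast
  then obtain k where "m = Suc k" by (cases m) auto
  then have "z = (f ^^ k) y" using m by (simp add: z(2) funpow_swap1)
  then show ?case using n by (intro exI[of _ "k + n"]) (simp add: funpow_add)
qed

lemma funpow_conn_gr:
  assumes "\<And>x. x \<in> D \<Longrightarrow> f x \<in> D" "x \<in> D"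
  shows "(x, (f ^^ n) x) \<in> conn (gr f D)"
proof (induction n)
  case (Suc n)
  have "((f ^^ n) x, f ((f ^^ n) x)) \<in> gr f D"
    using funpow_in[of D f x n] assms by (auto simp: gr_def)
  then show ?case using Suc by (auto intro: conn_trans conn_base)
qed simp

text \<open>Under the modified map \<open>y\<close> jumps to \<open>f x\<close> and then follows the
  whole old cycle of \<open>x\<close>, which avoids \<open>y\<close>, until it arrives at
  \<open>x\<close>.\<close>

lemma conn_transpose:
  assumes "finite D" "inj_on f D" "\<And>x. x \<in> D \<Longrightarrow> f x \<in> D" "x \<in> D" "y \<in> D"
    "(x, y) \<notin> conn (gr f D)"
  shows "(x, y) \<in> conn (gr (f \<circ> transpose x y) D)"
proof -
  let ?g = "f \<circ> transpose x y"
  define p where "p = (LEAST n. n > 0 \<and> (f ^^ n) x = x)"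
  have "\<exists>n. n > 0 \<and> (f ^^ n) x = x" using funpow_period[OF assms(1-4)] .
  then have p: "p > 0" "(f ^^ p) x = x" and pl: "\<And>k. 0 < k \<Longrightarrow> k < p \<Longrightarrow> (f ^^ k) x \<noteq> x"
    unfolding p_def using LeastI_ex[of "\<lambda>n. n > 0 \<and> (f ^^ n) x = x"] not_less_Least by blast+
  have gD: "?g z \<in> D" if "z \<in> D" for z using that assms(3-5) by (auto simp: transpose_def)
  have "0 < k \<Longrightarrow> k \<le> p \<Longrightarrow> (?g ^^ k) y = (f ^^ k) x" for k
  proof (induction k)
    case (Suc k)
    show ?case
    proof (cases "k = 0")
      case False
      have "(f ^^ k) x \<noteq> x" using pl[of k] False Suc by auto
      moreover have "(f ^^ k) x \<noteq> y" using assms(6) funpow_conn_gr[OF assms(3,4), where n = k] by auto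
      ultimately show ?thesis using Suc False by simp
    qed simp
  qed simp
  then have "(?g ^^ p) y = x" using p by auto
  then have "(y, x) \<in> conn (gr ?g D)" using funpow_conn_gr[of D ?g y, where n = p, OF gD assms(5)] by simp
  then show ?thesis by (rule conn_sym)
qed

lemma gr_transpose_sub:
  assumes "x \<in> D" "y \<in> D"
  shows "gr f D \<subseteq> conn (insert (x, y) (gr (f \<circ> transpose x y) D))"
proof
  fix p assume "p \<in> gr f D"
  then obtain z where z: "p = (z, f z)" "z \<in> D" by (auto simp: gr_def)
  let ?S = "insert (x, y) (gr (f \<circ> transpose x y) D)"
  have t: "transpose x y z \<in> D" using z assms by (auto simp: transpose_def)
  have "(x, y) \<in> conn ?S" by (auto intro: conn_base)
  then have "(z, transpose x y z) \<in> conn ?S"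
    by (auto simp: transpose_def intro: conn_sym)
  moreover have "(transpose x y z, f z) \<in> conn ?S"
    using t by (intro conn_base) (auto simp: gr_def intro!: exI[of _ "transpose x y z"])
  ultimately show "p \<in> conn ?S" by (auto simp: z intro: conn_trans)
qed

lemma gr_transpose_sub':
  assumes "x \<in> D" "y \<in> D"
  shows "gr (f \<circ> transpose x y) D \<subseteq> conn (insert (x, y) (gr f D))"
proof -
  have "(f \<circ> transpose x y) \<circ> transpose x y = f" by (simp add: comp_assoc)
  then show ?thesis using gr_transpose_sub[OF assms, of "f \<circ> transpose x y"] by simp
qed

lemma ncl_transpose_le:
  assumes "finite D" "x \<in> D" "y \<in> D"
  shows "ncl D (gr (f \<circ> transpose x y) D) \<le> ncl D (gr f D) + 1"
proof -
  have "ncl D (gr (f \<circ> transpose x y) D) \<le> ncl D (insert (x, y) (gr (f \<circ> transpose x y) D)) + 1"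
    by (rule ncl_insert) fact
  also have "ncl D (insert (x, y) (gr (f \<circ> transpose x y) D)) \<le> ncl D (gr f D)"
    by (rule ncl_mono) (use assms gr_transpose_sub[of x D y f] in simp_all)
  finally show ?thesis by simp
qed

lemma ncl_transpose_merge:
  assumes "finite D" "inj_on f D" "\<And>x. x \<in> D \<Longrightarrow> f x \<in> D" "x \<in> D" "y \<in> D"
    "(x, y) \<notin> conn (gr f D)"
  shows "ncl D (gr (f \<circ> transpose x y) D) + 1 \<le> ncl D (gr f D)"
proof (rule ncl_strict)
  let ?S = "gr (f \<circ> transpose x y) D"
  have xy: "(x, y) \<in> conn ?S" by (rule conn_transpose) (use assms in auto)
  have "conn (insert (x, y) ?S) \<subseteq> conn ?S"
    by (rule conn_mono) (use xy in \<open>auto intro: conn_base\<close>)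
  then show "gr f D \<subseteq> conn ?S" using gr_transpose_sub[of x D y f] assms by blast
  show "(x, y) \<in> conn ?S" by fact
qed (use assms in auto)

section \<open>Closed maps and edge switches\<close>

text \<open>As the fourth power of \<open>r\<close> is the identity,
  \<open>r (r h) \<noteq> h\<close> forces every vertex to carry exactly four half-edges.
  Connectedness is left out because closing dipoles destroys it.\<close>

definition closed_map :: "'a set \<Rightarrow> ('a \<Rightarrow> 'a) \<Rightarrow> ('a \<Rightarrow> 'a) \<Rightarrow> ('a \<Rightarrow> bool) \<Rightarrow> bool" where
  "closed_map D r e w \<longleftrightarrow> finite D \<and>
     (\<forall>h\<in>D. r h \<in> D \<and> r (r (r (r h))) = h \<and> r (r h) \<noteq> h \<and> w (r h) = w h) \<and>
     (\<forall>h\<in>D. e h \<in> D \<and> e (e h) = h \<and> w (e h) \<noteq> w h)"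

definition mrel :: "'a set \<Rightarrow> ('a \<Rightarrow> 'a) \<Rightarrow> ('a \<Rightarrow> 'a) \<Rightarrow> ('a \<times> 'a) set" where
  "mrel D r e = gr r D \<union> gr e D"

definition nfaces :: "'a set \<Rightarrow> ('a \<Rightarrow> 'a) \<Rightarrow> ('a \<Rightarrow> 'a) \<Rightarrow> nat" where
  "nfaces D r e = ncl D (gr (\<lambda>h. r (e h)) D)"

definition nstraight :: "'a set \<Rightarrow> ('a \<Rightarrow> 'a) \<Rightarrow> ('a \<Rightarrow> 'a) \<Rightarrow> nat" where
  "nstraight D r e = ncl D (gr (\<lambda>h. r (r (e h))) D)"

definition ncomps :: "'a set \<Rightarrow> ('a \<Rightarrow> 'a) \<Rightarrow> ('a \<Rightarrow> 'a) \<Rightarrow> nat" where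
  "ncomps D r e = ncl D (mrel D r e)"

text \<open>The weights make both outcomes of a switch at a dipole side cost the same. Separating a
  component while gaining two faces and two straight orbits changes this number by 4 - 4 - 2 = -2,
  and -2 is also guaranteed when nothing is separated.\<close>

definition Psi :: "'a set \<Rightarrow> ('a \<Rightarrow> 'a) \<Rightarrow> ('a \<Rightarrow> 'a) \<Rightarrow> int" where
  "Psi D r e = 4 * int (ncomps D r e) - 2 * int (nfaces D r e) - int (nstraight D r e)"

text \<open>The two-edge switch of graph theory: \<open>a\<close> is glued to \<open>b\<close>, and
  their former partners to each other. For an involution \<open>e\<close> with
  \<open>e a = b\<close> nothing changes.\<close>

definition sw :: "('a \<Rightarrow> 'a) \<Rightarrow> 'a \<Rightarrow> 'a \<Rightarrow> 'a \<Rightarrow> 'a" where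
  "sw e a b = (\<lambda>h. if h = a then b else if h = b then a
     else if h = e a then e b else if h = e b then e a else e h)"

lemma closed_mapD:
  assumes "closed_map D r e w"
  shows "finite D" and "h \<in> D \<Longrightarrow> r h \<in> D" and "h \<in> D \<Longrightarrow> r (r (r (r h))) = h"
    and "h \<in> D \<Longrightarrow> r (r h) \<noteq> h" and "h \<in> D \<Longrightarrow> w (r h) = w h"
    and "h \<in> D \<Longrightarrow> e h \<in> D" and "h \<in> D \<Longrightarrow> e (e h) = h" and "h \<in> D \<Longrightarrow> w (e h) \<noteq> w h"
    and "h \<in> D \<Longrightarrow> e h \<noteq> h" and "h \<in> D \<Longrightarrow> r h \<noteq> h"
  using assms unfolding closed_map_def by metis+

lemma closed_map_inj:
  assumes "closed_map D r e w"
  shows "inj_on r D" and "inj_on e D" and "inj_on (\<lambda>h. r (e h)) D" and "inj_on (\<lambda>h. r (r (e h))) D"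
proof -
  note c = closed_mapD[OF assms]
  show 1: "inj_on r D" by (rule inj_onI) (metis c(3))
  show "inj_on e D" by (rule inj_onI) (metis c(7))
  show "inj_on (\<lambda>h. r (e h)) D" by (rule inj_onI) (metis c(3,6,7))
  show "inj_on (\<lambda>h. r (r (e h))) D" by (rule inj_onI) (metis c(3,6,7))
qed

text \<open>A straight walk reversed: \<open>e\<close> conjugates the straight step to its inverse, so a straight
  orbit invariant under \<open>e\<close> would contain a fixed point of \<open>e\<close> or of \<open>r\<^sup>2\<close>.\<close>

lemma straight_reversal:
  assumes "closed_map D r e w" "h \<in> D"
  shows "(h, e h) \<notin> conn (gr (\<lambda>h. r (r (e h))) D)"
proof
  note c = closed_mapD[OF assms(1)]
  let ?t = "\<lambda>h. r (r (e h))"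
  assume "(h, e h) \<in> conn (gr ?t D)"
  then obtain n where n: "e h = (?t ^^ n) h"
    using conn_gr_funpow[of D ?t h "e h"] c closed_map_inj[OF assms(1)] assms(2) by auto
  have tD: "?t z \<in> D" if "z \<in> D" for z using that c by auto
  have tn: "(?t ^^ k) z \<in> D" if "z \<in> D" for k z using funpow_in[of D ?t z k] tD that by auto
  have 1: "?t (e (?t z)) = e z" if "z \<in> D" for z using that c by auto
  have 2: "(?t ^^ k) (e ((?t ^^ k) z)) = e z" if "z \<in> D" for k z
    using that
  proof (induction k arbitrary: z)
    case (Suc k)
    have "(?t ^^ Suc k) (e ((?t ^^ Suc k) z)) = (?t ^^ k) (?t (e ((?t ^^ Suc k) z)))"
      by (simp only: funpow_Suc_right o_apply)
    also have "(?t ^^ Suc k) z = ?t ((?t ^^ k) z)" by simp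
    also have "(?t ^^ k) (?t (e (?t ((?t ^^ k) z)))) = (?t ^^ k) (e ((?t ^^ k) z))" using 1[OF tn[OF Suc(2)]] by simp
    finally show ?case using Suc by simp
  qed simp
  have injk: "x = y" if "(?t ^^ k) x = (?t ^^ k) y" "x \<in> D" "y \<in> D" for k x y
    using that
  proof (induction k)
    case (Suc k)
    then have "(?t ^^ k) x = (?t ^^ k) y"
      using closed_map_inj(4)[OF assms(1)] tn by (auto dest: inj_onD)
    then show ?case using Suc by auto
  qed simp
  show False
  proof (cases "even n")
    case True
    then obtain m where "n = m + m" by (metis evenE mult_2)
    then have "(?t ^^ m) (e ((?t ^^ m) h)) = (?t ^^ m) ((?t ^^ m) h)"
      using 2[OF assms(2)] n by (simp add: funpow_add)
    then have "e ((?t ^^ m) h) = (?t ^^ m) h" using injk tn c assms(2) by meson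
    then show False using c(9) tn assms(2) by meson
  next
    case False
    then obtain m where "n = m + Suc m" by (metis oddE mult_2 add_Suc_right Suc_eq_plus1)
    then have "(?t ^^ m) (e ((?t ^^ m) h)) = (?t ^^ m) ((?t ^^ Suc m) h)"
      using 2[OF assms(2), of m] n by (simp only: funpow_add o_apply)
    then have "e ((?t ^^ m) h) = (?t ^^ Suc m) h" using injk tn c assms(2) by meson
    then have "e ((?t ^^ m) h) = r (r (e ((?t ^^ m) h)))" by simp
    moreover have "e ((?t ^^ m) h) \<in> D" using tn c assms(2) by meson
    ultimately show False using c(4) by metis
  qed
qed

text \<open>Meant for \<open>f'\<close> after and \<open>f\<close> before a switch: undoing it
  composes with two commuting transpositions. Each changes the number of orbits by at most one, and
  lowers it when its two points lie in different orbits. In the last claim the second transposition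
  still merges, since \<open>b\<close> lies in neither of the orbits fused by the first.\<close>

lemma double_transpose:
  assumes "finite D" "inj_on f' D" "\<And>x. x \<in> D \<Longrightarrow> f' x \<in> D" "a \<in> D" "b \<in> D" "x \<in> D" "y \<in> D"
    and f: "\<And>h. h \<in> D \<Longrightarrow> f h = f' (transpose a y (transpose b x h))"
    and d: "a \<noteq> b" "a \<noteq> x" "y \<noteq> b" "y \<noteq> x"
  shows "ncl D (gr f D) \<le> ncl D (gr f' D) + 2"
    and "(a, y) \<notin> conn (gr f' D) \<Longrightarrow> ncl D (gr f D) \<le> ncl D (gr f' D)"
    and "(b, x) \<notin> conn (gr f' D) \<Longrightarrow> ncl D (gr f D) \<le> ncl D (gr f' D)"
    and "(a, y) \<notin> conn (gr f' D) \<Longrightarrow> (b, x) \<notin> conn (gr f' D) \<Longrightarrow> (b, a) \<notin> conn (gr f' D)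
      \<Longrightarrow> (b, y) \<notin> conn (gr f' D) \<Longrightarrow> ncl D (gr f D) + 2 \<le> ncl D (gr f' D)"
proof -
  let ?g = "f' \<circ> transpose a y" and ?k = "f' \<circ> transpose b x"
  have f1: "gr f D = gr (?g \<circ> transpose b x) D" using f by (auto simp: gr_def)
  have "transpose a y (transpose b x h) = transpose b x (transpose a y h)" for h
    using d by (auto simp: transpose_def)
  then have f2: "gr f D = gr (?k \<circ> transpose a y) D" using f by (auto simp: gr_def)
  have u: "ncl D (gr f D) \<le> ncl D (gr ?g D) + 1" unfolding f1
    by (rule ncl_transpose_le) fact+
  have u': "ncl D (gr f D) \<le> ncl D (gr ?k D) + 1" unfolding f2
    by (rule ncl_transpose_le) fact+
  have v: "ncl D (gr ?g D) \<le> ncl D (gr f' D) + 1"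
    by (rule ncl_transpose_le) fact+
  show "ncl D (gr f D) \<le> ncl D (gr f' D) + 2" using u v by simp
  show "ncl D (gr f D) \<le> ncl D (gr f' D)" if "(b, x) \<notin> conn (gr f' D)"
    using u' ncl_transpose_merge[of D f' b x, OF assms(1-3)] assms(4-7) that by simp
  { assume 1: "(a, y) \<notin> conn (gr f' D)"
    have m: "ncl D (gr ?g D) + 1 \<le> ncl D (gr f' D)"
      using ncl_transpose_merge[of D f' a y, OF assms(1-3)] assms(4-7) 1 by simp
    then show "ncl D (gr f D) \<le> ncl D (gr f' D)" using u by simp
    assume 2: "(b, x) \<notin> conn (gr f' D)" "(b, a) \<notin> conn (gr f' D)" "(b, y) \<notin> conn (gr f' D)"
    have gD: "?g z \<in> D" if "z \<in> D" for z using that assms by (auto simp: transpose_def)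
    have ginj: "inj_on ?g D"
      by (rule comp_inj_on) (use assms in \<open>auto simp: inj_on_transpose\<close>)
    have "(b, x) \<notin> conn (gr ?g D)"
    proof
      assume "(b, x) \<in> conn (gr ?g D)"
      then have "(b, x) \<in> conn (insert (a, y) (gr f' D))"
        using conn_mono[OF gr_transpose_sub'[of a D y f']] assms(4,7) by blast
      then show False using conn_insert[of b x a y] 2 by blast
    qed
    then have "ncl D (gr f D) + 1 \<le> ncl D (gr ?g D)"
      unfolding f1 using ncl_transpose_merge[OF assms(1) ginj gD] assms(5,6) by blast
    then show "ncl D (gr f D) + 2 \<le> ncl D (gr f' D)" using m by simp }
qed

locale switch =
  fixes D r e w a b
  assumes cm: "closed_map D r e w" and aD: "a \<in> D" and bD: "b \<in> D" and wa: "w a" and wb: "\<not> w b"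
    and nt: "e a \<noteq> b"
begin

abbreviation "e' \<equiv> sw e a b"
abbreviation "x \<equiv> e a"
abbreviation "y \<equiv> e b"

lemmas c = closed_mapD[OF cm]

lemma ne: "a \<noteq> b" "a \<noteq> x" "a \<noteq> y" "b \<noteq> x" "b \<noteq> y" "x \<noteq> y"
  using c aD bD wa wb nt by metis+

lemma xyD: "x \<in> D" "y \<in> D"
  using c aD bD by auto

lemma sw_simps: "e' a = b" "e' b = a" "e' x = y" "e' y = x"
  using ne by (auto simp: sw_def)

lemma sw_other: "h \<noteq> a \<Longrightarrow> h \<noteq> b \<Longrightarrow> h \<noteq> x \<Longrightarrow> h \<noteq> y \<Longrightarrow> e' h = e h"
  by (simp add: sw_def)

lemma closed_map_sw: "closed_map D r e' w"
proof -
  have "e' h \<in> D \<and> e' (e' h) = h \<and> w (e' h) \<noteq> w h" if h: "h \<in> D" for h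
  proof (cases "h \<in> {a, b, x, y}")
    case True
    then show ?thesis using sw_simps aD bD xyD wa wb c(8)[OF aD] c(8)[OF bD] by auto
  next
    case False
    then have "e h \<notin> {a, b, x, y}" using c(7) h aD bD by (metis insertE insertI1 insertI2 singletonD)
    then show ?thesis using False sw_other h c by simp
  qed
  then show ?thesis using cm by (simp add: closed_map_def)
qed

lemma e_via: "h \<in> D \<Longrightarrow> e h = e' (transpose a y (transpose b x h))"
  using ne sw_simps sw_other c(7) aD bD by (auto simp: transpose_def)

text \<open>The new edges link \<open>a\<close> with \<open>b\<close> and \<open>x\<close> with
  \<open>y\<close>. The single extra link from \<open>a\<close> to \<open>x\<close> connects all
  four and thereby replaces both old edges.\<close>

lemma rel_sub: "gr e D \<union> T \<subseteq> conn (insert (a, x) (gr e' D \<union> T))"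
proof -
  let ?S = "insert (a, x) (gr e' D \<union> T)"
  have ax: "(a, x) \<in> conn ?S" by (auto intro: conn_base)
  have ab: "(a, b) \<in> conn ?S" using aD sw_simps by (intro conn_base) (auto simp: gr_def)
  have xy: "(x, y) \<in> conn ?S" using xyD sw_simps by (intro conn_base) (auto simp: gr_def)
  have by': "(b, y) \<in> conn ?S" by (meson conn_trans conn_sym ax ab xy)
  have "(h, e h) \<in> conn ?S" if h: "h \<in> D" for h
  proof (cases "h \<in> {a, b, x, y}")
    case True
    then show ?thesis using ax by' c(7) aD bD by (auto intro: conn_sym)
  next
    case False
    then show ?thesis using h sw_other by (intro conn_base) (auto simp: gr_def)
  qed
  then show ?thesis by (auto simp: gr_def intro: conn_base)
qed

lemma ncl_sw: "ncl D (gr e' D \<union> T) \<le> ncl D (gr e D \<union> T) + 1"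
proof -
  have "ncl D (gr e' D \<union> T) \<le> ncl D (insert (a, x) (gr e' D \<union> T)) + 1"
    by (rule ncl_insert) (fact c(1))
  also have "ncl D (insert (a, x) (gr e' D \<union> T)) \<le> ncl D (gr e D \<union> T)"
    by (rule ncl_mono) (use c(1) rel_sub in auto)
  finally show ?thesis by simp
qed

lemma ncomps_sw: "ncomps D r e' \<le> ncomps D r e + 1"
  using ncl_sw[of "gr r D"] by (simp add: ncomps_def mrel_def Un_commute)

lemma ncomps_sw_nonsep:
  assumes "(a, x) \<in> conn (mrel D r e')"
  shows "ncomps D r e' \<le> ncomps D r e"
proof -
  have "insert (a, x) (gr e' D \<union> gr r D) \<subseteq> conn (mrel D r e')"
    using assms by (auto simp: mrel_def intro: conn_base)
  then have "conn (insert (a, x) (gr e' D \<union> gr r D)) \<subseteq> conn (mrel D r e')"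
    by (rule conn_mono)
  then have "mrel D r e \<subseteq> conn (mrel D r e')"
    using rel_sub[of "gr r D"] by (auto simp: mrel_def)
  then show ?thesis unfolding ncomps_def by (intro ncl_mono) (use c(1) in auto)
qed

lemma face_sub: "gr (\<lambda>h. r (e' h)) D \<subseteq> conn (mrel D r e')"
  and straight_sub: "gr (\<lambda>h. r (r (e' h))) D \<subseteq> conn (mrel D r e')"
proof -
  note c' = closed_mapD[OF closed_map_sw]
  have 1: "(h, e' h) \<in> conn (mrel D r e')" if "h \<in> D" for h
    using that by (intro conn_base) (auto simp: mrel_def gr_def)
  have 2: "(h, r h) \<in> conn (mrel D r e')" if "h \<in> D" for h
    using that by (intro conn_base) (auto simp: mrel_def gr_def)
  have 3: "(h, r (e' h)) \<in> conn (mrel D r e')" if "h \<in> D" for h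
    using conn_trans[OF 1[OF that] 2] that c' by simp
  have 4: "(h, r (r (e' h))) \<in> conn (mrel D r e')" if "h \<in> D" for h
    using conn_trans[OF 3[OF that] 2] that c' by simp
  show "gr (\<lambda>h. r (e' h)) D \<subseteq> conn (mrel D r e')"
    "gr (\<lambda>h. r (r (e' h))) D \<subseteq> conn (mrel D r e')"
    using 3 4 by (auto simp: gr_def)
qed

lemmas face_double = double_transpose[OF c(1) closed_map_inj(3)[OF closed_map_sw] _ aD bD xyD, of "\<lambda>h. r (e h)"]
lemmas straight_double = double_transpose[OF c(1) closed_map_inj(4)[OF closed_map_sw] _ aD bD xyD, of "\<lambda>h. r (r (e h))"]

lemma nfaces_sw:
  shows "nfaces D r e \<le> nfaces D r e' + 2"
    and "(a, y) \<notin> conn (gr (\<lambda>h. r (e' h)) D) \<Longrightarrow> nfaces D r e \<le> nfaces D r e'"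
    and "(b, x) \<notin> conn (gr (\<lambda>h. r (e' h)) D) \<Longrightarrow> nfaces D r e \<le> nfaces D r e'"
    and "(a, y) \<notin> conn (gr (\<lambda>h. r (e' h)) D) \<Longrightarrow> (b, x) \<notin> conn (gr (\<lambda>h. r (e' h)) D)
      \<Longrightarrow> (b, a) \<notin> conn (gr (\<lambda>h. r (e' h)) D) \<Longrightarrow> (b, y) \<notin> conn (gr (\<lambda>h. r (e' h)) D)
      \<Longrightarrow> nfaces D r e + 2 \<le> nfaces D r e'"
  unfolding nfaces_def
  by (rule face_double; use closed_mapD(2,6)[OF closed_map_sw] ne e_via in auto)+

lemma nstraight_sw:
  shows "nstraight D r e \<le> nstraight D r e' + 2"
    and "(a, y) \<notin> conn (gr (\<lambda>h. r (r (e' h))) D) \<Longrightarrow> (b, x) \<notin> conn (gr (\<lambda>h. r (r (e' h))) D)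
      \<Longrightarrow> (b, a) \<notin> conn (gr (\<lambda>h. r (r (e' h))) D) \<Longrightarrow> (b, y) \<notin> conn (gr (\<lambda>h. r (r (e' h))) D)
      \<Longrightarrow> nstraight D r e + 2 \<le> nstraight D r e'"
  unfolding nstraight_def
  by (rule straight_double; use closed_mapD(2,6)[OF closed_map_sw] ne e_via in auto)+

text \<open>Once \<open>a\<close>, \<open>b\<close> and \<open>x\<close>, \<open>y\<close> lie in
  different components, only \<open>a\<close> and \<open>b\<close> could still share an orbit. For
  straight walks this is impossible, because \<open>e'\<close> exchanges them and no straight orbit
  is its own reversal. For faces it has to be assumed.\<close>

lemma sep_counts:
  assumes "(a, x) \<notin> conn (mrel D r e')" "(b, a) \<notin> conn (gr (\<lambda>h. r (e' h)) D)"
  shows "nfaces D r e + 2 \<le> nfaces D r e'" and "nstraight D r e + 2 \<le> nstraight D r e'"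
proof -
  let ?C = "conn (mrel D r e')"
  have ab: "(a, b) \<in> ?C" using aD sw_simps by (intro conn_base) (auto simp: gr_def mrel_def)
  have xy: "(x, y) \<in> ?C" using xyD sw_simps by (intro conn_base) (auto simp: gr_def mrel_def)
  have n: "(a, y) \<notin> ?C" "(b, x) \<notin> ?C" "(b, y) \<notin> ?C"
    using assms(1) ab xy by (meson conn_trans conn_sym)+
  have f: "conn (gr (\<lambda>h. r (e' h)) D) \<subseteq> ?C" by (rule conn_mono[OF face_sub])
  have s: "conn (gr (\<lambda>h. r (r (e' h))) D) \<subseteq> ?C" by (rule conn_mono[OF straight_sub])
  show "nfaces D r e + 2 \<le> nfaces D r e'" using n f assms(2) by (intro nfaces_sw(4)) auto
  have "(b, a) \<notin> conn (gr (\<lambda>h. r (r (e' h))) D)"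
    using straight_reversal[OF closed_map_sw bD] sw_simps by simp
  then show "nstraight D r e + 2 \<le> nstraight D r e'" using n s by (intro nstraight_sw(2)) auto
qed

lemma loop_not_conn:
  assumes "f u = v" "f v = u" "u \<in> D" "v \<in> D" "z \<noteq> u" "z \<noteq> v"
    "inj_on f D" "\<And>h. h \<in> D \<Longrightarrow> f h \<in> D"
  shows "(u, z) \<notin> conn (gr f D)" "(z, u) \<notin> conn (gr f D)"
proof -
  have "(h \<in> {u, v}) = (k \<in> {u, v})" if "(h, k) \<in> gr f D" for h k
  proof -
    have k: "k = f h" "h \<in> D" using that by (auto simp: gr_def)
    have "f h = u \<Longrightarrow> h = v" "f h = v \<Longrightarrow> h = u" using assms k by (metis inj_onD)+
    then show ?thesis using k assms by auto
  qed
  then show "(u, z) \<notin> conn (gr f D)" "(z, u) \<notin> conn (gr f D)"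
    using conn_closed[of u z "gr f D" "{u, v}"] conn_closed[of z u "gr f D" "{u, v}"] assms by auto
qed

text \<open>If the switch disconnects the map, both orbit counts grow by two.  Otherwise a U-dipole splits
  off two straight orbits and an O-dipole two faces.\<close>

lemma Psi_sw_dipole:
  assumes j: "j \<in> {1, 2, 3 :: nat}"
    and ed: "\<And>i. i \<in> {1, 2, 3} - {j} \<Longrightarrow> e ((r ^^ i) a) = (r ^^ (4 - i)) b"
  shows "Psi D r e' + 2 \<le> Psi D r e"
proof -
  note c' = closed_mapD[OF closed_map_sw]
  have r2: "(r ^^ 2) h = r (r h)" and r3: "(r ^^ 3) h = r (r (r h))" for h
    by (simp_all add: numeral_eq_Suc)
  have rD: "r a \<in> D" "r (r a) \<in> D" "r (r (r a)) \<in> D" "r b \<in> D" "r (r b) \<in> D" "r (r (r b)) \<in> D"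
    using c aD bD by auto
  have rne: "r a \<noteq> a" "r (r a) \<noteq> a" "r (r (r a)) \<noteq> a" "r b \<noteq> b" "r (r b) \<noteq> b" "r (r (r b)) \<noteq> b"
    using c aD bD by metis+
  have wr: "w (r a)" "w (r (r a))" "w (r (r (r a)))" "\<not> w (r b)" "\<not> w (r (r b))" "\<not> w (r (r (r b)))"
    using c aD bD wa wb by simp_all
  have wxy: "\<not> w x" "w y" using c aD bD wa wb by metis+
  have inner: "e' h = e h" if "h \<in> D" "h \<noteq> a" "h \<noteq> b" "e h \<noteq> a" "e h \<noteq> b" for h
    using that sw_other c(7) aD bD by metis
  have xn: "x \<noteq> r (r (r b))" if "e (r a) = r (r (r b))" using that c(7) rD aD rne by metis
  have xn2: "x \<noteq> r (r b)" if "e (r (r a)) = r (r b)" using that c(7) rD aD rne by metis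
  have xn3: "x \<noteq> r b" if "e (r (r (r a))) = r b" using that c(7) rD aD rne by metis
  have yn: "y \<noteq> r a" if "e (r a) = r (r (r b))" using that c(7) rD bD rne by metis
  have yn2: "y \<noteq> r (r a)" if "e (r (r a)) = r (r b)" using that c(7) rD bD rne by metis
  have yn3: "y \<noteq> r (r (r a))" if "e (r (r (r a))) = r b" using that c(7) rD bD rne by metis
  have i1: "e' (r a) = r (r (r b))" if "e (r a) = r (r (r b))"
    using that inner[of "r a"] rD rne wr wa wb by metis
  have i2: "e' (r (r b)) = r (r a)" "e' (r (r a)) = r (r b)" if h: "e (r (r a)) = r (r b)"
  proof -
    have k: "e (r (r b)) = r (r a)" using h c(7) rD by metis
    show "e' (r (r b)) = r (r a)" using k inner[of "r (r b)"] rD rne wr wa wb by metis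
    show "e' (r (r a)) = r (r b)" using h inner[of "r (r a)"] rD rne wr wa wb by metis
  qed
  have i3: "e' (r b) = r (r (r a))" if h: "e (r (r (r a))) = r b"
  proof -
    have k: "e (r b) = r (r (r a))" using h c(7) rD by metis
    then show ?thesis using inner[of "r b"] rD rne wr wa wb by metis
  qed
  let ?s = "\<lambda>h. r (e' h)" and ?t = "\<lambda>h. r (r (e' h))"
  note loopf = loop_not_conn[OF _ _ _ _ _ _ closed_map_inj(3)[OF closed_map_sw]]
  note loops = loop_not_conn[OF _ _ _ _ _ _ closed_map_inj(4)[OF closed_map_sw]]
  have sD: "?s h \<in> D" "?t h \<in> D" if "h \<in> D" for h using that c' by auto
  \<comment> \<open>The new edge from \<open>a\<close> to \<open>b\<close> closes up with an inner
    edge to a cycle of length two: with the third edge the face \<open>{a, r b}\<close>, with the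
    first the face \<open>{b, r a}\<close>, with the middle one the straight orbits
    \<open>{a, r (r b)}\<close> and \<open>{b, r (r a)}\<close>. Such a cycle shares no orbit with
    anything else.\<close>
  have La: "(a, z) \<notin> conn (gr ?s D)" "(z, a) \<notin> conn (gr ?s D)"
    if "e (r (r (r a))) = r b" "z \<noteq> a" "z \<noteq> r b" for z
    using loopf[of a "r b" z] that i3 sw_simps rD aD c sD by auto
  have Lb: "(b, z) \<notin> conn (gr ?s D)" "(z, b) \<notin> conn (gr ?s D)"
    if "e (r a) = r (r (r b))" "z \<noteq> b" "z \<noteq> r a" for z
    using loopf[of b "r a" z] that i1 sw_simps rD bD c sD by auto
  have Sa: "(a, z) \<notin> conn (gr ?t D)" "(z, a) \<notin> conn (gr ?t D)"
    if "e (r (r a)) = r (r b)" "z \<noteq> a" "z \<noteq> r (r b)" for z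
    using loops[of a "r (r b)" z] that i2 sw_simps rD aD c sD by auto
  have Sb: "(b, z) \<notin> conn (gr ?t D)" "(z, b) \<notin> conn (gr ?t D)"
    if "e (r (r a)) = r (r b)" "z \<noteq> b" "z \<noteq> r (r a)" for z
    using loops[of b "r (r a)" z] that i2 sw_simps rD bD c sD by auto
  have e1: "e (r a) = r (r (r b))" if "j \<noteq> 1" using ed[of 1] that by (simp add: r3)
  have e2: "e (r (r a)) = r (r b)" if "j \<noteq> 2" using ed[of 2] that by (simp add: r2)
  have e3: "e (r (r (r a))) = r b" if "j \<noteq> 3" using ed[of 3] that by (simp add: r3)
  have ba: "(b, a) \<notin> conn (gr ?s D)"
  proof (cases "j = 1")
    case True
    then have "e (r (r (r a))) = r b" using e3 by simp
    then show ?thesis using La[of b] ne rne by simp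
  next
    case False
    then show ?thesis using Lb[of a] e1 ne rne by simp
  qed
  show ?thesis
  proof (cases "(a, x) \<in> conn (mrel D r e')")
    case False
    then show ?thesis using sep_counts[OF False ba] ncomps_sw unfolding Psi_def by linarith
  next
    case True
    note cle = ncomps_sw_nonsep[OF True]
    show ?thesis
    proof (cases "j = 2")
      case True
      then have E: "e (r a) = r (r (r b))" "e (r (r (r a))) = r b" using e1 e3 by auto
      have "nfaces D r e + 2 \<le> nfaces D r e'"
      proof (rule nfaces_sw(4))
        show "(a, y) \<notin> conn (gr ?s D)" using La(1)[OF E(2), of y] ne wr wxy by metis
        show "(b, x) \<notin> conn (gr ?s D)" using Lb(1)[OF E(1), of x] ne wr wxy by metis
        show "(b, y) \<notin> conn (gr ?s D)" using Lb(1)[OF E(1), of y] ne yn[OF E(1)] by metis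
      qed (fact ba)
      then show ?thesis using cle nstraight_sw(1) unfolding Psi_def by linarith
    next
      case False
      then have E: "e (r (r a)) = r (r b)" using e2 by auto
      have "nstraight D r e + 2 \<le> nstraight D r e'"
      proof (rule nstraight_sw(2))
        show "(a, y) \<notin> conn (gr ?t D)" using Sa(1)[OF E, of y] ne wr wxy by metis
        show "(b, x) \<notin> conn (gr ?t D)" using Sb(1)[OF E, of x] ne wr wxy by metis
        show "(b, y) \<notin> conn (gr ?t D)" using Sb(1)[OF E, of y] ne yn2[OF E] by metis
        show "(b, a) \<notin> conn (gr ?t D)" using Sb(1)[OF E, of a] ne rne wr wa by metis
      qed
      moreover have "nfaces D r e \<le> nfaces D r e'"
      proof (cases "j = 1")
        case True
        then have E: "e (r (r (r a))) = r b" using e3 by auto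
        then have "(a, y) \<notin> conn (gr ?s D)" using La[OF E] ne wr wxy by metis
        then show ?thesis by (rule nfaces_sw(2))
      next
        case False
        then have E: "e (r a) = r (r (r b))" using e1 by auto
        then have "(b, x) \<notin> conn (gr ?s D)" using Lb[OF E] ne wr wxy by metis
        then show ?thesis by (rule nfaces_sw(3))
      qed
      ultimately show ?thesis using cle unfolding Psi_def by linarith
    qed
  qed
qed

end

section \<open>Additivity of the counts over unions of components\<close>

lemma closed_map_sub:
  assumes "closed_map D r e w" "X \<subseteq> D" "\<And>h. h \<in> X \<Longrightarrow> r h \<in> X" "\<And>h. h \<in> X \<Longrightarrow> e h \<in> X"
  shows "closed_map X r e w"
  using assms finite_subset[OF assms(2) closed_mapD(1)[OF assms(1)]] unfolding closed_map_def by (simp add: subset_iff)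

lemma closed_back:
  assumes "closed_map D r e w" "\<And>h. h \<in> X \<Longrightarrow> r h \<in> X" "h \<in> D" "r h \<in> X"
  shows "h \<in> X"
  using assms closed_mapD(3)[OF assms(1)] by metis

lemma rclosed_iff:
  assumes "closed_map D r e w" "\<And>h. h \<in> X \<Longrightarrow> r h \<in> X" "h \<in> D"
  shows "r h \<in> X \<longleftrightarrow> h \<in> X"
  using assms closed_back by metis

lemma eclosed_iff:
  assumes "closed_map D r e w" "\<And>h. h \<in> X \<Longrightarrow> e h \<in> X" "h \<in> D"
  shows "e h \<in> X \<longleftrightarrow> h \<in> X"
  using assms closed_mapD(7)[OF assms(1)] by metis

lemma mrel_closed:
  assumes "closed_map D r e w" "\<And>h. h \<in> X \<Longrightarrow> r h \<in> X" "\<And>h. h \<in> X \<Longrightarrow> e h \<in> X" "(u, v) \<in> mrel D r e"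
  shows "u \<in> X \<longleftrightarrow> v \<in> X"
  using assms rclosed_iff[OF assms(1,2)] eclosed_iff[OF assms(1,3)] by (auto simp: mrel_def gr_def)

lemma ncl_gr_sub:
  assumes "X \<subseteq> D" "\<And>h. h \<in> D \<Longrightarrow> f h \<in> X \<longleftrightarrow> h \<in> X"
  shows "ncl X (gr f D) = ncl X (gr f X)"
proof -
  have "cls (gr f D) h = cls (gr f X) h" if "h \<in> X" for h
    by (rule cls_restrict[where X = X]) (use assms that in \<open>auto simp: gr_def\<close>)
  then show ?thesis by (simp add: ncl_def)
qed

context
  fixes D r e w X
  assumes cm: "closed_map D r e w" and X: "X \<subseteq> D" "\<And>h. h \<in> X \<Longrightarrow> r h \<in> X" "\<And>h. h \<in> X \<Longrightarrow> e h \<in> X"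
begin

lemma face_closed: "h \<in> D \<Longrightarrow> r (e h) \<in> X \<longleftrightarrow> h \<in> X"
  using rclosed_iff[OF cm X(2)] eclosed_iff[OF cm X(3)] closed_mapD(6)[OF cm] by metis

lemma straight_closed: "h \<in> D \<Longrightarrow> r (r (e h)) \<in> X \<longleftrightarrow> h \<in> X"
  using rclosed_iff[OF cm X(2)] eclosed_iff[OF cm X(3)] closed_mapD(2,6)[OF cm] by metis

lemma nfaces_sub: "ncl X (gr (\<lambda>h. r (e h)) D) = nfaces X r e"
  unfolding nfaces_def by (rule ncl_gr_sub) (use X face_closed in auto)

lemma nstraight_sub: "ncl X (gr (\<lambda>h. r (r (e h))) D) = nstraight X r e"
  unfolding nstraight_def by (rule ncl_gr_sub) (use X straight_closed in auto)

lemma cls_mrel_sub: "h \<in> X \<Longrightarrow> cls (mrel D r e) h = cls (mrel X r e) h"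
  using X by (intro cls_restrict[where X = X])
    (auto simp: mrel_def gr_def rclosed_iff[OF cm X(2)] eclosed_iff[OF cm X(3)])

lemma ncomps_sub: "ncl X (mrel D r e) = ncomps X r e"
  using cls_mrel_sub unfolding ncomps_def ncl_def by simp

end

lemma counts_Un:
  assumes "closed_map D r e w" "X \<subseteq> D" "\<And>h. h \<in> X \<Longrightarrow> r h \<in> X" "\<And>h. h \<in> X \<Longrightarrow> e h \<in> X"
  shows "nfaces D r e = nfaces X r e + nfaces (D - X) r e"
    and "nstraight D r e = nstraight X r e + nstraight (D - X) r e"
    and "ncomps D r e = ncomps X r e + ncomps (D - X) r e"
    and "closed_map (D - X) r e w"
proof -
  note c = closed_mapD[OF assms(1)]
  have Y: "D - X \<subseteq> D" "\<And>h. h \<in> D - X \<Longrightarrow> r h \<in> D - X" "\<And>h. h \<in> D - X \<Longrightarrow> e h \<in> D - X"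
    using rclosed_iff[OF assms(1,3)] eclosed_iff[OF assms(1,4)] c(2,6) by auto
  have D: "D = X \<union> (D - X)" using assms(2) by auto
  have fin: "finite X" "finite (D - X)" using c(1) assms(2) finite_subset by auto
  show "closed_map (D - X) r e w" by (rule closed_map_sub) (use assms Y in auto)
  have "nfaces D r e = ncl (X \<union> (D - X)) (gr (\<lambda>h. r (e h)) D)" using D by (simp add: nfaces_def)
  also have "\<dots> = ncl X (gr (\<lambda>h. r (e h)) D) + ncl (D - X) (gr (\<lambda>h. r (e h)) D)"
    by (rule ncl_Un) (use fin face_closed[OF assms] in \<open>auto simp: gr_def\<close>)
  finally show "nfaces D r e = nfaces X r e + nfaces (D - X) r e"
    using nfaces_sub[OF assms] nfaces_sub[OF assms(1) Y] by simp
  have "nstraight D r e = ncl (X \<union> (D - X)) (gr (\<lambda>h. r (r (e h))) D)" using D by (simp add: nstraight_def)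
  also have "\<dots> = ncl X (gr (\<lambda>h. r (r (e h))) D) + ncl (D - X) (gr (\<lambda>h. r (r (e h))) D)"
    by (rule ncl_Un) (use fin straight_closed[OF assms] in \<open>auto simp: gr_def\<close>)
  finally show "nstraight D r e = nstraight X r e + nstraight (D - X) r e"
    using nstraight_sub[OF assms] nstraight_sub[OF assms(1) Y] by simp
  have "ncomps D r e = ncl (X \<union> (D - X)) (mrel D r e)" using D by (simp add: ncomps_def)
  also have "\<dots> = ncl X (mrel D r e) + ncl (D - X) (mrel D r e)"
    by (rule ncl_Un) (use fin in simp_all, rule mrel_closed[OF assms(1,3,4)], simp_all)
  finally show "ncomps D r e = ncomps X r e + ncomps (D - X) r e"
    using ncomps_sub[OF assms] ncomps_sub[OF assms(1) Y] by simp
qed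

section \<open>Short cycles\<close>

text \<open>Sum over the cycles \<open>C\<close> of \<open>|C \<inter> Bad| + 20 \<le> 5 |C| + 10 [C is a 2-cycle]\<close>.\<close>

lemma cycle_count:
  assumes "finite D" "inj_on f D" "\<And>h. h \<in> D \<Longrightarrow> f h \<in> D"
    and odd: "\<And>h. h \<in> D \<Longrightarrow> f h \<noteq> h" "\<And>h. h \<in> D \<Longrightarrow> f (f (f h)) \<noteq> h"
    and two: "\<And>h. h \<in> D \<Longrightarrow> f (f h) = h \<Longrightarrow> h \<in> M \<or> f h \<in> M"
  shows "card {h \<in> D. f (f (f (f h))) \<noteq> h} + 20 * ncl D (gr f D)
     \<le> 5 * card D + 10 * card (cls (gr f D) ` {h \<in> M \<inter> D. f (f h) = h})"
proof -
  let ?R = "gr f D"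
  let ?B = "{h \<in> D. f (f (f (f h))) \<noteq> h}"
  let ?M = "cls ?R ` {h \<in> M \<inter> D. f (f h) = h}"
  have cl: "u \<in> D \<longleftrightarrow> v \<in> D" if "(u, v) \<in> ?R" for u v using that assms(3) by (auto simp: gr_def)
  have sub: "cls ?R h \<subseteq> D" if "h \<in> D" for h
    using conn_closed[of h _ ?R D] cl that by (auto simp: cls_def)
  have step: "f h \<in> C" if "h \<in> C" "C = cls ?R k" "k \<in> D" for h k C
  proof -
    have "h \<in> D" using sub that by auto
    then have "(h, f h) \<in> conn ?R" by (intro conn_base) (auto simp: gr_def)
    then show ?thesis using that by (auto simp: cls_def intro: conn_trans)
  qed
  have main: "card (C \<inter> ?B) + 20 \<le> 5 * card C + (if C \<in> ?M then 10 else 0)" if CD: "C \<in> cls ?R ` D" for C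
  proof -
    obtain k where k: "k \<in> D" "C = cls ?R k" using CD by auto
    have fC: "finite C" "C \<subseteq> D" unfolding k(2) using sub[OF k(1)] assms(1) finite_subset by blast+
    have in2: "k \<in> C" "f k \<in> C" using k step by auto
    show ?thesis
    proof (cases "\<exists>h\<in>C. f (f h) = h")
      case True
      then obtain h where h: "h \<in> C" "f (f h) = h" by auto
      have hD: "h \<in> D" using h fC by auto
      have Ch: "C = cls ?R h" using h k by (simp add: cls_eq_iff) (simp add: cls_def)
      have fh: "f h \<in> C" using step h k by auto
      have "C \<subseteq> {h, f h}"
      proof
        fix z assume "z \<in> C"
        then have "(h, z) \<in> conn ?R" using Ch by (simp add: cls_def)
        then obtain n where "z = (f ^^ n) h" using conn_gr_funpow[OF assms(1-3) hD] by blast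
        moreover have "(f ^^ n) h \<in> {h, f h}" by (induction n) (use h in auto)
        ultimately show "z \<in> {h, f h}" by simp
      qed
      then have CE: "C = {h, f h}" using h fh by auto
      then have "C \<inter> ?B = {}" using h by auto
      moreover have "card C = 2" using CE odd(1)[OF hD] by auto
      moreover have "C \<in> ?M"
      proof -
        have "h \<in> M \<or> f h \<in> M" using two hD h by auto
        moreover have "C = cls ?R (f h)" using fh k by (simp add: cls_eq_iff) (simp add: cls_def)
        ultimately show ?thesis using Ch hD h assms(3) by auto
      qed
      ultimately show ?thesis by simp
    next
      case False
      have four: "f (f k) \<in> C" "f (f (f k)) \<in> C" "f (f (f (f k))) \<in> C"
        using step k in2 by auto
      have d: "k \<noteq> f k" "k \<noteq> f (f k)" "k \<noteq> f (f (f k))" "f k \<noteq> f (f k)" "f k \<noteq> f (f (f k))"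
        "f (f k) \<noteq> f (f (f k))"
        using odd False k in2 four fC by (metis subsetD)+
      have c4: "card {k, f k, f (f k), f (f (f k))} = 4" using d by auto
      then have 4: "4 \<le> card C" using card_mono[OF fC(1), of "{k, f k, f (f k), f (f (f k))}"] in2 four by auto
      show ?thesis
      proof (cases "C \<inter> ?B = {}")
        case True then show ?thesis unfolding True using 4 by simp
      next
        case nB: False
        then obtain h where h: "h \<in> C" "f (f (f (f h))) \<noteq> h" by auto
        have s: "f h \<in> C" "f (f h) \<in> C" "f (f (f h)) \<in> C" "f (f (f (f h))) \<in> C"
          using step k h by auto
        have "h \<noteq> f h" "h \<noteq> f (f h)" "h \<noteq> f (f (f h))" "f h \<noteq> f (f h)" "f h \<noteq> f (f (f h))"
          "f (f h) \<noteq> f (f (f h))" "f h \<noteq> f (f (f (f h)))" "f (f h) \<noteq> f (f (f (f h)))"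
          "f (f (f h)) \<noteq> f (f (f (f h)))"
          using odd False h s fC by (metis subsetD)+
        then have "card {h, f h, f (f h), f (f (f h)), f (f (f (f h)))} = 5" using h by auto
        then have "5 \<le> card C"
          using card_mono[OF fC(1), of "{h, f h, f (f h), f (f (f h)), f (f (f (f h)))}"] h s by auto
        moreover have "card (C \<inter> ?B) \<le> card C" using fC by (simp add: card_mono)
        ultimately show ?thesis by simp
      qed
    qed
  qed
  have Msub: "?M \<subseteq> cls ?R ` D" by auto
  have "(\<Sum>C\<in>cls ?R ` D. card (C \<inter> ?B) + 20)
      \<le> (\<Sum>C\<in>cls ?R ` D. 5 * card C + (if C \<in> ?M then 10 else 0))"
    by (rule sum_mono) (rule main)
  moreover have "(\<Sum>C\<in>cls ?R ` D. card (C \<inter> ?B)) = card ?B"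
  proof -
    have "(\<Sum>C\<in>cls ?R ` D. card (C \<inter> ?B)) = (\<Sum>C\<in>cls ?R ` D. \<Sum>h\<in>C. if h \<in> ?B then 1 else 0)"
    proof (rule sum.cong)
      fix C assume "C \<in> cls ?R ` D"
      then have "finite C" using sub finite_subset[OF _ assms(1)] by blast
      then show "card (C \<inter> ?B) = (\<Sum>h\<in>C. if h \<in> ?B then 1 else 0)"
        by (simp add: sum.If_cases Int_def)
    qed simp
    also have "\<dots> = (\<Sum>h\<in>D. if h \<in> ?B then 1 else 0)" by (rule sum_cls) (use assms(1) cl in auto)
    also have "\<dots> = card ?B" using assms(1) by (simp add: sum.If_cases Int_def)
    finally show ?thesis .
  qed
  moreover have "(\<Sum>C\<in>cls ?R ` D. 5 * card C) = 5 * card D"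
    using sum_cls[OF assms(1), of ?R "\<lambda>_. 1::nat"] cl by (simp add: sum_distrib_left[symmetric])
  moreover have "(\<Sum>C\<in>cls ?R ` D. if C \<in> ?M then 10 else (0::nat)) = 10 * card ?M"
    using assms(1) Msub by (simp add: sum.If_cases Int_absorb1 Int_commute)
  ultimately show ?thesis
    by (simp add: sum.distrib ncl_def)
qed

lemma cycle_count2:
  assumes "finite D" "\<And>h. h \<in> D \<Longrightarrow> f h \<in> D" "\<And>h. h \<in> D \<Longrightarrow> f h \<noteq> h"
  shows "2 * ncl D (gr f D) \<le> card D"
proof -
  let ?R = "gr f D"
  have cl: "u \<in> D \<longleftrightarrow> v \<in> D" if "(u, v) \<in> ?R" for u v using that assms(2) by (auto simp: gr_def)
  have sub: "cls ?R h \<subseteq> D" if "h \<in> D" for h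
    using conn_closed[of h _ ?R D] cl that by (auto simp: cls_def)
  have "2 \<le> card C" if C: "C \<in> cls ?R ` D" for C
  proof -
    obtain k where k: "k \<in> D" "C = cls ?R k" using C by auto
    have "finite C" unfolding k(2) by (rule finite_subset[OF sub[OF k(1)] assms(1)])
    moreover have "f k \<in> C" using k by (auto simp: cls_def gr_def intro!: conn_base)
    ultimately have "card {k, f k} \<le> card C" using k by (intro card_mono) auto
    then show ?thesis using assms(3)[OF k(1)] by (simp add: card_insert_if split: if_splits)
  qed
  then have "(\<Sum>C\<in>cls ?R ` D. 2) \<le> (\<Sum>C\<in>cls ?R ` D. card C)" by (intro sum_mono) auto
  also have "\<dots> = card D" using sum_cls[OF assms(1), of ?R "\<lambda>_. 1::nat"] cl by simp
  finally show ?thesis by (simp add: ncl_def mult.commute)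
qed

text \<open>Parity of colours: each step of a face or straight walk crosses one edge and so changes
  the colour, while rotating keeps it. Closed walks have even length.\<close>

lemma closed_map_face_cycle:
  assumes "closed_map D r e w" "h \<in> D"
  shows "r (e h) \<noteq> h" "r (e (r (e (r (e h))))) \<noteq> h" "r (r (e h)) \<noteq> h"
    "r (r (e (r (r (e (r (r (e h)))))))) \<noteq> h"
proof -
  note c = closed_mapD[OF assms(1)]
  have w1: "w (r (e z)) \<noteq> w z" "w (r (r (e z))) \<noteq> w z" "r (e z) \<in> D" "r (r (e z)) \<in> D"
    if "z \<in> D" for z using that c by auto
  show "r (e h) \<noteq> h" "r (r (e h)) \<noteq> h" using w1[OF assms(2)] by auto
  show "r (e (r (e (r (e h))))) \<noteq> h" using w1 assms(2) by metis
  show "r (r (e (r (r (e (r (r (e h)))))))) \<noteq> h" using w1 assms(2) by metis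
qed

lemma nfaces_le: assumes "closed_map D r e w" shows "2 * nfaces D r e \<le> card D"
  unfolding nfaces_def by (rule cycle_count2) (use closed_mapD[OF assms] closed_map_face_cycle[OF assms] in auto)

lemma nstraight_le: assumes "closed_map D r e w" shows "2 * nstraight D r e \<le> card D"
  unfolding nstraight_def by (rule cycle_count2) (use closed_mapD[OF assms] closed_map_face_cycle[OF assms] in auto)

section \<open>Dipoles and closing their sides\<close>

definition dip :: "('a \<Rightarrow> 'a) \<Rightarrow> ('a \<Rightarrow> 'a) \<Rightarrow> 'a \<Rightarrow> 'a \<Rightarrow> nat \<Rightarrow> bool" where
  "dip r e a b j \<longleftrightarrow> j \<in> {1, 2, 3} \<and> (\<forall>i\<in>{1, 2, 3} - {j}. e ((r ^^ i) a) = (r ^^ (4 - i)) b)"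

definition vx :: "('a \<Rightarrow> 'a) \<Rightarrow> 'a \<Rightarrow> 'a set" where
  "vx r h = {h, r h, r (r h), r (r (r h))}"

lemma funpow123:
  "(f ^^ Suc 0) h = f h" "(f ^^ 2) h = f (f h)" "(f ^^ 3) h = f (f (f h))"
  by (simp_all add: numeral_eq_Suc)

lemma dip_simps:
  "dip r e a b (Suc 0) \<longleftrightarrow> e (r (r a)) = r (r b) \<and> e (r (r (r a))) = r b"
  "dip r e a b 1 \<longleftrightarrow> e (r (r a)) = r (r b) \<and> e (r (r (r a))) = r b"
  "dip r e a b 2 \<longleftrightarrow> e (r a) = r (r (r b)) \<and> e (r (r (r a))) = r b"
  "dip r e a b 3 \<longleftrightarrow> e (r a) = r (r (r b)) \<and> e (r (r a)) = r (r b)"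
  by (simp_all add: dip_def insert_Diff_if funpow123)

lemma dip_cases:
  assumes "dip r e a b j"
  obtains "j = 1" | "j = 2" | "j = 3"
  using assms by (auto simp: dip_def)

lemma dip_flip:
  assumes "closed_map D r e w" "a \<in> D" "b \<in> D" "dip r e a b j"
  shows "dip r e ((r ^^ j) a) ((r ^^ (4 - j)) b) (4 - j)"
proof -
  have "j = 1 \<or> j = 2 \<or> j = 3" using assms(4) by (auto simp: dip_def)
  then show ?thesis using assms closed_mapD(2,3)[OF assms(1)] by (auto simp: dip_simps funpow123)
qed

text \<open>What the sides of pairwise disjoint dipoles satisfy, freed from the dipoles themselves.
  Inner edges never end in a side, so switching at one side leaves the inner edges at all others
  intact; the last clause keeps distinct sides disjoint.\<close>

definition closable :: "'a set \<Rightarrow> ('a \<Rightarrow> 'a) \<Rightarrow> ('a \<Rightarrow> 'a) \<Rightarrow> ('a \<Rightarrow> bool) \<Rightarrow> ('a \<times> 'a) set \<Rightarrow> bool" where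
  "closable D r e w S \<longleftrightarrow> S \<subseteq> D \<times> D \<and>
     (\<forall>a b. (a, b) \<in> S \<longrightarrow> w a \<and> \<not> w b \<and> (\<exists>j\<in>{1, 2, 3 :: nat}. \<forall>i\<in>{1, 2, 3} - {j}.
        e ((r ^^ i) a) = (r ^^ (4 - i)) b \<and> (r ^^ i) a \<notin> fst ` S \<union> snd ` S
        \<and> (r ^^ (4 - i)) b \<notin> fst ` S \<union> snd ` S)) \<and>
     (\<forall>a b a' b'. (a, b) \<in> S \<longrightarrow> (a', b') \<in> S \<longrightarrow> (a = a' \<longleftrightarrow> b = b'))"

text \<open>The sides are closed one by one. \<open>n\<close> counts the switches really performed,
  as a side may already have become an edge through an earlier switch. The last estimate is later
  read backwards: the number of rings after closing bounds \<open>n\<close> from below.\<close>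

lemma close_sides:
  assumes "closed_map D r e w" "closable D r e w S" "P \<subseteq> S"
  shows "\<exists>e' n. closed_map D r e' w
    \<and> (\<forall>h\<in>D. h \<notin> fst ` S \<union> snd ` S \<longrightarrow> e h \<notin> fst ` S \<union> snd ` S \<longrightarrow> e' h = e h)
    \<and> (\<forall>(a, b)\<in>P. e' a = b) \<and> Psi D r e' + 2 * int n \<le> Psi D r e \<and> ncomps D r e' \<le> ncomps D r e + n
    \<and> ncl D (gr e' D \<union> S) \<le> ncl D (gr e D \<union> S) + n"
proof -
  let ?S = "fst ` S \<union> snd ` S"
  have "finite P"
    using assms closed_mapD(1)[OF assms(1)] unfolding closable_def by (meson finite_SigmaI finite_subset)
  then show ?thesis using assms(3)
  proof (induction P)
    case empty
    then show ?case using assms(1) by (intro exI[of _ e] exI[of _ 0]) auto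
  next
    case (insert p P)
    then obtain e1 n where cm1: "closed_map D r e1 w"
      and same: "\<And>h. h \<in> D \<Longrightarrow> h \<notin> ?S \<Longrightarrow> e h \<notin> ?S \<Longrightarrow> e1 h = e h"
      and dn: "\<forall>(a, b)\<in>P. e1 a = b"
      and psi: "Psi D r e1 + 2 * int n \<le> Psi D r e" and ncomps: "ncomps D r e1 \<le> ncomps D r e + n"
      and nc: "ncl D (gr e1 D \<union> S) \<le> ncl D (gr e D \<union> S) + n"
      by auto
    obtain a b where p: "p = (a, b)" by force
    have pS: "(a, b) \<in> S" using insert p by auto
    have ab: "a \<in> D" "b \<in> D" "w a" "\<not> w b" using pS assms(2) by (auto simp: closable_def)
    have "\<exists>j\<in>{1, 2, 3 :: nat}. \<forall>i\<in>{1, 2, 3} - {j}.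
        e ((r ^^ i) a) = (r ^^ (4 - i)) b \<and> (r ^^ i) a \<notin> ?S \<and> (r ^^ (4 - i)) b \<notin> ?S"
      using pS assms(2) unfolding closable_def by simp
    then obtain j where j: "j \<in> {1, 2, 3 :: nat}" and ed: "\<forall>i\<in>{1, 2, 3} - {j}.
        e ((r ^^ i) a) = (r ^^ (4 - i)) b \<and> (r ^^ i) a \<notin> ?S \<and> (r ^^ (4 - i)) b \<notin> ?S"
      by (rule bexE)
    show ?case
    proof (cases "e1 a = b")
      case True
      then show ?thesis using cm1 same dn psi ncomps nc p by (intro exI[of _ e1] exI[of _ n]) auto
    next
      case False
      interpret s: switch D r e1 w a b by unfold_locales (use cm1 ab False in auto)
      have ed1: "e1 ((r ^^ i) a) = (r ^^ (4 - i)) b" if "i \<in> {1, 2, 3} - {j}" for i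
        using bspec[OF ed that] same[of "(r ^^ i) a"] funpow_in[of D r a i] s.c(2) ab by auto
      have 1: "Psi D r s.e' + 2 \<le> Psi D r e1" by (rule s.Psi_sw_dipole[OF j ed1])
      have 2: "s.e' h = e h" if h: "h \<in> D" "h \<notin> ?S" "e h \<notin> ?S" for h
      proof -
        have "h \<noteq> a" "h \<noteq> b" using h pS by force+
        moreover have "e1 h \<noteq> a" "e1 h \<noteq> b" using same[OF h] h pS by force+
        ultimately show ?thesis using same[OF h] s.sw_other[of h] s.c(7) ab h by metis
      qed
      have 3: "s.e' a2 = b2" if "(a2, b2) \<in> insert p P" for a2 b2
      proof (cases "(a2, b2) = (a, b)")
        case True then show ?thesis using s.sw_simps by auto
      next
        case ne: False
        then have "(a2, b2) \<in> P" using that p by auto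
        then have e1: "e1 a2 = b2" and S2: "(a2, b2) \<in> S" using dn insert by auto
        have ab2: "a2 \<in> D" "w a2" "\<not> w b2" "a = a2 \<longleftrightarrow> b = b2" using S2 pS assms(2)
          by (auto simp: closable_def)
        have "a2 \<noteq> a" "a2 \<noteq> b" "a2 \<noteq> e1 a" "a2 \<noteq> e1 b"
          using ne ab2 ab e1 s.c(7) by auto
        then show ?thesis using s.sw_other e1 by simp
      qed
      show ?thesis
        using s.closed_map_sw 2 3 1 psi ncomps nc s.ncomps_sw s.ncl_sw[of S]
        by (intro exI[of _ s.e'] exI[of _ "Suc n"]) auto
    qed
  qed
qed

section \<open>Non-negativity\<close>

text \<open>Four times \<open>6c + 3V - 2F - 2\<phi>\<close>, which is \<open>2g + l\<close> for a connected map.\<close>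

definition excess :: "'a set \<Rightarrow> ('a \<Rightarrow> 'a) \<Rightarrow> ('a \<Rightarrow> 'a) \<Rightarrow> int" where
  "excess D r e = 24 * int (ncomps D r e) + 3 * int (card D) - 8 * int (nfaces D r e) - 4 * int (nstraight D r e)"

lemma excess_Psi: "excess D r e = 4 * Psi D r e + 8 * int (ncomps D r e) + 3 * int (card D)"
  by (simp add: excess_def Psi_def)

text \<open>A face of degree two lies between the second and third edge of a U-dipole: the edge of
  \<open>h\<close> is the third, that of its predecessor \<open>r (r (r h))\<close> the second, and
  the first is cut.\<close>

lemma face_dip:
  assumes "closed_map D r e w" "h \<in> D" "r (e (r (e h))) = h" "w h"
  shows "dip r e (r h) (r (r (r (e h)))) 1"
  using closed_mapD[OF assms(1)] assms by (simp add: dip_simps) (metis)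

lemma straight_dip:
  assumes "closed_map D r e w" "h \<in> D" "r (r (e (r (r (e h))))) = h" "w h"
  shows "dip r e (r (r (r h))) (r (e h)) 2"
  using closed_mapD[OF assms(1)] assms by (simp add: dip_simps) (metis)

definition block :: "('a \<Rightarrow> 'a) \<Rightarrow> 'a \<Rightarrow> 'a \<Rightarrow> 'a set" where
  "block r a b = vx r a \<union> vx r b"

lemma card_block: "card (block r a b) \<le> 8" "finite (block r a b)"
proof -
  have v: "card (vx r h) \<le> 4" for h :: 'a
    unfolding vx_def by (simp add: card_insert_if)
  show "card (block r a b) \<le> 8" unfolding block_def
    using card_Un_le[of "vx r a" "vx r b"] v[of a] v[of b] by linarith
  show "finite (block r a b)" by (simp add: block_def vx_def)
qed

lemma block_closed:
  assumes "closed_map D r e w" "a \<in> D" "b \<in> D"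
  shows "block r a b \<subseteq> D" "h \<in> block r a b \<Longrightarrow> r h \<in> block r a b"
  using assms closed_mapD[OF assms(1)] by (auto simp: block_def vx_def)

text \<open>One component, and at most half as many faces and straight orbits as half-edges, leave
  at least 24 - 3 \<open>card X\<close>. This is where 8, the size of two vertices, is
  critical.\<close>

lemma excess_block:
  assumes "closed_map X r e w" "card X \<le> 8" "X \<noteq> {}"
  shows "0 \<le> excess X r e"
proof -
  have "ncomps X r e \<ge> 1" unfolding ncomps_def ncl_def using assms(3) closed_mapD(1)[OF assms(1)]
    by (simp add: Suc_le_eq card_gt_0_iff)
  then show ?thesis using nfaces_le[OF assms(1)] nstraight_le[OF assms(1)] assms(2) unfolding excess_def by linarith
qed

lemma closable_dip:
  assumes "closed_map D r e w" "a \<in> D" "b \<in> D" "w a" "\<not> w b" "dip r e a b j"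
  shows "closable D r e w {(a, b), ((r ^^ j) a, (r ^^ (4 - j)) b)}"
proof -
  note c = closed_mapD[OF assms(1)]
  have n: "r a \<noteq> a" "r (r a) \<noteq> a" "r (r (r a)) \<noteq> a" "r b \<noteq> b" "r (r b) \<noteq> b" "r (r (r b)) \<noteq> b"
    "r (r a) \<noteq> r a" "r (r (r a)) \<noteq> r a" "r (r (r a)) \<noteq> r (r a)"
    "r (r b) \<noteq> r b" "r (r (r b)) \<noteq> r b" "r (r (r b)) \<noteq> r (r b)"
    using c(2,3,4,10) assms(2,3) by metis+
  have f: "dip r e ((r ^^ j) a) ((r ^^ (4 - j)) b) (4 - j)"
    by (rule dip_flip) (use assms in auto)
  have ww: "w (r a)" "w (r (r a))" "w (r (r (r a)))" "\<not> w (r b)" "\<not> w (r (r b))" "\<not> w (r (r (r b)))"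
    using c assms by simp_all
  have ab: "z \<noteq> z'" if "w z" "\<not> w z'" for z z' using that by auto
  show ?thesis
    using assms(6)
  proof (cases rule: dip_cases)
    case 1
    then show ?thesis using f assms n n[symmetric] ww ab c(2,3)
      unfolding closable_def by (auto simp: dip_simps funpow123 insert_Diff_if intro!: bexI[of _ 1] bexI[of _ 3])
  next
    case 2
    then show ?thesis using f assms n n[symmetric] ww ab c(2,3)
      unfolding closable_def by (auto simp: dip_simps funpow123 insert_Diff_if intro!: bexI[of _ 2])
  next
    case 3
    then show ?thesis using f assms n n[symmetric] ww ab c(2,3)
      unfolding closable_def by (auto simp: dip_simps funpow123 insert_Diff_if intro!: bexI[of _ 1] bexI[of _ 3])
  qed
qed

lemma block_inner:
  assumes "closed_map D r e w" "a \<in> D" "b \<in> D" "w a" "\<not> w b" "dip r e a b j"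
    "h \<in> block r a b" "h \<notin> {a, b, (r ^^ j) a, (r ^^ (4 - j)) b}"
  shows "e h \<in> block r a b" "e h \<notin> {a, b, (r ^^ j) a, (r ^^ (4 - j)) b}"
proof -
  note c = closed_mapD[OF assms(1)]
  have n: "r a \<noteq> a" "r (r a) \<noteq> a" "r (r (r a)) \<noteq> a" "r b \<noteq> b" "r (r b) \<noteq> b" "r (r (r b)) \<noteq> b"
    "r (r a) \<noteq> r a" "r (r (r a)) \<noteq> r a" "r (r (r a)) \<noteq> r (r a)"
    "r (r b) \<noteq> r b" "r (r (r b)) \<noteq> r b" "r (r (r b)) \<noteq> r (r b)"
    using c(2,3,4,10) assms(2,3) by metis+
  have ww: "w (r a)" "w (r (r a))" "w (r (r (r a)))" "\<not> w (r b)" "\<not> w (r (r b))" "\<not> w (r (r (r b)))"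
    using c assms by simp_all
  have ab: "z \<noteq> z'" if "w z" "\<not> w z'" for z z' using that by auto
  have d: "r a \<in> D" "r (r a) \<in> D" "r (r (r a)) \<in> D" "r b \<in> D" "r (r b) \<in> D" "r (r (r b)) \<in> D"
    using c assms by auto
  have "j = 1 \<or> j = 2 \<or> j = 3" using assms(6) by (auto simp: dip_def)
  then have "e h \<in> block r a b \<and> e h \<notin> {a, b, (r ^^ j) a, (r ^^ (4 - j)) b}"
  proof (elim disjE)
    assume [simp]: "j = 1"
    have E: "e (r (r a)) = r (r b)" "e (r (r (r a))) = r b" using assms(6) by (simp_all add: dip_simps)
    then have "e (r (r b)) = r (r a)" "e (r b) = r (r (r a))" using c(7) d by metis+
    then show ?thesis using assms(4,5,7,8) E n n[symmetric] ww ab by (auto simp: block_def vx_def funpow123)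
  next
    assume [simp]: "j = 2"
    have E: "e (r a) = r (r (r b))" "e (r (r (r a))) = r b" using assms(6) by (simp_all add: dip_simps)
    then have "e (r (r (r b))) = r a" "e (r b) = r (r (r a))" using c(7) d by metis+
    then show ?thesis using assms(4,5,7,8) E n n[symmetric] ww ab by (auto simp: block_def vx_def funpow123)
  next
    assume [simp]: "j = 3"
    have E: "e (r (r a)) = r (r b)" "e (r a) = r (r (r b))" using assms(6) by (simp_all add: dip_simps)
    then have "e (r (r b)) = r (r a)" "e (r (r (r b))) = r a" using c(7) d by metis+
    then show ?thesis using assms(4,5,7,8) E n n[symmetric] ww ab by (auto simp: block_def vx_def funpow123)
  qed
  then show "e h \<in> block r a b" "e h \<notin> {a, b, (r ^^ j) a, (r ^^ (4 - j)) b}" by auto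
qed

lemma excess_Un:
  assumes "closed_map D r e w" "X \<subseteq> D" "\<And>h. h \<in> X \<Longrightarrow> r h \<in> X" "\<And>h. h \<in> X \<Longrightarrow> e h \<in> X"
  shows "excess D r e = excess X r e + excess (D - X) r e" and "Psi D r e = Psi X r e + Psi (D - X) r e"
proof -
  have "finite D" using closed_mapD(1)[OF assms(1)] .
  then have "card D = card X + card (D - X)" using assms(2)
    by (metis card_Diff_subset card_mono finite_subset le_add_diff_inverse)
  then show "excess D r e = excess X r e + excess (D - X) r e" using counts_Un[OF assms] by (simp add: excess_def)
  show "Psi D r e = Psi X r e + Psi (D - X) r e" using counts_Un[OF assms] by (simp add: Psi_def)
qed

text \<open>A cycle of length two would be a dipole, and odd lengths are excluded by colours. All
  cycles therefore have length at least four, and 8/4 + 4/4 is exactly the 3 per half-edge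
  available.\<close>

lemma excess_no_dip:
  assumes "closed_map D r e w" "\<not> (\<exists>a b j. a \<in> D \<and> b \<in> D \<and> w a \<and> \<not> w b \<and> dip r e a b j)"
  shows "0 \<le> excess D r e"
proof -
  note c = closed_mapD[OF assms(1)]
  have f: False if h: "h \<in> D" "r (e (r (e h))) = h" for h
  proof -
    have "\<exists>h\<in>D. r (e (r (e h))) = h \<and> w h"
      using h c(2,5,6,8) by metis
    then obtain k where k: "k \<in> D" "r (e (r (e k))) = k" "w k" by auto
    show False using assms(2) face_dip[OF assms(1) k] c k by (metis)
  qed
  have s: False if h: "h \<in> D" "r (r (e (r (r (e h))))) = h" for h
  proof -
    have "\<exists>h\<in>D. r (r (e (r (r (e h))))) = h \<and> w h"
      using h c(2,5,6,8) by metis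
    then obtain k where k: "k \<in> D" "r (r (e (r (r (e k))))) = k" "w k" by auto
    show False using assms(2) straight_dip[OF assms(1) k] c k by (metis)
  qed
  have "card {h \<in> D. r (e (r (e (r (e (r (e h))))))) \<noteq> h} + 20 * nfaces D r e \<le> 5 * card D
      + 10 * card (cls (gr (\<lambda>h. r (e h)) D) ` {h \<in> {} \<inter> D. r (e (r (e h))) = h})"
    unfolding nfaces_def
  proof (rule cycle_count)
    show "h \<in> {} \<or> r (e h) \<in> {}" if "h \<in> D" "r (e (r (e h))) = h" for h using f that by blast
  qed (use c(1,2,6) closed_map_inj(3)[OF assms(1)] closed_map_face_cycle[OF assms(1)] in auto)
  moreover have "card {h \<in> D. r (r (e (r (r (e (r (r (e (r (r (e h))))))))))) \<noteq> h} + 20 * nstraight D r e \<le> 5 * card D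
      + 10 * card (cls (gr (\<lambda>h. r (r (e h))) D) ` {h \<in> {} \<inter> D. r (r (e (r (r (e h))))) = h})"
    unfolding nstraight_def
  proof (rule cycle_count)
    show "h \<in> {} \<or> r (r (e h)) \<in> {}" if "h \<in> D" "r (r (e (r (r (e h))))) = h" for h using s that by blast
  qed (use c(1,2,6) closed_map_inj(4)[OF assms(1)] closed_map_face_cycle[OF assms(1)] in auto)
  ultimately show ?thesis unfolding excess_def by simp
qed

text \<open>Closing both sides of a dipole does not raise \<open>excess\<close>: a switch gains 8
  through \<open>Psi\<close> and pays at most 8 for a new component. Afterwards the two vertices of
  the dipole split off from the rest, which has fewer half-edges.\<close>

theorem excess_nonneg:
  assumes "closed_map D r e w"
  shows "0 \<le> excess D r e"
  using assms
proof (induction "card D" arbitrary: D e rule: less_induct)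
  case less
  note cm = less(2)
  note c = closed_mapD[OF cm]
  show ?case
  proof (cases "\<exists>a b j. a \<in> D \<and> b \<in> D \<and> w a \<and> \<not> w b \<and> dip r e a b j")
    case False
    then show ?thesis using excess_no_dip[OF cm] by simp
  next
    case True
    then obtain a b j where ab: "a \<in> D" "b \<in> D" "w a" "\<not> w b" and d: "dip r e a b j" by auto
    define a' b' where "a' = (r ^^ j) a" and "b' = (r ^^ (4 - j)) b"
    let ?S = "{(a, b), (a', b')}"
    obtain e' n where cm': "closed_map D r e' w"
      and same: "\<And>h. h \<in> D \<Longrightarrow> h \<notin> {a, b, a', b'} \<Longrightarrow> e h \<notin> {a, b, a', b'} \<Longrightarrow> e' h = e h"
      and cl: "e' a = b" "e' a' = b'" and psi: "Psi D r e' + 2 * int n \<le> Psi D r e"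
      and ncomps: "ncomps D r e' \<le> ncomps D r e + n"
      using close_sides[OF cm closable_dip[OF cm ab d] subset_refl] unfolding a'_def b'_def by auto
    note c' = closed_mapD[OF cm']
    let ?B = "block r a b"
    have a'D: "a' \<in> D" "b' \<in> D" unfolding a'_def b'_def using funpow_in[of D r] c ab by auto
    have S: "{a, b, a', b'} \<subseteq> ?B" unfolding a'_def b'_def using dip_cases[OF d]
      by (cases rule: dip_cases[OF d]) (auto simp: block_def vx_def funpow123)
    have BD: "?B \<subseteq> D" and Br: "\<And>h. h \<in> ?B \<Longrightarrow> r h \<in> ?B"
      using block_closed[OF cm ab(1,2)] by auto
    have cl': "e' b = a" "e' b' = a'" using cl c'(7) ab a'D by metis+
    have Be: "e' h \<in> ?B" if h: "h \<in> ?B" for h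
    proof (cases "h \<in> {a, b, a', b'}")
      case True
      then show ?thesis using cl cl' S by auto
    next
      case F: False
      then show ?thesis using same[of h] h BD block_inner[OF cm ab d h]
        unfolding a'_def b'_def by auto
    qed
    have Bne: "?B \<noteq> {}" by (auto simp: block_def vx_def)
    have "closed_map ?B r e' w" by (rule closed_map_sub[OF cm' BD Br Be])
    then have 1: "0 \<le> excess ?B r e'" using excess_block card_block(1) Bne by metis
    have "card (D - ?B) < card D" using Bne BD c(1) by (intro psubset_card_mono) auto
    then have 2: "0 \<le> excess (D - ?B) r e'" using less(1) counts_Un(4)[OF cm' BD Br Be] by blast
    have "excess D r e' \<le> excess D r e" using psi ncomps unfolding excess_Psi by linarith
    then show ?thesis using excess_Un(1)[OF cm' BD Br Be] 1 2 by linarith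
  qed
qed

section \<open>Flat maps are small\<close>

text \<open>Where all faces and straight cycles have length dividing \<open>4\<close>, the map looks like a quotient
  of the square lattice in which both unit translations \<open>\<tau>\<^sub>1\<close> and \<open>\<tau>\<^sub>2\<close> have order dividing \<open>4\<close>.\<close>

definition shift1 :: "('a \<Rightarrow> 'a) \<Rightarrow> ('a \<Rightarrow> 'a) \<Rightarrow> 'a \<Rightarrow> 'a" where
  "shift1 r e h = r (r (e h))"

definition shift2 :: "('a \<Rightarrow> 'a) \<Rightarrow> ('a \<Rightarrow> 'a) \<Rightarrow> 'a \<Rightarrow> 'a" where
  "shift2 r e h = r (r (r (e (r (r (r h))))))"

definition irregular :: "'a set \<Rightarrow> ('a \<Rightarrow> 'a) \<Rightarrow> ('a \<Rightarrow> 'a) \<Rightarrow> 'a set" where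
  "irregular D r e = {h \<in> D. r (e (r (e (r (e (r (e h))))))) \<noteq> h} \<union> {h \<in> D. (shift1 r e ^^ 4) h \<noteq> h}"

lemma funpow4: "(f ^^ 4) h = f (f (f (f h)))"
  by (simp add: numeral_eq_Suc)

context
  fixes D r e w
  assumes cm: "closed_map D r e w"
begin

abbreviation (input) "tau1 \<equiv> shift1 r e"
abbreviation (input) "tau2 \<equiv> shift2 r e"

text \<open>Normal form of a half-edge reached from \<open>h\<close> in the lattice: a rotation
  first, then a translation vector.\<close>

definition word :: "nat \<Rightarrow> nat \<Rightarrow> nat \<Rightarrow> 'a \<Rightarrow> 'a" where
  "word i j k h = (tau1 ^^ j) ((tau2 ^^ k) ((r ^^ i) h))"

lemma TD: "h \<in> D \<Longrightarrow> tau1 h \<in> D" and UD: "h \<in> D \<Longrightarrow> tau2 h \<in> D"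
  using closed_mapD(2,6)[OF cm] by (auto simp: shift1_def shift2_def)

lemma TnD: "h \<in> D \<Longrightarrow> (tau1 ^^ n) h \<in> D" and UnD: "h \<in> D \<Longrightarrow> (tau2 ^^ n) h \<in> D"
  and rnD: "h \<in> D \<Longrightarrow> (r ^^ n) h \<in> D"
  using funpow_in[of D tau1] funpow_in[of D tau2] funpow_in[of D r] TD UD closed_mapD(2)[OF cm] by auto

lemma wordD: "h \<in> D \<Longrightarrow> word i j k h \<in> D"
  by (simp add: word_def TnD UnD rnD)

lemma T_inj: "inj_on tau1 D" and U_inj: "inj_on tau2 D"
proof -
  note c = closed_mapD[OF cm]
  show "inj_on tau1 D" unfolding shift1_def by (rule inj_onI) (metis c(2,3,6,7))
  show "inj_on tau2 D" unfolding shift2_def by (rule inj_onI) (metis c(2,3,6,7))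
qed

lemma inj_funpow: "inj_on f D \<Longrightarrow> (\<And>h. h \<in> D \<Longrightarrow> f h \<in> D) \<Longrightarrow> inj_on (f ^^ n) D"
proof (induction n)
  case (Suc n)
  have "inj_on (f \<circ> (f ^^ n)) D"
    using Suc by (intro comp_inj_on) (auto intro: inj_on_subset funpow_in)
  then show ?case by (simp add: comp_def)
qed simp

lemma word_inj: "inj_on (word i j k) D"
proof (rule inj_onI)
  fix x y assume "x \<in> D" "y \<in> D" "word i j k x = word i j k y"
  then show "x = y" unfolding word_def
    using inj_funpow[OF T_inj TD] inj_funpow[OF U_inj UD] inj_funpow[OF closed_map_inj(1)[OF cm] closed_mapD(2)[OF cm]]
    by (meson UnD rnD inj_onD)
qed

text \<open>The quarter turn \<open>r\<close> carries the first translation to the second and, as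
  \<open>T_r_U\<close> says in multiplied-out form, the second to the inverse of the first. Both
  relations hold in every closed map.\<close>

lemma r_T: "h \<in> D \<Longrightarrow> r (tau1 h) = tau2 (r h)"
  using closed_mapD[OF cm] by (simp add: shift1_def shift2_def)

lemma r_Tn: "h \<in> D \<Longrightarrow> r ((tau1 ^^ n) h) = (tau2 ^^ n) (r h)"
  by (induction n) (simp_all add: r_T TnD)

lemma T_r_U: "h \<in> D \<Longrightarrow> tau1 (r (tau2 h)) = r h"
  using closed_mapD[OF cm] by (simp add: shift1_def shift2_def)

lemma Tn_r_Un: "h \<in> D \<Longrightarrow> (tau1 ^^ n) (r ((tau2 ^^ n) h)) = r h"
proof (induction n)
  case (Suc n)
  have "(tau2 ^^ Suc n) h = tau2 ((tau2 ^^ n) h)" by simp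
  then have "(tau1 ^^ Suc n) (r ((tau2 ^^ Suc n) h)) = (tau1 ^^ n) (tau1 (r (tau2 ((tau2 ^^ n) h))))"
    by (simp only: funpow_Suc_right o_apply)
  then show ?case using Suc T_r_U[OF UnD] by simp
qed simp

text \<open>Commutation of the two translations is the relation of a square: if the face through
  \<open>h\<close> closes up after four steps, both products lead to the half-edge opposite to the
  one that lies two face steps after \<open>h\<close>.\<close>

lemma reg_comm: assumes "h \<in> D" "h \<notin> irregular D r e" shows "tau1 (tau2 h) = tau2 (tau1 h)"
proof -
  note c = closed_mapD[OF cm]
  have s: "r (e (r (e (r (e (r (e h))))))) = h" using assms by (auto simp: irregular_def)
  define z where "z = r (e (r (e h)))"
  have z: "z \<in> D" unfolding z_def using c assms by auto
  have "r (e (r (e z))) = h" using s by (simp add: z_def)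
  then have "e (r (r (r (e (r (r (r h))))))) = z" using c z by (metis)
  then have "tau1 (tau2 h) = r (r z)" by (simp add: shift1_def shift2_def)
  moreover have "tau2 (tau1 h) = r (r z)" using c assms by (simp add: shift1_def shift2_def z_def)
  ultimately show ?thesis by simp
qed

context
  fixes h
  assumes h: "h \<in> D" and reg: "\<And>i j k. i < 4 \<Longrightarrow> j < 4 \<Longrightarrow> k < 4 \<Longrightarrow> word i j k h \<notin> irregular D r e"
begin

lemma T4: assumes "i < 4" "j < 4" "k < 4" shows "(tau1 ^^ 4) (word i j k h) = word i j k h"
  using reg[OF assms] wordD[OF h] by (auto simp: irregular_def)

lemma U_word: assumes "i < 4" "k < 4" shows "j \<le> 4 \<Longrightarrow> tau2 (word i j k h) = word i j (Suc k) h"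
proof (induction j)
  case 0 then show ?case by (simp add: word_def)
next
  case (Suc j)
  have "tau2 (word i (Suc j) k h) = tau2 (tau1 (word i j k h))" by (simp add: word_def)
  also have "\<dots> = tau1 (tau2 (word i j k h))"
    using reg_comm[OF wordD[OF h] reg[of i j k]] assms Suc by simp
  also have "\<dots> = tau1 (word i j (Suc k) h)" using Suc by simp
  finally show ?case by (simp add: word_def)
qed

lemma Un_word: assumes "i < 4" "j < 4" shows "k \<le> 4 \<Longrightarrow> (tau2 ^^ k) (word i j 0 h) = word i j k h"
  using U_word[OF assms(1)] assms(2) by (induction k) auto

text \<open>A quarter turn acts on the translation vector: the exponents \<open>(j, k)\<close>
  become \<open>(-k, j)\<close> modulo 4, and \<open>i\<close> increases by one.\<close>

lemma r_word: assumes "i < 4" "j < 4" "k < 4"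
  shows "\<exists>i' j' k'. i' < 4 \<and> j' < 4 \<and> k' < 4 \<and> r (word i j k h) = word i' j' k' h"
proof -
  define i' where "i' = (if i = 3 then 0 else Suc i)"
  define m where "m = (if k = 0 then 0 else 4 - k)"
  have lt: "i' < 4" "m < 4" using assms by (auto simp: i'_def m_def)
  have v: "r ((r ^^ i) h) = (r ^^ i') h"
    using closed_mapD(3)[OF cm h] by (auto simp: i'_def numeral_eq_Suc)
  let ?v = "(r ^^ i') h"
  have vD: "?v \<in> D" using rnD h by auto
  have "(tau1 ^^ 4) ?v = ?v" using T4[OF lt(1), of 0 0] by (simp add: word_def)
  then have "(tau1 ^^ k) ((tau1 ^^ m) ?v) = ?v"
    using assms(3) by (cases "k = 0") (auto simp: m_def funpow_add[symmetric, THEN fun_cong, simplified])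
  moreover have "(tau1 ^^ k) (r ((tau2 ^^ k) ((r ^^ i) h))) = ?v" using Tn_r_Un[OF rnD[OF h]] v by simp
  ultimately have 1: "r ((tau2 ^^ k) ((r ^^ i) h)) = (tau1 ^^ m) ?v"
    using inj_funpow[OF T_inj TD, of k] closed_mapD(2)[OF cm] UnD rnD TnD h vD by (metis inj_onD)
  have "r (word i j k h) = (tau2 ^^ j) (r ((tau2 ^^ k) ((r ^^ i) h)))"
    unfolding word_def by (rule r_Tn) (simp add: UnD rnD h)
  also have "\<dots> = (tau2 ^^ j) (word i' m 0 h)" by (simp add: 1 word_def)
  also have "\<dots> = word i' m j h" using Un_word[OF lt] assms by simp
  finally show ?thesis using lt assms by blast
qed

lemma T_word: assumes "i < 4" "j < 4" "k < 4"
  shows "\<exists>j'. j' < 4 \<and> tau1 (word i j k h) = word i j' k h"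
proof (cases "j = 3")
  case True
  have "tau1 (word i 3 k h) = (tau1 ^^ 4) (word i 0 k h)" by (simp add: word_def numeral_eq_Suc)
  then show ?thesis using T4[of i 0 k] assms True by (intro exI[of _ 0]) simp
next
  case False
  then show ?thesis using assms by (intro exI[of _ "Suc j"]) (simp add: word_def)
qed

lemma cls_word: "cls (mrel D r e) h \<subseteq> (\<lambda>(i, j, k). word i j k h) ` ({..<4} \<times> {..<4} \<times> {..<4})"
proof -
  let ?W = "(\<lambda>(i, j, k). word i j k h) ` ({..<4} \<times> {..<4} \<times> {..<4})"
  have W: "z \<in> ?W \<longleftrightarrow> (\<exists>i j k. i < 4 \<and> j < 4 \<and> k < 4 \<and> z = word i j k h)" for z
    by (auto simp: image_iff Bex_def)
  have rW: "r z \<in> ?W" if "z \<in> ?W" for z using that r_word unfolding W by metis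
  have TW: "tau1 z \<in> ?W" if "z \<in> ?W" for z using that T_word unfolding W by metis
  have WD: "z \<in> D" if "z \<in> ?W" for z using that wordD[OF h] unfolding W by auto
  have eW: "e z \<in> ?W" if "z \<in> ?W" for z
  proof -
    have "e z = r (r (tau1 z))" using WD[OF that] closed_mapD[OF cm] by (simp add: shift1_def)
    then show ?thesis using rW TW that by simp
  qed
  have "h \<in> ?W" unfolding W by (intro exI[of _ 0]) (simp add: word_def)
  moreover have "h \<in> ?W \<longleftrightarrow> z \<in> ?W" if "(h, z) \<in> conn (mrel D r e)" for z
    by (rule conn_closed[OF that mrel_closed[OF cm rW eW]])
  ultimately show ?thesis unfolding cls_def by blast
qed

end

text \<open>If all 64 words at \<open>h\<close> are regular, the component of \<open>h\<close>
  consists of these words; this accounts for 64 half-edges per component. Any other half-edge is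
  sent to an irregular one by one of 64 injective words.\<close>

lemma flat_bound: "card D \<le> 64 * card (irregular D r e) + 64 * ncomps D r e"
proof -
  note c = closed_mapD[OF cm]
  let ?I = "{..<4::nat} \<times> {..<4::nat} \<times> {..<4::nat}"
  let ?W = "\<lambda>h. (\<lambda>(i, j, k). word i j k h) ` ?I"
  define G where "G = {h \<in> D. \<forall>i j k. i < 4 \<longrightarrow> j < 4 \<longrightarrow> k < 4 \<longrightarrow> word i j k h \<notin> irregular D r e}"
  have cI: "card ?I = 64" by simp
  have small: "card (cls (mrel D r e) h) \<le> 64" if "h \<in> G" for h
  proof -
    have "cls (mrel D r e) h \<subseteq> ?W h" using that by (intro cls_word) (auto simp: G_def)
    then have "card (cls (mrel D r e) h) \<le> card (?W h)" by (intro card_mono) auto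
    also have "\<dots> \<le> 64" using card_image_le[of ?I "\<lambda>(i, j, k). word i j k h"] cI by simp
    finally show ?thesis .
  qed
  have "G \<subseteq> \<Union>(cls (mrel D r e) ` G)" by (auto intro: cls_self)
  moreover have "finite (\<Union>(cls (mrel D r e) ` G))"
  proof -
    have "finite (cls (mrel D r e) h)" if "h \<in> G" for h
    proof -
      have "cls (mrel D r e) h \<subseteq> ?W h" using that by (intro cls_word) (auto simp: G_def)
      then show ?thesis by (rule finite_subset) auto
    qed
    moreover have "finite G" using c(1) by (simp add: G_def)
    ultimately show ?thesis by auto
  qed
  ultimately have "card G \<le> card (\<Union>(cls (mrel D r e) ` G))" by (simp add: card_mono)
  also have "\<dots> \<le> (\<Sum>C\<in>cls (mrel D r e) ` G. card C)" by (rule card_Union_le_sum_card)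
  also have "\<dots> \<le> (\<Sum>C\<in>cls (mrel D r e) ` G. 64)" using small by (intro sum_mono) auto
  also have "\<dots> \<le> 64 * ncomps D r e"
  proof -
    have "card (cls (mrel D r e) ` G) \<le> card (cls (mrel D r e) ` D)"
      using c(1) by (intro card_mono) (auto simp: G_def)
    then show ?thesis by (simp add: ncomps_def ncl_def)
  qed
  finally have 1: "card G \<le> 64 * ncomps D r e" .
  have "D - G \<subseteq> (\<Union>(i, j, k)\<in>?I. {h \<in> D. word i j k h \<in> irregular D r e})"
    by (fastforce simp: G_def)
  then have "card (D - G) \<le> card (\<Union>(i, j, k)\<in>?I. {h \<in> D. word i j k h \<in> irregular D r e})"
    using c(1) by (intro card_mono) auto
  also have "\<dots> \<le> (\<Sum>p\<in>?I. card (case p of (i, j, k) \<Rightarrow> {h \<in> D. word i j k h \<in> irregular D r e}))"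
    by (rule card_UN_le) simp
  also have "\<dots> \<le> (\<Sum>p\<in>?I. card (irregular D r e))"
  proof (rule sum_mono, clarify)
    fix i j k
    have "card {h \<in> D. word i j k h \<in> irregular D r e} = card (word i j k ` {h \<in> D. word i j k h \<in> irregular D r e})"
      by (rule card_image[symmetric]) (rule inj_on_subset[OF word_inj], auto)
    also have "\<dots> \<le> card (irregular D r e)" using c(1) by (intro card_mono) (auto simp: irregular_def)
    finally show "card {h \<in> D. word i j k h \<in> irregular D r e} \<le> card (irregular D r e)" .
  qed
  also have "\<dots> = 64 * card (irregular D r e)" by simp
  finally have 2: "card (D - G) \<le> 64 * card (irregular D r e)" .
  have "card D = card G + card (D - G)"
    using c(1) by (metis (no_types, lifting) G_def card_Diff_subset card_mono finite_subset
        le_add_diff_inverse mem_Collect_eq subsetI)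
  then show ?thesis using 1 2 by linarith
qed

end

section \<open>Marked maps without free dipoles\<close>

text \<open>The situation of a piece after closing the family: \<open>M\<close> holds the ends of
  the edges created by the cuts and of the root edge, and every remaining bigon or straight cycle of
  length two touches it.\<close>

locale marked =
  fixes D r e w M
  assumes cm: "closed_map D r e w" and MD: "M \<subseteq> D" and Me: "\<And>h. h \<in> M \<Longrightarrow> e h \<in> M"
    and noU: "\<And>h. h \<in> D \<Longrightarrow> r (e (r (e h))) = h \<Longrightarrow> h \<in> M \<or> r (e h) \<in> M"
    and noO: "\<And>h. h \<in> D \<Longrightarrow> r (r (e (r (r (e h))))) = h \<Longrightarrow> h \<in> M \<or> r (r (e h)) \<in> M"
begin

lemma face_count:
  "card {h \<in> D. r (e (r (e (r (e (r (e h))))))) \<noteq> h} + 20 * nfaces D r e \<le> 5 * card D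
    + 10 * card (cls (gr (\<lambda>h. r (e h)) D) ` {h \<in> M \<inter> D. r (e (r (e h))) = h})"
  unfolding nfaces_def
  by (rule cycle_count)
    (use closed_mapD(1,2,6)[OF cm] closed_map_inj(3)[OF cm] closed_map_face_cycle[OF cm] noU in auto)

lemma straight_count:
  "card {h \<in> D. (shift1 r e ^^ 4) h \<noteq> h} + 20 * nstraight D r e \<le> 5 * card D
    + 10 * card (cls (gr (\<lambda>h. r (r (e h))) D) ` {h \<in> M \<inter> D. r (r (e (r (r (e h))))) = h})"
  unfolding nstraight_def funpow4 shift1_def
  by (rule cycle_count)
    (use closed_mapD(1,2,6)[OF cm] closed_map_inj(4)[OF cm] closed_map_face_cycle[OF cm] noO in auto)

lemma finM: "finite M"
  using MD closed_mapD(1)[OF cm] finite_subset by auto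

lemma card_cls_M: "card (f ` {h \<in> M \<inter> D. P h}) \<le> card M"
proof -
  have "card (f ` {h \<in> M \<inter> D. P h}) \<le> card {h \<in> M \<inter> D. P h}"
    by (rule card_image_le) (use finM in auto)
  also have "\<dots> \<le> card M" by (rule card_mono) (use finM in auto)
  finally show ?thesis .
qed

text \<open>Twice the face count plus the straight count, inserted into \<open>5 * excess\<close>.
  The terms in \<open>card D\<close> cancel, and the marks enter 20 + 10 times.\<close>

lemma irregular_bound: "int (card (irregular D r e)) \<le> 5 * excess D r e + 30 * int (card M)"
proof -
  define B1 B2 where "B1 = card {h \<in> D. r (e (r (e (r (e (r (e h))))))) \<noteq> h}"
    and "B2 = card {h \<in> D. (shift1 r e ^^ 4) h \<noteq> h}"
  have B: "int (card (irregular D r e)) \<le> int B1 + int B2"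
    unfolding irregular_def B1_def B2_def of_nat_add[symmetric] of_nat_le_iff by (rule card_Un_le)
  have f: "int B1 + 20 * int (nfaces D r e) \<le> 5 * int (card D) + 10 * int (card M)"
    using face_count card_cls_M[of "cls (gr (\<lambda>h. r (e h)) D)" "\<lambda>h. r (e (r (e h))) = h"]
    unfolding B1_def by linarith
  have s: "int B2 + 20 * int (nstraight D r e) \<le> 5 * int (card D) + 10 * int (card M)"
    using straight_count
      card_cls_M[of "cls (gr (\<lambda>h. r (r (e h))) D)" "\<lambda>h. r (r (e (r (r (e h))))) = h"]
    unfolding B2_def by linarith
  have "0 \<le> int B1" "0 \<le> int (ncomps D r e)" by simp_all
  then show ?thesis using B f s unfolding excess_def by (simp add: algebra_simps)
qed

text \<open>With four marked half-edges equality would put them in four different bigons and four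
  different straight cycles of length two; then the map has two vertices, joined by four edges,
  and its two marked edges share a bigon or a straight cycle.\<close>

lemma piece_pos:
  assumes conn: "\<And>u v. u \<in> D \<Longrightarrow> v \<in> D \<Longrightarrow> (u, v) \<in> conn (mrel D r e)" and one: "ncomps D r e = 1"
  shows "1 \<le> 5 * excess D r e - 40 + 9 * int (card M)"
proof -
  note c = closed_mapD[OF cm]
  let ?F = "gr (\<lambda>h. r (e h)) D" and ?S = "gr (\<lambda>h. r (r (e h))) D"
  let ?MF = "{h \<in> M \<inter> D. r (e (r (e h))) = h}" and ?MS = "{h \<in> M \<inter> D. r (r (e (r (r (e h))))) = h}"
  \<comment> \<open>Two fifths of the face count plus one fifth of the straight count absorb exactly
    \<open>3 * card D\<close>.\<close>
  have q: "24 - 4 * int (card (cls ?F ` ?MF)) - 2 * int (card (cls ?S ` ?MS)) \<le> excess D r e"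
    using face_count straight_count one unfolding excess_def by linarith
  have le: "card (cls ?F ` ?MF) \<le> card M" "card (cls ?S ` ?MS) \<le> card M"
    by (rule card_cls_M)+
  have nn: "0 \<le> excess D r e" by (rule excess_nonneg[OF cm])
  have ne4: False if m: "card M = 4" and z: "excess D r e \<le> 0"
  proof -
    have 4: "card (cls ?F ` ?MF) = 4" "card (cls ?S ` ?MS) = 4" using q le m z by linarith+
    have cF: "card ?MF \<le> 4" "card ?MS \<le> 4" using m card_mono[OF finM, of ?MF] card_mono[OF finM, of ?MS] by auto
    have fin: "finite ?MF" "finite ?MS" using finM by auto
    have "card ?MF = 4" "card ?MS = 4"
      using 4 cF card_image_le[OF fin(1), of "cls ?F"] card_image_le[OF fin(2), of "cls ?S"] by linarith+
    then have eq: "?MF = M" "?MS = M" using m card_subset_eq[OF finM, of ?MF] card_subset_eq[OF finM, of ?MS] by auto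
    have inj: "inj_on (cls ?F) M" "inj_on (cls ?S) M"
      using 4 m eq finM by (auto intro!: eq_card_imp_inj_on)
    obtain x where x: "x \<in> M" using m by fastforce
    define y where "y = e x"
    have yM: "y \<in> M" using Me x by (simp add: y_def)
    have xD: "x \<in> D" "y \<in> D" using MD x yM by auto
    have ex: "e x = y" "e y = x" using c xD by (auto simp: y_def)
    have wxy: "w x \<noteq> w y" using c xD by (auto simp: y_def)
    have s: "r (e (r (e h))) = h" "r (r (e (r (r (e h))))) = h" if "h \<in> M" for h
      using that eq by auto
    have E1: "e (r y) = r (r (r x))" using s(1)[OF x] ex c xD by metis
    have E2: "e (r x) = r (r (r y))" using s(1)[OF yM] ex c xD by metis
    have E3: "e (r (r y)) = r (r x)" using s(2)[OF x] ex c xD by metis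
    have E: "e (r (r (r x))) = r y" "e (r (r (r y))) = r x" "e (r (r x)) = r (r y)"
      using E1 E2 E3 c xD by metis+
    have B: "block r x y \<subseteq> D" and Br: "\<And>h. h \<in> block r x y \<Longrightarrow> r h \<in> block r x y"
      using block_closed[OF cm xD] by auto
    have Be: "e h \<in> block r x y" if "h \<in> block r x y" for h
      using that E E1 E2 E3 ex by (auto simp: block_def vx_def)
    have sub: "D \<subseteq> block r x y"
    proof
      fix v assume "v \<in> D"
      then have "(x, v) \<in> conn (mrel D r e)" using conn xD by auto
      then have "x \<in> block r x y \<longleftrightarrow> v \<in> block r x y"
        by (rule conn_closed) (rule mrel_closed[OF cm Br Be])
      then show "v \<in> block r x y" by (simp add: block_def vx_def)
    qed
    have step: "(h, r (e h)) \<in> conn ?F" "(h, r (r (e h))) \<in> conn ?S" if "h \<in> D" for h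
      using that by (auto intro!: conn_base simp: gr_def)
    have nM: "r (e h) \<notin> M" "r (r (e h)) \<notin> M" if "h \<in> M" for h
    proof -
      have h: "h \<in> D" using that MD by auto
      show "r (e h) \<notin> M"
        using step(1)[OF h] inj(1) that closed_map_face_cycle(1)[OF cm h] by (metis cls_eq_iff inj_onD)
      show "r (r (e h)) \<notin> M"
        using step(2)[OF h] inj(2) that closed_map_face_cycle(3)[OF cm h] by (metis cls_eq_iff inj_onD)
    qed
    have n: "r y \<notin> M" "r x \<notin> M" "r (r y) \<notin> M" "r (r x) \<notin> M"
      using nM x yM ex by metis+
    then have "r (r (r x)) \<notin> M" "r (r (r y)) \<notin> M" using Me E by metis+
    then have "M \<subseteq> {x, y}" using n sub MD by (auto simp: block_def vx_def)
    then have "card M \<le> card {x, y}" by (intro card_mono) auto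
    also have "\<dots> \<le> 2" by (simp add: card_insert_if)
    finally show False using m by simp
  qed
  \<comment> \<open>Up to three marks \<open>q\<close> gives an excess of at least 24 - 6
    \<open>card M\<close>, which is enough. From five marks on, 9 * 5 > 40 needs only
    non-negativity. With four marks 36 falls short of 40, so excess zero has to be excluded.\<close>
  consider "card M \<le> 3" | "card M = 4" | "5 \<le> card M" by linarith
  then show ?thesis
  proof cases
    case 1 then show ?thesis using q le by linarith
  next
    case 2 then have "1 \<le> excess D r e" using ne4 by force
    then show ?thesis using 2 by simp
  next
    case 3 then show ?thesis using nn by linarith
  qed
qed

lemma restrict:
  assumes "X \<subseteq> D" "\<And>h. h \<in> X \<Longrightarrow> r h \<in> X" "\<And>h. h \<in> X \<Longrightarrow> e h \<in> X"
  shows "marked X r e w (M \<inter> X)"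
proof
  show "closed_map X r e w" by (rule closed_map_sub[OF cm assms])
  show "M \<inter> X \<subseteq> X" by auto
  show "e h \<in> M \<inter> X" if "h \<in> M \<inter> X" for h using that Me assms(3) by auto
  show "h \<in> M \<inter> X \<or> r (e h) \<in> M \<inter> X" if "h \<in> X" "r (e (r (e h))) = h" for h
    using noU[of h] assms that by (metis Int_iff subsetD)
  show "h \<in> M \<inter> X \<or> r (r (e h)) \<in> M \<inter> X" if "h \<in> X" "r (r (e (r (r (e h))))) = h" for h
    using noO[of h] assms that by (metis Int_iff subsetD)
qed

lemma ncomps_bound: "int (ncomps D r e) \<le> 5 * excess D r e - 40 * int (ncomps D r e) + 9 * int (card M)"
proof -
  note c = closed_mapD[OF cm]
  define C where "C = cls (mrel D r e) ` D"
  have cl: "u \<in> D \<longleftrightarrow> v \<in> D" if "(u, v) \<in> mrel D r e" for u v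
    using that c by (auto simp: mrel_def gr_def)
  have XD: "X \<subseteq> D" if "X \<in> C" for X
    using that conn_closed[OF _ cl] by (auto simp: C_def cls_def)
  have Xr: "r h \<in> X" "e h \<in> X" if X: "X \<in> C" "h \<in> X" for X h
  proof -
    have "h \<in> D" using XD X by auto
    then have "(h, r h) \<in> conn (mrel D r e)" "(h, e h) \<in> conn (mrel D r e)"
      by (auto intro!: conn_base simp: mrel_def gr_def)
    then show "r h \<in> X" "e h \<in> X" using X by (auto simp: C_def cls_def intro: conn_trans)
  qed
  have fin: "finite C" using c(1) by (simp add: C_def)
  have UC: "\<Union>C = D" using XD by (auto simp: C_def intro: cls_self)
  have disj: "disjoint C"
  proof (unfold disjoint_def, intro ballI impI, rule ccontr)
    fix A B assume A: "A \<in> C" and B: "B \<in> C" and n: "A \<noteq> B" "A \<inter> B \<noteq> {}"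
    then obtain x y z where "A = cls (mrel D r e) x" "B = cls (mrel D r e) y"
      "z \<in> cls (mrel D r e) x" "z \<in> cls (mrel D r e) y" unfolding C_def by blast
    then show False using n(1) cls_eq_iff[of "mrel D r e" x y] unfolding cls_def
      by (auto dest: conn_trans conn_sym)
  qed
  have f: "nfaces D r e = (\<Sum>X\<in>C. nfaces X r e)"
  proof -
    have "nfaces D r e = (\<Sum>X\<in>C. ncl X (gr (\<lambda>h. r (e h)) D))" unfolding nfaces_def
      by (rule ncl_UN) (use c(1) XD UC disj face_closed[OF cm XD Xr] in \<open>auto simp: gr_def\<close>)
    also have "\<dots> = (\<Sum>X\<in>C. nfaces X r e)"
      by (rule sum.cong) (use nfaces_sub[OF cm XD Xr] in auto)
    finally show ?thesis .
  qed
  have s: "nstraight D r e = (\<Sum>X\<in>C. nstraight X r e)"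
  proof -
    have "nstraight D r e = (\<Sum>X\<in>C. ncl X (gr (\<lambda>h. r (r (e h))) D))" unfolding nstraight_def
      by (rule ncl_UN) (use c(1) XD UC disj straight_closed[OF cm XD Xr] in \<open>auto simp: gr_def\<close>)
    also have "\<dots> = (\<Sum>X\<in>C. nstraight X r e)"
      by (rule sum.cong) (use nstraight_sub[OF cm XD Xr] in auto)
    finally show ?thesis .
  qed
  have conX: "(u, v) \<in> conn (mrel X r e)" if X: "X \<in> C" "u \<in> X" "v \<in> X" for X u v
  proof -
    have "cls (mrel D r e) u = cls (mrel D r e) v"
      using X by (auto simp: C_def cls_eq_iff) (auto simp: cls_def intro: conn_trans conn_sym)
    then show ?thesis
      using cls_mrel_sub[OF cm XD Xr, of X] X by (simp add: cls_eq_iff[symmetric])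
  qed
  have cX: "ncomps X r e = 1" if X: "X \<in> C" for X
  proof -
    obtain x where x: "x \<in> X" using X by (auto simp: C_def intro: cls_self)
    have "cls (mrel X r e) ` X = {cls (mrel X r e) x}"
    proof -
      have "cls (mrel X r e) u = cls (mrel X r e) x" if "u \<in> X" for u
        unfolding cls_eq_iff using conX[OF X that x] .
      then show ?thesis using x by blast
    qed
    then show ?thesis by (simp add: ncomps_def ncl_def)
  qed
  have cD: "ncomps D r e = card C" by (simp add: ncomps_def ncl_def C_def)
  have finX: "finite X" if "X \<in> C" for X using XD[OF that] c(1) finite_subset by auto
  have cardD: "card D = (\<Sum>X\<in>C. card X)"
    using card_Union_disjoint[of C] disj finX UC by (simp add: pairwise_def disjoint_def disjnt_def)
  have cardM: "card M = (\<Sum>X\<in>C. card (M \<inter> X))"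
  proof -
    have "M = (\<Union>X\<in>C. M \<inter> X)" using UC MD by auto
    moreover have "card (\<Union>X\<in>C. M \<inter> X) = (\<Sum>X\<in>C. card (M \<inter> X))"
      by (rule card_UN_disjoint) (use fin finM disj in \<open>auto simp: disjoint_def\<close>)
    ultimately show ?thesis by simp
  qed
  have "(\<Sum>X\<in>C. 1) \<le> (\<Sum>X\<in>C. 5 * excess X r e - 40 + 9 * int (card (M \<inter> X)))"
  proof (rule sum_mono)
    fix X assume X: "X \<in> C"
    interpret mX: marked X r e w "M \<inter> X" by (rule restrict[OF XD[OF X] Xr[OF X]])
    show "1 \<le> 5 * excess X r e - 40 + 9 * int (card (M \<inter> X))"
      by (rule mX.piece_pos) (use conX cX X in auto)
  qed
  also have "\<dots> = 5 * (\<Sum>X\<in>C. excess X r e) - 40 * int (card C) + 9 * int (card M)"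
    by (simp add: sum.distrib sum_subtractf sum_distrib_left cardM)
  also have "(\<Sum>X\<in>C. excess X r e) = excess D r e"
    unfolding excess_def using cX
    by (simp add: sum.distrib sum_subtractf sum_distrib_left[symmetric] f s cardD cD)
  finally show ?thesis by (simp add: cD)
qed

text \<open>Abbreviate the bracket by \<open>t\<close>. There are at most \<open>t\<close>
  components, so five times the excess plus nine times the marks is at most 41 \<open>t\<close>.
  Hence the irregular half-edges number at most (30 / 9) 41 \<open>t\<close>, below 137
  \<open>t\<close>, and 64 (137 + 1) < 20000.\<close>

lemma card_bound:
  "int (card D) \<le> 20000 * (5 * excess D r e - 40 * int (ncomps D r e) + 9 * int (card M))"
proof -
  define t where "t = 5 * excess D r e - 40 * int (ncomps D r e) + 9 * int (card M)"
  have d: "int (card D) \<le> 64 * int (card (irregular D r e)) + 64 * int (ncomps D r e)"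
    using flat_bound[OF cm] by linarith
  have ncomps: "int (ncomps D r e) \<le> t" using ncomps_bound unfolding t_def .
  have "5 * excess D r e + 9 * int (card M) = t + 40 * int (ncomps D r e)"
    by (simp add: t_def)
  moreover have "0 \<le> excess D r e" by (rule excess_nonneg[OF cm])
  moreover have "0 \<le> int (card M)" "0 \<le> t" using ncomps by simp_all
  ultimately have "int (card D) \<le> 20000 * t" using irregular_bound ncomps d by linarith
  then show ?thesis by (simp add: t_def)
qed

end

section \<open>A maximal family of disjoint dipoles\<close>

lemma ncl_involution:
  assumes "finite D" "\<And>h. h \<in> D \<Longrightarrow> e h \<in> D" "\<And>h. h \<in> D \<Longrightarrow> e (e h) = h"
  shows "card D \<le> 2 * ncl D (gr e D)"
proof -
  have cl: "u \<in> D \<longleftrightarrow> v \<in> D" if "(u, v) \<in> gr e D" for u v using that assms by (auto simp: gr_def)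
  have C: "card C \<le> 2" if C: "C \<in> cls (gr e D) ` D" for C
  proof -
    obtain h where h: "h \<in> D" "C = cls (gr e D) h" using C by auto
    have "(u \<in> {h, e h}) = (v \<in> {h, e h})" if "(u, v) \<in> gr e D" for u v
      using that assms h by (auto simp: gr_def) (metis assms(3))
    then have "C \<subseteq> {h, e h}" using conn_closed[of h _ "gr e D" "{h, e h}"] by (auto simp: h cls_def)
    then have "card C \<le> card {h, e h}" by (intro card_mono) auto
    also have "\<dots> \<le> 2" by (simp add: card_insert_if)
    finally show ?thesis .
  qed
  have "card D = (\<Sum>C\<in>cls (gr e D) ` D. card C)"
    using sum_cls[OF assms(1), of "gr e D" "\<lambda>_. 1::nat"] cl by simp
  also have "\<dots> \<le> (\<Sum>C\<in>cls (gr e D) ` D. 2)" using C by (intro sum_mono) auto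
  finally show ?thesis by (simp add: ncl_def mult.commute)
qed

text \<open>\<open>S\<close> lists the sides of the dipoles of the family, \<open>BB\<close> their half-edge sets, and \<open>R\<close> holds
  the half-edges of the root edge, which no dipole may use.\<close>

locale family =
  fixes D :: "'a set" and r e w S BB R
  assumes cm: "closed_map D r e w" and cl: "closable D r e w S" and one: "ncomps D r e = 1"
    and disj: "disjoint BB" and BD: "\<And>B. B \<in> BB \<Longrightarrow> B \<subseteq> D" and Bne: "\<And>B. B \<in> BB \<Longrightarrow> B \<noteq> {}"
    and B8: "\<And>B. B \<in> BB \<Longrightarrow> card B \<le> 8" and Br: "\<And>B h. B \<in> BB \<Longrightarrow> h \<in> B \<Longrightarrow> r h \<in> B"
    and Bi: "\<And>B h. B \<in> BB \<Longrightarrow> h \<in> B \<Longrightarrow> h \<notin> fst ` S \<union> snd ` S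
      \<Longrightarrow> e h \<in> B \<and> e h \<notin> fst ` S \<union> snd ` S"
    and BS: "\<And>B a b. B \<in> BB \<Longrightarrow> (a, b) \<in> S \<Longrightarrow> a \<in> B \<longleftrightarrow> b \<in> B"
    and SB: "fst ` S \<union> snd ` S \<subseteq> \<Union>BB" and cardS: "2 * card BB \<le> card S"
    and RD: "R \<subseteq> D" and Re: "\<And>h. h \<in> R \<Longrightarrow> e h \<in> R" and R2: "\<And>x y. x \<in> R \<Longrightarrow> y \<in> R \<Longrightarrow> y = x \<or> y = e x"
    and nontriv: "\<And>a b. (a, b) \<in> S \<Longrightarrow> e a = b \<Longrightarrow> a \<in> R"
    and noU: "\<And>h. h \<in> D - \<Union>BB \<Longrightarrow> e h \<notin> \<Union>BB \<Longrightarrow> e (r (e h)) \<notin> \<Union>BB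
      \<Longrightarrow> r (e (r (e h))) = h \<Longrightarrow> h \<in> R \<or> r (e h) \<in> R"
    and noO: "\<And>h. h \<in> D - \<Union>BB \<Longrightarrow> e h \<notin> \<Union>BB \<Longrightarrow> e (r (r (e h))) \<notin> \<Union>BB
      \<Longrightarrow> r (r (e (r (r (e h))))) = h \<Longrightarrow> h \<in> R \<or> r (r (e h)) \<in> R"
begin

lemmas c = closed_mapD[OF cm]

abbreviation "Sd \<equiv> fst ` S \<union> snd ` S"
abbreviation "Bl \<equiv> \<Union>BB"

text \<open>Crossing the edges at both ends of a side leads to another side. Edges exchange colours,
  whence the swapped order. Root half-edges are excluded because no chain passes through the root
  edge.\<close>

definition jn :: "'a \<times> 'a \<Rightarrow> bool" where
  "jn p \<longleftrightarrow> fst p \<notin> R \<and> snd p \<notin> R \<and> (e (snd p), e (fst p)) \<in> S"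

abbreviation "J \<equiv> {p \<in> S. jn p}"
abbreviation "N \<equiv> {p \<in> S. \<not> jn p}"
abbreviation "Bd \<equiv> {h \<in> D - Bl. e h \<in> Bl}"

lemma SD: "(a, b) \<in> S \<Longrightarrow> a \<in> D" "(a, b) \<in> S \<Longrightarrow> b \<in> D" "(a, b) \<in> S \<Longrightarrow> w a" "(a, b) \<in> S \<Longrightarrow> \<not> w b"
  and Sinj: "(a, b) \<in> S \<Longrightarrow> (a', b') \<in> S \<Longrightarrow> a = a' \<longleftrightarrow> b = b'"
  using cl unfolding closable_def by auto

lemma finS: "finite S"
  using cl c(1) unfolding closable_def by (meson finite_SigmaI finite_subset)

lemma BlD: "Bl \<subseteq> D" "finite Bl"
  using BD c(1) finite_subset[of Bl D] by auto

lemma Bl_r: "h \<in> Bl \<Longrightarrow> r h \<in> Bl"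
  using Br by auto

lemma Bd_side: "h \<in> Bd \<Longrightarrow> e h \<in> Sd"
proof (rule ccontr)
  assume h: "h \<in> Bd" "e h \<notin> Sd"
  then have "e (e h) \<in> Bl" using Bi by auto
  then show False using h c(7) by auto
qed

abbreviation "sides_of T \<equiv> fst ` T \<union> snd ` T"

text \<open>Give each half-edge the weight \<open>20\<close> minus its penalty.  The classes below are the closed rings
  and the paths traced by alternately crossing an edge and a side.  The penalties are chosen such
  that every class without root half-edges still weighs at least \<open>40\<close>, while their total is large
  enough to pay for the marks on the pieces and for the sides not joined to another side.\<close>

definition penalty :: "'a \<Rightarrow> int" where
  "penalty h = (if h \<in> Bd then 9 else 0) + (if h \<in> sides_of J then 10 else 0)
     + (if h \<in> sides_of N then 11 else 0)"

lemma card_sides: "T \<subseteq> S \<Longrightarrow> card (sides_of T) = 2 * card T"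
proof -
  assume T: "T \<subseteq> S"
  have i: "inj_on fst T" "inj_on snd T" using T Sinj by (force intro!: inj_onI)+
  have "fst ` T \<inter> snd ` T = {}" using T SD(3,4) by force
  then have "card (sides_of T) = card (fst ` T) + card (snd ` T)"
    using finite_subset[OF T finS] by (intro card_Un_disjoint) auto
  then show ?thesis using i by (simp add: card_image)
qed

lemma sidesD: "T \<subseteq> S \<Longrightarrow> sides_of T \<subseteq> D"
  using SD by force

lemma sum_pen: "(\<Sum>h\<in>D. penalty h) = 9 * int (card Bd) + 20 * int (card J) + 22 * int (card N)"
proof -
  have i: "(\<Sum>h\<in>D. if h \<in> X then k else 0) = k * int (card X)" if "X \<subseteq> D" for X and k :: int
    using that c(1) by (simp add: sum.If_cases Int_absorb1)
  have "(\<Sum>h\<in>D. penalty h) = 9 * int (card Bd) + 10 * int (card (sides_of J)) + 11 * int (card (sides_of N))"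
    unfolding penalty_def sum.distrib by (subst (1 2 3) i) (use sidesD[of J] sidesD[of N] in auto)
  then show ?thesis using card_sides[of J] card_sides[of N] by simp
qed

lemma penalty_Sd: "h \<in> Sd \<Longrightarrow> penalty h \<le> 11"
proof -
  assume h: "h \<in> Sd"
  have "h \<notin> Bd" using h SB by auto
  moreover have "\<not> (h \<in> sides_of J \<and> h \<in> sides_of N)"
  proof
    assume "h \<in> sides_of J \<and> h \<in> sides_of N"
    then obtain p q where p: "p \<in> J" "h = fst p \<or> h = snd p" and q: "q \<in> N" "h = fst q \<or> h = snd q"
      by auto
    have "w (fst p)" "\<not> w (snd p)" "w (fst q)" "\<not> w (snd q)"
      using p q SD(3,4)[of "fst p" "snd p"] SD(3,4)[of "fst q" "snd q"] by auto
    then have "p = q" using p q Sinj[of "fst p" "snd p" "fst q" "snd q"] by (auto simp: prod_eq_iff)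
    then show False using p q by auto
  qed
  ultimately show ?thesis by (auto simp: penalty_def)
qed

lemma penalty_joined: "h \<in> sides_of J \<Longrightarrow> penalty h \<le> 10"
proof -
  assume h: "h \<in> sides_of J"
  have "h \<notin> Bd" using h SB by auto
  moreover have "h \<notin> sides_of N"
  proof
    assume "h \<in> sides_of N"
    then obtain p q where p: "p \<in> J" "h = fst p \<or> h = snd p" and q: "q \<in> N" "h = fst q \<or> h = snd q"
      using h by auto
    have "w (fst p)" "\<not> w (snd p)" "w (fst q)" "\<not> w (snd q)"
      using p q SD(3,4)[of "fst p" "snd p"] SD(3,4)[of "fst q" "snd q"] by auto
    then have "p = q" using p q Sinj[of "fst p" "snd p" "fst q" "snd q"] by (auto simp: prod_eq_iff)
    then show False using p q by auto
  qed
  ultimately show ?thesis by (auto simp: penalty_def)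
qed

lemma penalty_other: "h \<notin> Sd \<Longrightarrow> penalty h \<le> (if h \<in> Bd then 9 else 0)"
  by (auto simp: penalty_def)

lemma penalty_le: "penalty h \<le> 11"
  using penalty_Sd[of h] penalty_other[of h] by (cases "h \<in> Sd") (auto split: if_splits)

lemma penalty_le_20: "penalty h \<le> 20"
  using penalty_le[of h] by simp

text \<open>The origin of 9, 10 and 11. An edge inside a block, or with both ends outside the
  blocks, carries no penalty and weighs 40. If a boundary half-edge occurs, there are two of them
  and a side, at least 2 (20 - 9) + 2 (20 - 11) = 40. Otherwise the class consists of sides: a side
  joined to another gives at least 4 (20 - 10) = 40, and an unjoined one leads to two further sides,
  at least 6 (20 - 11) = 54. Without root half-edges \<open>nontriv\<close> ensures that no side
  closes up on itself.\<close>

lemma class_weight: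
  assumes finC: "finite C" and CD: "C \<subseteq> D" and Ce: "\<And>h. h \<in> C \<Longrightarrow> e h \<in> C"
    and CS: "\<And>a b. (a, b) \<in> S \<Longrightarrow> a \<in> C \<longleftrightarrow> b \<in> C" and CR: "C \<inter> R = {}" and h0: "h0 \<in> C"
  shows "40 \<le> (\<Sum>h\<in>C. 20 - penalty h)"
proof -
  have mono: "(\<Sum>h\<in>K. 20 - penalty h) \<le> (\<Sum>h\<in>C. 20 - penalty h)" if "K \<subseteq> C" for K
    using that finC penalty_le_20 by (intro sum_mono2) auto
  have pair: ?thesis if h: "h \<in> C" "penalty h \<le> 0" "penalty (e h) \<le> 0" for h
  proof -
    have "h \<noteq> e h" using h CD c(9) by (metis subsetD)
    then have "(\<Sum>k\<in>{h, e h}. 20 - penalty k) = (20 - penalty h) + (20 - penalty (e h))" by simp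
    then show ?thesis using mono[of "{h, e h}"] h Ce by auto
  qed
  show ?thesis
  proof (cases "\<exists>h\<in>C. h \<in> Bl - Sd")
    case True
    then obtain h where h: "h \<in> C" "h \<in> Bl - Sd" by auto
    then have "e h \<in> Bl - Sd" using Bi by auto
    moreover have "penalty z \<le> 0" if "z \<in> Bl - Sd" for z
      using that penalty_other[of z] by (auto split: if_splits)
    ultimately show ?thesis using h pair[of h] by blast
  next
    case nI: False
    show ?thesis
    proof (cases "\<exists>h\<in>C. h \<in> D - Bl \<and> e h \<in> D - Bl")
      case True
      then obtain h where h: "h \<in> C" "h \<in> D - Bl" "e h \<in> D - Bl" by auto
      have "e (e h) \<in> D - Bl" using h c(7) by auto
      moreover have "penalty z \<le> 0" if "z \<in> D - Bl" "e z \<in> D - Bl" for z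
      proof -
        have z: "z \<notin> Sd" "z \<notin> Bd" using that SB by blast+
        show ?thesis using penalty_other[OF z(1)] unfolding if_not_P[OF z(2)] .
      qed
      ultimately show ?thesis using h pair[of h] by blast
    next
      case nInt: False
      have CBd: "h \<in> Bd \<or> h \<in> Sd" if "h \<in> C" for h using that nI nInt CD c(6) by blast
      show ?thesis
      proof (cases "\<exists>h\<in>C. h \<in> Bd")
        case True
        then obtain h where h: "h \<in> C" "h \<in> Bd" by auto
        \<comment> \<open>A colour balance yields the second boundary half-edge. \<open>e\<close>
          exchanges the colours inside \<open>C\<close>, and each side has one half-edge of either
          colour, so white and black boundary half-edges are equally many.\<close>
        have bij: "card {x \<in> C. w x} = card {x \<in> C. \<not> w x}"
        proof (rule bij_betw_same_card[of e], rule bij_betwI[where g = e])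
          show "e \<in> {x \<in> C. w x} \<rightarrow> {x \<in> C. \<not> w x}" "e \<in> {x \<in> C. \<not> w x} \<rightarrow> {x \<in> C. w x}"
            using Ce CD c(8) by auto
        qed (use CD c(7) in auto)
        let ?T = "{p \<in> S. fst p \<in> C}"
        have T: "fst ` ?T = {x \<in> C \<inter> Sd. w x}" "snd ` ?T = {x \<in> C \<inter> Sd. \<not> w x}"
        proof -
          show "fst ` ?T = {x \<in> C \<inter> Sd. w x}" using SD(3,4) by (auto simp: image_iff)
          show "snd ` ?T = {x \<in> C \<inter> Sd. \<not> w x}" using SD(3,4) CS by (auto simp: image_iff)
        qed
        have "card (fst ` ?T) = card ?T" "card (snd ` ?T) = card ?T"
          by (rule card_image, use Sinj in \<open>force intro!: inj_onI\<close>)+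
        then have sb: "card {x \<in> C \<inter> Sd. w x} = card {x \<in> C \<inter> Sd. \<not> w x}" using T by metis
        have split: "{x \<in> C. P x} = {x \<in> C \<inter> Sd. P x} \<union> {x \<in> C \<inter> Bd. P x}" for P
          using CBd by blast
        have spl: "card {x \<in> C. P x} = card {x \<in> C \<inter> Sd. P x} + card {x \<in> C \<inter> Bd. P x}" for P
          by (subst split, rule card_Un_disjoint) (use finC SB in auto)
        have bb: "card {x \<in> C \<inter> Bd. w x} = card {x \<in> C \<inter> Bd. \<not> w x}"
          using bij sb spl[of w] spl[of "\<lambda>x. \<not> w x"] by linarith
        define A B where "A = {x \<in> C \<inter> Bd. w x}" and "B = {x \<in> C \<inter> Bd. \<not> w x}"
        have "finite A" "finite B" "card A = card B" using finC bb by (simp_all add: A_def B_def)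
        then have "A = {} \<longleftrightarrow> B = {}" by (metis card_0_eq)
        moreover have "h \<in> A \<or> h \<in> B" using h by (auto simp: A_def B_def)
        ultimately have "\<exists>k. k \<in> (if w h then B else A)" by (auto simp: A_def B_def)
        then have "\<exists>k. k \<in> C \<and> k \<in> Bd \<and> w k \<noteq> w h"
          by (auto simp: A_def B_def split: if_splits)
        then obtain k where k: "k \<in> C" "k \<in> Bd" "w k \<noteq> w h" by auto
        obtain a b where ab: "(a, b) \<in> S" "e h = a \<or> e h = b" using Bd_side[OF h(2)] by auto
        have abC: "a \<in> C" "b \<in> C" using ab Ce[OF h(1)] CS by auto
        have n: "h \<noteq> k" "h \<noteq> a" "h \<noteq> b" "k \<noteq> a" "k \<noteq> b" "a \<noteq> b"
        proof -
          have "a \<in> Sd" "b \<in> Sd" using ab(1) by force+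
          then have "a \<in> Bl" "b \<in> Bl" using SB by blast+
          moreover have "h \<notin> Bl" "k \<notin> Bl" using h k by blast+
          ultimately show "h \<noteq> k" "h \<noteq> a" "h \<noteq> b" "k \<noteq> a" "k \<noteq> b" "a \<noteq> b"
            using k(3) SD(3,4)[OF ab(1)] by metis+
        qed
        then have "(\<Sum>x\<in>{h, k, a, b}. 20 - penalty x) = (20 - penalty h) + (20 - penalty k) + (20 - penalty a) + (20 - penalty b)"
          by simp
        moreover have "penalty z \<le> 9" if "z \<in> Bd" for z
        proof -
          have z: "z \<notin> Sd" using that SB by blast
          show ?thesis using penalty_other[OF z] unfolding if_P[OF that] .
        qed
        then have "penalty h \<le> 9" "penalty k \<le> 9" using h k by blast+
        moreover have "{h, k, a, b} \<subseteq> C" using h k abC by blast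
        ultimately show ?thesis
          using mono[of "{h, k, a, b}"] penalty_le[of a] penalty_le[of b] by linarith
      next
        case nB: False
        then have CSd: "x \<in> Sd" if "x \<in> C" for x using CBd[OF that] that by blast
        obtain a b where ab: "(a, b) \<in> S" and aC: "a \<in> C" "b \<in> C"
          using CSd[OF h0] h0 CS by auto
        define x y where "x = e a" and "y = e b"
        have xy: "x \<in> C" "y \<in> C" using Ce aC by (auto simp: x_def y_def)
        have wab: "w a" "\<not> w b" using SD ab by auto
        have wxy: "\<not> w x" "w y" using c(8) wab SD(1,2)[OF ab] by (auto simp: x_def y_def)
        have aR: "a \<notin> R" "b \<notin> R" using CR aC by auto
        have xb: "x \<noteq> b" using nontriv[OF ab] aR by (auto simp: x_def)
        then have ya: "y \<noteq> a" using c(7) SD(1,2)[OF ab] by (auto simp: x_def y_def)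
        have d: "a \<noteq> b" "a \<noteq> x" "a \<noteq> y" "b \<noteq> x" "b \<noteq> y" "x \<noteq> y"
          using wab wxy xb ya by metis+
        show ?thesis
        proof (cases "jn (a, b)")
          case True
          have exy: "e x = a" "e y = b" using c(7) SD(1,2)[OF ab] by (auto simp: x_def y_def)
          have yx: "(y, x) \<in> S" using True by (simp add: jn_def x_def y_def)
          have "jn (y, x)" using True exy Re ab CR xy by (auto simp: jn_def)
          then have "a \<in> sides_of J" "b \<in> sides_of J" "x \<in> sides_of J" "y \<in> sides_of J"
            using True ab yx by force+
          then have "penalty a \<le> 10" "penalty b \<le> 10" "penalty x \<le> 10" "penalty y \<le> 10"
            using penalty_joined by auto
          moreover have "(\<Sum>z\<in>{a, b, x, y}. 20 - penalty z) = (20 - penalty a) + (20 - penalty b) + (20 - penalty x) + (20 - penalty y)"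
            using d by simp
          moreover have "{a, b, x, y} \<subseteq> C" using aC xy by blast
          ultimately show ?thesis using mono[of "{a, b, x, y}"] by linarith
        next
          case False
          have nS: "(y, x) \<notin> S" using False aR by (simp add: jn_def x_def y_def)
          obtain x' where x': "(x', x) \<in> S" using CSd[OF xy(1)] wxy SD(3) by fastforce
          obtain y' where y': "(y, y') \<in> S" using CSd[OF xy(2)] wxy SD(4) by fastforce
          have C': "x' \<in> C" "y' \<in> C" using CS[OF x'] CS[OF y'] xy by auto
          have w': "w x'" "\<not> w y'" using SD x' y' by auto
          have n: "x' \<noteq> y" "y' \<noteq> x" "x' \<noteq> a" "y' \<noteq> b"
            using nS x' y' Sinj[OF ab x'] Sinj[OF ab y'] xb ya by auto
          have "(\<Sum>z\<in>{a, b, x, y, x', y'}. 20 - penalty z)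
            = (20 - penalty a) + (20 - penalty b) + (20 - penalty x) + (20 - penalty y) + (20 - penalty x') + (20 - penalty y')"
          proof -
            have "a \<noteq> x'" "b \<noteq> x'" "x \<noteq> x'" "y \<noteq> x'" "a \<noteq> y'" "b \<noteq> y'" "x \<noteq> y'" "y \<noteq> y'" "x' \<noteq> y'"
              using wab wxy w' n by metis+
            then show ?thesis using d by simp
          qed
          moreover have "{a, b, x, y, x', y'} \<subseteq> C" using aC xy C' by blast
          ultimately show ?thesis
            using mono[of "{a, b, x, y, x', y'}"] penalty_le[of a] penalty_le[of b] penalty_le[of x]
              penalty_le[of y] penalty_le[of x'] penalty_le[of y'] by linarith
        qed
      qed
    qed
  qed
qed

text \<open>The weights of \<open>class_weight\<close> summed over all classes. The root half-edges
  form a single edge and so lie in one class; that class may weigh less than 40, which accounts for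
  the additive 40.\<close>

lemma ring_count:
  "40 * int (ncl D (gr e D \<union> S)) \<le> 40 + 20 * int (card D)
     - 9 * int (card Bd) - 20 * int (card J) - 22 * int (card N)"
proof -
  let ?R = "gr e D \<union> S"
  have clD: "u \<in> D \<longleftrightarrow> v \<in> D" if "(u, v) \<in> ?R" for u v
    using that c SD by (auto simp: gr_def)
  have sub: "cls ?R h \<subseteq> D" if "h \<in> D" for h
    using conn_closed[of h _ ?R D] clD that by (auto simp: cls_def)
  let ?C = "cls ?R ` D"
  let ?Z = "{C \<in> ?C. C \<inter> R \<noteq> {}}"
  have fin: "finite ?C" using c(1) by simp
  have eC: "e h \<in> C" if "C \<in> ?C" "h \<in> C" for C h
  proof -
    have "h \<in> D" using that sub by auto
    then have "(h, e h) \<in> conn ?R" by (auto intro!: conn_base simp: gr_def)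
    then show ?thesis using that by (auto simp: cls_def intro: conn_trans)
  qed
  have CS: "a \<in> C \<longleftrightarrow> b \<in> C" if "C \<in> ?C" "(a, b) \<in> S" for C a b
  proof -
    have "(a, b) \<in> conn ?R" using that by (auto intro: conn_base)
    then show ?thesis using that by (auto simp: cls_def intro: conn_trans conn_sym)
  qed
  have Z1: "card ?Z \<le> 1"
  proof -
    have "A = B" if A: "A \<in> ?Z" and B: "B \<in> ?Z" for A B
    proof -
      obtain u v x y where A': "A = cls ?R u" "x \<in> A" "x \<in> R" and B': "B = cls ?R v" "y \<in> B" "y \<in> R"
        using A B by auto
      have "x \<in> B" using R2[of y x] A' B' eC[of B y] B by auto
      then have "(u, v) \<in> conn ?R" using A' B' by (auto simp: cls_def intro: conn_trans conn_sym)
      then show ?thesis using A' B' by (simp add: cls_eq_iff)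
    qed
    moreover have "finite ?Z" using fin by simp
    ultimately show ?thesis unfolding One_nat_def by (subst card_le_Suc0_iff_eq) blast+
  qed
  have "(\<Sum>C\<in>?C. if C \<in> ?Z then 0 else 40) \<le> (\<Sum>C\<in>?C. \<Sum>h\<in>C. 20 - penalty h)"
  proof (rule sum_mono)
    fix C assume C: "C \<in> ?C"
    have CD: "C \<subseteq> D" using C sub by auto
    have fC: "finite C" using CD c(1) finite_subset by auto
    show "(if C \<in> ?Z then 0 else 40) \<le> (\<Sum>h\<in>C. 20 - penalty h)"
    proof (cases "C \<in> ?Z")
      case True
      have "0 \<le> (\<Sum>h\<in>C. 20 - penalty h)" using penalty_le_20 by (intro sum_nonneg) auto
      then show ?thesis using True by simp
    next
      case False
      obtain h0 where "h0 \<in> C" using C by (auto intro: cls_self)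
      then have "40 \<le> (\<Sum>h\<in>C. 20 - penalty h)"
        using class_weight[OF fC CD eC[OF C] CS[OF C]] False C by auto
      then show ?thesis using False by simp
    qed
  qed
  also have "(\<Sum>C\<in>?C. \<Sum>h\<in>C. 20 - penalty h) = (\<Sum>h\<in>D. 20 - penalty h)"
    by (rule sum_cls) (use c(1) clD in auto)
  also have "\<dots> = 20 * int (card D) - (9 * int (card Bd) + 20 * int (card J) + 22 * int (card N))"
    using sum_pen by (simp add: sum_subtractf)
  also have "(\<Sum>C\<in>?C. if C \<in> ?Z then 0 else 40) = 40 * int (card (?C - ?Z))"
  proof -
    have "(\<Sum>C\<in>?C. if C \<in> ?Z then 0 else 40) = (\<Sum>C\<in>?C - ?Z. 40::int)"
      by (rule sum.mono_neutral_cong_right) (use fin in auto)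
    then show ?thesis by simp
  qed
  finally have 1: "40 * int (card (?C - ?Z))
    \<le> 20 * int (card D) - (9 * int (card Bd) + 20 * int (card J) + 22 * int (card N))" .
  have "card ?C = card ?Z + card (?C - ?Z)"
    using fin card_Un_disjoint[of ?Z "?C - ?Z"] by (simp add: Un_absorb1 Collect_subset subset_iff Un_Diff_cancel)
  then show ?thesis using 1 Z1 unfolding ncl_def by linarith
qed

lemma closed_family:
  obtains e' n where "closed_map D r e' w" "\<And>h. h \<in> D \<Longrightarrow> h \<notin> Sd \<Longrightarrow> e h \<notin> Sd \<Longrightarrow> e' h = e h"
    "\<And>a b. (a, b) \<in> S \<Longrightarrow> e' a = b" "Psi D r e' + 2 * int n \<le> Psi D r e"
    "ncl D (gr e' D \<union> S) \<le> ncl D (gr e D \<union> S) + n"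
proof -
  from close_sides[OF cm cl subset_refl] obtain e' n where H: "closed_map D r e' w"
    "\<forall>h\<in>D. h \<notin> Sd \<longrightarrow> e h \<notin> Sd \<longrightarrow> e' h = e h" "\<forall>(a, b)\<in>S. e' a = b"
    "Psi D r e' + 2 * int n \<le> Psi D r e" "ncl D (gr e' D \<union> S) \<le> ncl D (gr e D \<union> S) + n"
    by blast
  show thesis
  proof (rule that[of e' n])
    show "e' a = b" if "(a, b) \<in> S" for a b using H(3) that by auto
    show "e' h = e h" if "h \<in> D" "h \<notin> Sd" "e h \<notin> Sd" for h using H(2) that by auto
  qed (use H in auto)
qed

text \<open>With all sides closed, \<open>D - Bl\<close> is a marked map whose size is controlled by
  \<open>t\<close>. The inequality \<open>main\<close> compares \<open>t\<close> with the excess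
  before closing, and its surplus of 2 per unjoined side bounds the number of these.\<close>

lemma family_bounds:
  "2 * int (card N) \<le> 5 * excess D r e + 18"
  "int (card (D - Bl)) \<le> 20000 * (5 * excess D r e + 18)"
proof -
  obtain e' n where cm': "closed_map D r e' w"
    and same: "\<And>h. h \<in> D \<Longrightarrow> h \<notin> Sd \<Longrightarrow> e h \<notin> Sd \<Longrightarrow> e' h = e h"
    and closed: "\<And>a b. (a, b) \<in> S \<Longrightarrow> e' a = b" and psi: "Psi D r e' + 2 * int n \<le> Psi D r e"
    and nc: "ncl D (gr e' D \<union> S) \<le> ncl D (gr e D \<union> S) + n"
    using closed_family by blast
  note c' = closed_mapD[OF cm']
  have Be: "e' h \<in> B" if B: "B \<in> BB" "h \<in> B" for B h
  proof (cases "h \<in> Sd")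
    case True
    then obtain a b where ab: "(a, b) \<in> S" "h = a \<or> h = b" by auto
    have "e' a = b" "e' b = a" using closed[OF ab(1)] c'(7) SD(1)[OF ab(1)] by auto
    then show ?thesis using BS[OF B(1) ab(1)] ab B by auto
  next
    case False
    have "h \<in> D" using BD B by auto
    then show ?thesis using same[of h] Bi[OF B False] False by auto
  qed
  have Ble: "e' h \<in> Bl" if "h \<in> Bl" for h using that Be by auto
  have cmB: "closed_map Bl r e' w" by (rule closed_map_sub[OF cm' BlD(1) Bl_r Ble])
  have cmY: "closed_map (D - Bl) r e' w" by (rule counts_Un(4)[OF cm' BlD(1) Bl_r Ble])
  note cY = closed_mapD[OF cmY]
  \<comment> \<open>The marks: the half-edges that were attached to a block before closing, and the
    root half-edges outside the blocks.\<close>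
  define M where "M = Bd \<union> (R \<inter> (D - Bl))"
  have unm: "e' h = e h" "e h \<notin> Bl" if "h \<in> D - Bl" "h \<notin> M" for h
  proof -
    show "e h \<notin> Bl" using that by (auto simp: M_def)
    then have "h \<notin> Sd" "e h \<notin> Sd" using that SB by blast+
    then show "e' h = e h" using that same[of h] by blast
  qed
  interpret m: marked "D - Bl" r e' w M
  proof
    show "closed_map (D - Bl) r e' w" by (rule cmY)
    show "M \<subseteq> D - Bl" by (auto simp: M_def)
    show "e' h \<in> M" if h: "h \<in> M" for h
    proof (rule ccontr)
      assume n: "e' h \<notin> M"
      have hD: "h \<in> D - Bl" using h by (auto simp: M_def)
      then have e'D: "e' h \<in> D - Bl" using cY(6) by blast
      have k: "e' (e' h) = e (e' h)" "e (e' h) \<notin> Bl" using unm[OF e'D n] by auto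
      have "e (e' h) = h" using k(1) cY(7)[OF hD] by simp
      moreover have "e (e (e' h)) = e' h" by (rule c(7)) (use e'D in auto)
      ultimately have eq: "e h = e' h" by metis
      then have "h \<in> R" using h e'D by (auto simp: M_def)
      then have "e h \<in> R" by (rule Re)
      then have "e' h \<in> R" by (simp only: eq)
      then show False using n e'D by (auto simp: M_def)
    qed
    show "h \<in> M \<or> r (e' h) \<in> M" if h: "h \<in> D - Bl" "r (e' (r (e' h))) = h" for h
    proof (rule ccontr)
      assume n: "\<not> ?thesis"
      have k: "r (e' h) \<in> D - Bl" using cY(2,6) h by blast
      have 1: "e' h = e h" "e h \<notin> Bl" using unm[OF h(1)] n by auto
      have 2: "e' (r (e h)) = e (r (e h))" "e (r (e h)) \<notin> Bl" using unm[OF k] n 1 by auto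
      have "h \<in> R \<or> r (e h) \<in> R" by (rule noU) (use h 1 2 in auto)
      then show False using n h k 1 by (auto simp: M_def)
    qed
    show "h \<in> M \<or> r (r (e' h)) \<in> M" if h: "h \<in> D - Bl" "r (r (e' (r (r (e' h))))) = h" for h
    proof (rule ccontr)
      assume n: "\<not> ?thesis"
      have k: "r (r (e' h)) \<in> D - Bl" using cY(2,6) h by blast
      have 1: "e' h = e h" "e h \<notin> Bl" using unm[OF h(1)] n by auto
      have 2: "e' (r (r (e h))) = e (r (r (e h)))" "e (r (r (e h))) \<notin> Bl" using unm[OF k] n 1 by auto
      have "h \<in> R \<or> r (r (e h)) \<in> R" by (rule noO) (use h 1 2 in auto)
      then show False using n h k 1 by (auto simp: M_def)
    qed
  qed
  have "card R \<le> 2"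
  proof (cases "R = {}")
    case False
    then obtain x where "x \<in> R" by auto
    then have "R \<subseteq> {x, e x}" using R2 by auto
    then have "card R \<le> card {x, e x}" by (intro card_mono) auto
    then show ?thesis by (simp add: card_insert_if split: if_splits)
  qed simp
  moreover have "card (R \<inter> (D - Bl)) \<le> card R"
    using RD c(1) finite_subset by (intro card_mono) auto
  ultimately have M: "card M \<le> card Bd + 2"
    unfolding M_def using card_Un_le[of Bd "R \<inter> (D - Bl)"] by linarith
  \<comment> \<open>After closing, each block is invariant under both permutations and so contains a
    component of its own.\<close>
  have cB: "card BB \<le> ncomps Bl r e'"
  proof -
    let ?f = "\<lambda>B. cls (mrel Bl r e') (SOME x. x \<in> B)"
    have some: "(SOME x. x \<in> B) \<in> B" if "B \<in> BB" for B using Bne[OF that] some_in_eq by auto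
    have sub: "?f B \<subseteq> B" if B: "B \<in> BB" for B
    proof
      fix z assume "z \<in> ?f B"
      then have "((SOME x. x \<in> B), z) \<in> conn (mrel Bl r e')" by (simp add: cls_def)
      then have "(SOME x. x \<in> B) \<in> B \<longleftrightarrow> z \<in> B"
        by (rule conn_closed) (rule mrel_closed[OF cmB Br[OF B] Be[OF B]])
      then show "z \<in> B" using some[OF B] by simp
    qed
    have "inj_on ?f BB"
    proof (rule inj_onI)
      fix A B assume A: "A \<in> BB" and B: "B \<in> BB" and eq: "?f A = ?f B"
      have "(SOME x. x \<in> A) \<in> ?f A" by (rule cls_self)
      then have "(SOME x. x \<in> A) \<in> A \<inter> B" using sub[OF A] sub[OF B] eq by blast
      then show "A = B" using disj A B by (auto simp: disjoint_def)
    qed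
    then have "card BB = card (?f ` BB)" by (simp add: card_image)
    also have "\<dots> \<le> card (cls (mrel Bl r e') ` Bl)"
      using BlD(2) some by (intro card_mono) auto
    finally show ?thesis by (simp add: ncomps_def ncl_def)
  qed
  have card_Bl: "card Bl \<le> 8 * card BB"
  proof -
    have "card Bl \<le> (\<Sum>B\<in>BB. card B)" by (rule card_Union_le_sum_card)
    also have "\<dots> \<le> (\<Sum>B\<in>BB. 8)" using B8 by (intro sum_mono) auto
    finally show ?thesis by simp
  qed
  \<comment> \<open>All sides are edges now, so the rings are just the edges,
    \<open>card D / 2\<close> in number. Together with \<open>nc\<close> this bounds the number
    \<open>n\<close> of switches from below.\<close>
  have "gr e' D \<union> S = gr e' D" using closed SD by (auto simp: gr_def)
  then have nD: "card D \<le> 2 * (ncl D (gr e D \<union> S) + n)"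
    using ncl_involution[of D e'] c' nc by auto
  have JN: "card S = card J + card N"
  proof -
    have "S = J \<union> N" by auto
    then show ?thesis using finS card_Un_disjoint[of J N] by (simp add: disjoint_iff)
  qed
  have dD: "card D = card Bl + card (D - Bl)"
    using BlD c(1) by (metis card_Diff_subset card_mono le_add_diff_inverse)
  have fs: "2 * nfaces Bl r e' \<le> card Bl" "2 * nstraight Bl r e' \<le> card Bl"
    by (rule nfaces_le[OF cmB], rule nstraight_le[OF cmB])
  define Y where "Y = D - Bl"
  have P': "Psi D r e' = Psi Bl r e' + Psi Y r e'"
    unfolding Y_def by (rule excess_Un(2)[OF cm' BlD(1) Bl_r Ble])
  have PB: "Psi Bl r e' = 4 * int (ncomps Bl r e') - 2 * int (nfaces Bl r e') - int (nstraight Bl r e')"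
    by (simp add: Psi_def)
  have q: "excess D r e = 4 * Psi D r e + 8 + 3 * int (card D)" by (simp add: excess_Psi one)
  have qY: "excess Y r e' = 4 * Psi Y r e' + 8 * int (ncomps Y r e') + 3 * int (card Y)" by (simp add: excess_Psi)
  define t where "t = 5 * excess Y r e' - 40 * int (ncomps Y r e') + 9 * int (card M)"
  have t: "t = 20 * Psi Y r e' + 15 * int (card Y) + 9 * int (card M)"
    unfolding t_def qY by simp
  \<comment> \<open>The switches contribute 40 \<open>n\<close>, which \<open>ring_count\<close>
    turns into 9 per boundary half-edge, 20 per joined and 22 per unjoined side, minus 40. The 9
    pays for the marks, 20 per side pay for the blocks by \<open>lower\<close>, the -40 is offset by
    the one component of \<open>D\<close>, and 18 = 9 * 2 is the price of the root
    half-edges.\<close>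
  have main: "t + 2 * int (card N) \<le> 5 * excess D r e + 18"
  proof -
    have dY: "int (card D) = int (card Bl) + int (card Y)" using dD by (simp add: Y_def)
    have n': "int (card D) \<le> 2 * int (ncl D (gr e D \<union> S)) + 2 * int n" using nD by simp
    have J': "int (card S) = int (card J) + int (card N)" using JN by simp
    have f': "2 * int (nfaces Bl r e') \<le> int (card Bl)" "2 * int (nstraight Bl r e') \<le> int (card Bl)"
      using fs by linarith+
    have b': "int (card BB) \<le> int (ncomps Bl r e')" "int (card Bl) \<le> 8 * int (card BB)"
      "2 * int (card BB) \<le> int (card S)" using cB card_Bl cardS by linarith+
    have m': "int (card M) \<le> int (card Bd) + 2" using M by linarith
    \<comment> \<open>At most half as many faces and straight orbits as half-edges leave 80 per
      component minus 15 per half-edge of \<open>Bl\<close>, hence at least 80 - 120 = -40 per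
      block, and there are at least two sides per block.\<close>
    have lower: "20 * Psi Bl r e' + 15 * int (card Bl) + 20 * int (card S) \<ge> 0"
      using PB f' b' by linarith
    have 1: "40 * int n \<ge> 9 * int (card Bd) + 20 * int (card J) + 22 * int (card N) - 40"
      using n' ring_count by linarith
    show ?thesis using lower 1 t q P' psi dY J' m' by linarith
  qed
  have t1: "int (ncomps Y r e') \<le> t" using m.ncomps_bound unfolding t_def Y_def .
  have t2: "int (card Y) \<le> 20000 * t" using m.card_bound unfolding t_def Y_def .
  show "2 * int (card N) \<le> 5 * excess D r e + 18" using main t1 by linarith
  have "0 \<le> int (card N)" by simp
  then have "t \<le> 5 * excess D r e + 18" using main by linarith
  then have "20000 * t \<le> 20000 * (5 * excess D r e + 18)" by (intro mult_left_mono) auto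
  then show "int (card (D - Bl)) \<le> 20000 * (5 * excess D r e + 18)"
    using t2 unfolding Y_def by linarith
qed

end

section \<open>Two-point maps and their closures\<close>

abbreviation ce :: "'a hmap \<Rightarrow> 'a \<Rightarrow> 'a" where
  "ce M \<equiv> edge (closure_map M)"

lemma rot_period:
  assumes "finite D" "bij_betw r D D" "h \<in> D" "card (orbit r h) = 4"
  shows "r (r (r (r h))) = h" "r (r h) \<noteq> h"
proof -
  have rD: "x \<in> D \<Longrightarrow> r x \<in> D" for x using assms(2) by (auto simp: bij_betw_def)
  obtain n where "n > 0" "(r ^^ n) h = h"
    using funpow_period[of D r h] assms rD by (auto simp: bij_betw_def)
  then have self: "h \<in> orbit r h" by (auto simp: orbit_altdef intro!: exI[of _ n])
  have "card (orbit r h) = funpow_dist1 r h h"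
    using orbit_conv_funpow_dist1[OF self] inj_on_funpow_dist1[OF self] by (simp add: card_image)
  then have 4: "funpow_dist1 r h h = 4" using assms(4) by simp
  have "(r ^^ funpow_dist1 r h h) h = h" by (rule funpow_dist1_prop[OF self])
  then show "r (r (r (r h))) = h" unfolding 4 by (simp add: numeral_eq_Suc)
  have "(r ^^ 2) h \<noteq> h" by (rule funpow_dist1_least) (simp_all add: 4)
  then show "r (r h) \<noteq> h" by (simp add: numeral_eq_Suc)
qed

lemma closure_simps [simp]:
  "darts (closure_map M) = darts M" "rot (closure_map M) = rot M" "white (closure_map M) = white M"
  by (simp_all add: closure_map_def)

lemma wf_hmapD:
  assumes "wf_hmap M"
  shows "finite (darts M)" "h \<in> darts M \<Longrightarrow> rot M h \<in> darts M"
    "h \<in> darts M \<Longrightarrow> rot M (rot M (rot M (rot M h))) = h" "h \<in> darts M \<Longrightarrow> rot M (rot M h) \<noteq> h"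
    "h \<in> darts M \<Longrightarrow> white M (rot M h) = white M h" "h \<in> darts M \<Longrightarrow> edge M h \<in> darts M"
    "h \<in> darts M \<Longrightarrow> edge M (edge M h) = h"
    "h \<in> darts M \<Longrightarrow> edge M h \<noteq> h \<Longrightarrow> white M (edge M h) \<noteq> white M h"
  using assms rot_period[of "darts M" "rot M" h]
  unfolding wf_hmap_def bij_betw_def by auto

lemma two_pointE:
  assumes "two_point_map M"
  obtains p q where "free_darts M = {p, q}" "white M p" "\<not> white M q" "p \<in> darts M" "q \<in> darts M"
    "edge M p = p" "edge M q = q" "ce M p = q" "ce M q = p"
    "\<And>h. h \<notin> {p, q} \<Longrightarrow> ce M h = edge M h"
    "\<And>h. h \<in> darts M \<Longrightarrow> h \<notin> {p, q} \<Longrightarrow> edge M h \<noteq> h"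
    "other_free M p = q" "other_free M q = p"
proof -
  obtain p q where f: "free_darts M = {p, q}" "white M p" "\<not> white M q"
    using assms by (auto simp: two_point_map_def)
  then have pq: "p \<noteq> q" by auto
  have o: "other_free M p = q" "other_free M q = p"
    unfolding other_free_def using f(1) pq by (auto intro!: the_equality)
  have m: "p \<in> free_darts M" "q \<in> free_darts M" using f by auto
  show thesis
    by (rule that[of p q]) (use f o m in \<open>auto simp: closure_map_def free_darts_def\<close>)
qed

lemma two_point_closed_map:
  assumes "two_point_map M"
  shows "closed_map (darts M) (rot M) (ce M) (white M)"
proof -
  have wf: "wf_hmap M" using assms by (simp add: two_point_map_def)
  note W = wf_hmapD[OF wf]
  obtain p q where P: "free_darts M = {p, q}" "white M p" "\<not> white M q" "p \<in> darts M" "q \<in> darts M"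
    "edge M p = p" "edge M q = q" "ce M p = q" "ce M q = p"
    "\<And>h. h \<notin> {p, q} \<Longrightarrow> ce M h = edge M h"
    "\<And>h. h \<in> darts M \<Longrightarrow> h \<notin> {p, q} \<Longrightarrow> edge M h \<noteq> h"
    using two_pointE[OF assms] by metis
  have "ce M h \<in> darts M \<and> ce M (ce M h) = h \<and> white M (ce M h) \<noteq> white M h" if h: "h \<in> darts M" for h
  proof (cases "h \<in> {p, q}")
    case True
    then show ?thesis using P by auto
  next
    case False
    have e: "edge M (edge M h) = h" using W h by auto
    then have "edge M h \<notin> {p, q}" using P False by (metis insertE singletonD insertI1 insertI2)
    then show ?thesis using P(10)[OF False] P(10)[of "edge M h"] P(11)[OF h False] e W h by auto
  qed
  then show ?thesis unfolding closed_map_def using W by blast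
qed

lemma submap_simps [simp]:
  "darts (submap M A) = A" "rot (submap M A) = rot M" "white (submap M A) = white M"
  by (simp_all add: submap_def)

lemma contract_simps [simp]:
  "darts (contract M A) = darts M - A" "rot (contract M A) = rot M" "white (contract M A) = white M"
  by (simp_all add: contract_def)

lemma edge_submap: "edge (submap M A) h = (if edge M h \<in> A then edge M h else h)"
  by (simp add: submap_def)

lemma wf_rclosed: "wf_hmap M \<Longrightarrow> h \<in> darts M \<Longrightarrow> rot M h \<in> darts M"
  by (auto simp: wf_hmap_def bij_betw_def)

text \<open>Replacing a two-point submap by an edge amounts to switching the two edges at its free
  half-edges in the closure.\<close>

locale subpair =
  fixes M :: "'a hmap" and A p q
  assumes tp: "two_point_map M" and AD: "A \<subseteq> darts M" and tpA: "two_point_map (submap M A)"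
    and free: "free_darts (submap M A) = {p, q}" and wp: "white M p" and wq: "\<not> white M q"
begin

abbreviation "D \<equiv> darts M"
abbreviation "r \<equiv> rot M"
abbreviation "e \<equiv> ce M"

lemmas cm = two_point_closed_map[OF tp]
lemmas cD = closed_mapD[OF cm]

lemma wf: "wf_hmap M" using tp by (simp add: two_point_map_def)

lemma pA: "p \<in> A" "q \<in> A"
  using free by (auto simp: free_darts_def)

lemma Ar: "h \<in> A \<Longrightarrow> r h \<in> A"
  using tpA wf_rclosed[of "submap M A" h] by (simp add: two_point_map_def)

lemma A_inner: "h \<in> A \<Longrightarrow> h \<notin> {p, q} \<Longrightarrow> edge M h \<in> A \<and> edge M h \<noteq> h"
proof -
  assume h: "h \<in> A" "h \<notin> {p, q}"
  then have "edge (submap M A) h \<noteq> h" using free by (auto simp: free_darts_def)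
  then show ?thesis by (auto simp: edge_submap split: if_splits)
qed

lemma A_inner_ce: "h \<in> A \<Longrightarrow> h \<notin> {p, q} \<Longrightarrow> e h = edge M h"
proof -
  assume h: "h \<in> A" "h \<notin> {p, q}"
  obtain P Q where "free_darts M = {P, Q}" "\<And>h. h \<notin> {P, Q} \<Longrightarrow> ce M h = edge M h"
    using two_pointE[OF tp] by metis
  then show ?thesis using A_inner[OF h] h AD by (auto simp: free_darts_def)
qed

lemma p_out: "edge M p = p \<or> edge M p \<notin> A" "edge M q = q \<or> edge M q \<notin> A"
proof -
  have "edge (submap M A) p = p" "edge (submap M A) q = q" using free by (auto simp: free_darts_def)
  then show "edge M p = p \<or> edge M p \<notin> A" "edge M q = q \<or> edge M q \<notin> A"
    by (auto simp: edge_submap split: if_splits)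
qed

lemma free_in_A: "h \<in> A \<Longrightarrow> edge M h = h \<Longrightarrow> h \<in> {p, q}"
  using A_inner by auto

lemma edge_contract: "edge (contract M A) h = (if edge M h \<in> A
     then let z = other_free (submap M A) (edge M h) in if edge M z = z then h else edge M z
     else edge M h)"
  by (simp add: contract_def)

lemma both_free:
  assumes "e p = q"
  shows "free_darts M = {p, q}" "h \<in> A \<Longrightarrow> e h \<in> A" "free_darts (contract M A) = {}"
proof -
  obtain P Q where f: "free_darts M = {P, Q}" "white M P" "\<not> white M Q" "edge M P = P" "edge M Q = Q"
    "ce M P = Q" "ce M Q = P" "\<And>h. h \<notin> {P, Q} \<Longrightarrow> ce M h = edge M h"
    using two_pointE[OF tp] by metis
  have "p \<in> {P, Q}"
  proof (rule ccontr)
    assume n: "p \<notin> {P, Q}"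
    then have "edge M p = q" using f(8) assms by metis
    then show False using p_out pA wp wq by metis
  qed
  then have pq: "p = P" "q = Q" using f assms wp by auto
  then show F: "free_darts M = {p, q}" using f by simp
  show "e h \<in> A" if h: "h \<in> A" for h
  proof (cases "h \<in> {p, q}")
    case True then show ?thesis using f pq pA by auto
  next
    case False then show ?thesis using A_inner_ce[OF h] A_inner[OF h] by simp
  qed
  show "free_darts (contract M A) = {}"
  proof (rule equals0I)
    fix h assume "h \<in> free_darts (contract M A)"
    then have h: "h \<in> D - A" "edge (contract M A) h = h" by (auto simp: free_darts_def)
    have ee: "edge M (edge M h) = h" using wf_hmapD(7)[OF wf] h by auto
    show False
    proof (cases "edge M h \<in> A")
      case True
      then show False using A_inner[OF True] ee h f(4,5) pq by (metis DiffE insertE singletonD)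
    next
      case False
      then have "edge M h = h" using h by (simp add: edge_contract)
      then have "h \<in> free_darts M" using h by (simp add: free_darts_def)
      then show False using F h pA by auto
    qed
  qed
qed

end

locale contraction = subpair M A p q for M :: "'a hmap" and A p q +
  assumes nt: "ce M p \<noteq> q"
begin

abbreviation "e' \<equiv> sw e p q"

sublocale s: switch D r e "white M" p q
  by unfold_locales (use cm pA AD wp wq nt in auto)

lemma xy_out: "e p \<notin> A" "e q \<notin> A"
proof -
  obtain P Q where f: "free_darts M = {P, Q}" "white M P" "\<not> white M Q" "edge M P = P" "edge M Q = Q"
    "ce M P = Q" "ce M Q = P" "\<And>h. h \<notin> {P, Q} \<Longrightarrow> ce M h = edge M h"
    using two_pointE[OF tp] by metis
  show "e p \<notin> A"
  proof (cases "p \<in> {P, Q}")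
    case True
    then have "p = P" using f wp by auto
    then show ?thesis using f nt free_in_A[of Q] wp wq by auto
  next
    case False
    then have "edge M p \<noteq> p" using f(1) pA AD by (auto simp: free_darts_def)
    then show ?thesis using p_out f False by auto
  qed
  show "e q \<notin> A"
  proof (cases "q \<in> {P, Q}")
    case True
    then have "q = Q" using f wq by auto
    then show ?thesis using f nt free_in_A[of P] wp wq by auto
  next
    case False
    then have "edge M q \<noteq> q" using f(1) pA AD by (auto simp: free_darts_def)
    then show ?thesis using p_out f False by auto
  qed
qed

lemma Ae': "h \<in> A \<Longrightarrow> e' h \<in> A"
proof -
  assume h: "h \<in> A"
  show ?thesis
  proof (cases "h \<in> {p, q}")
    case True then show ?thesis using s.sw_simps pA by auto
  next
    case False
    then have "h \<noteq> e p" "h \<noteq> e q" using xy_out h by auto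
    then show ?thesis using s.sw_other False A_inner_ce[OF h False] A_inner[OF h False] by auto
  qed
qed

lemma outside: "h \<in> D - A \<Longrightarrow> h \<noteq> e p \<Longrightarrow> h \<noteq> e q \<Longrightarrow> edge M h \<notin> A"
proof
  assume h: "h \<in> D - A" "h \<noteq> e p" "h \<noteq> e q" and a: "edge M h \<in> A"
  have ee: "edge M (edge M h) = h" using wf_hmapD[OF wf] h by auto
  then have "edge M h \<in> {p, q}" using A_inner[OF a] h by auto
  moreover obtain P Q where f: "free_darts M = {P, Q}" "\<And>h. h \<notin> {P, Q} \<Longrightarrow> ce M h = edge M h"
    "edge M P = P" "edge M Q = Q"
    using two_pointE[OF tp] by metis
  moreover have "edge M h \<notin> {P, Q}" using f ee a h by auto
  ultimately show False using ee h by auto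
qed

lemma of_sub: "other_free (submap M A) p = q" "other_free (submap M A) q = p"
  unfolding other_free_def free using wp wq by (auto intro!: the_equality)

lemma contract_edge_other: "h \<in> D - A \<Longrightarrow> h \<noteq> e p \<Longrightarrow> h \<noteq> e q \<Longrightarrow> edge (contract M A) h = edge M h"
  using outside by (simp add: edge_contract)

text \<open>Three cases: the root edge is attached to neither end of \<open>A\<close>, or to exactly
  one of them; \<open>nt\<close> excludes both. In the last two cases the half-edge glued to the
  other end of \<open>A\<close> becomes free in place of the root half-edge that is removed.\<close>

lemma two_point_contract:
  "two_point_map (contract M A)" "\<And>h. h \<in> D - A \<Longrightarrow> ce (contract M A) h = e' h"
  "free_darts (contract M A) = (free_darts M - A) \<union> (if edge M p = p then {e q} else {})
     \<union> (if edge M q = q then {e p} else {})"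
proof -
  obtain P Q where f: "free_darts M = {P, Q}" "white M P" "\<not> white M Q" "P \<in> D" "Q \<in> D"
    "edge M P = P" "edge M Q = Q" "ce M P = Q" "ce M Q = P"
    "\<And>h. h \<notin> {P, Q} \<Longrightarrow> ce M h = edge M h" "\<And>h. h \<in> D \<Longrightarrow> h \<notin> {P, Q} \<Longrightarrow> edge M h \<noteq> h"
    using two_pointE[OF tp] by metis
  note W = wf_hmapD[OF wf]
  let ?N = "contract M A"
  have pqD: "p \<in> D" "q \<in> D" using pA AD by auto
  have xyD: "e p \<in> D - A" "e q \<in> D - A" using xy_out s.xyD by auto
  have xyw: "\<not> white M (e p)" "white M (e q)" using cD(8) pqD wp wq by auto
  have fp: "edge M p = p \<longleftrightarrow> p = P" using f wp pqD by auto
  have fq: "edge M q = q \<longleftrightarrow> q = Q" using f wq pqD by auto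
  have ep: "e p = edge M p" if "p \<noteq> P"
  proof -
    have "p \<notin> {P, Q}" using f(3) that wp by auto
    then show ?thesis by (rule f(10))
  qed
  have eq: "e q = edge M q" if "q \<noteq> Q"
  proof -
    have "q \<notin> {P, Q}" using f(2) that wq by auto
    then show ?thesis by (rule f(10))
  qed
  have PA: "P \<in> A \<longleftrightarrow> p = P" using free_in_A[of P] f pA wq by auto
  have QA: "Q \<in> A \<longleftrightarrow> q = Q" using free_in_A[of Q] f pA wp by auto
  have both: "\<not> (p = P \<and> q = Q)" using f nt by auto
  have Nx: "edge ?N (e p) = (if q = Q then e p else e q)" if "p \<noteq> P"
  proof -
    have "edge M (e p) = p" using ep[OF that] W pqD by auto
    then show ?thesis using of_sub pA fq eq by (simp add: edge_contract)
  qed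
  have Ny: "edge ?N (e q) = (if p = P then e q else e p)" if "q \<noteq> Q"
  proof -
    have "edge M (e q) = q" using eq[OF that] W pqD by auto
    then show ?thesis using of_sub pA fp ep by (simp add: edge_contract)
  qed
  have Nother: "edge ?N h = edge M h" if "h \<in> D - A" "h \<noteq> e p" "h \<noteq> e q" for h
    using contract_edge_other that by auto
  have xP: "e p = Q \<longleftrightarrow> p = P" using f cD(7) pqD by metis
  have yQ: "e q = P \<longleftrightarrow> q = Q" using f cD(7) pqD by metis
  have xne: "e p \<noteq> P" "e q \<noteq> Q" using xyw f by auto
  have other: "edge M h \<in> D - A" "edge M h \<noteq> e p" "edge M h \<noteq> e q" "edge M (edge M h) = h"
    if h: "h \<in> D - A" "h \<noteq> e p" "h \<noteq> e q" "h \<notin> {P, Q}" for h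
  proof -
    have e: "e h = edge M h" using f h by auto
    show "edge M h \<in> D - A" using outside h W by auto
    show "edge M (edge M h) = h" using W h by auto
    show "edge M h \<noteq> e p" "edge M h \<noteq> e q" using cD(7) e h pqD pA by (metis DiffE)+
  qed
  consider (n) "p \<noteq> P" "q \<noteq> Q" | (p) "p = P" "q \<noteq> Q" | (q) "p \<noteq> P" "q = Q" using both by auto
  then have main: "free_darts ?N = (free_darts M - A) \<union> (if edge M p = p then {e q} else {})
     \<union> (if edge M q = q then {e p} else {})
     \<and> (\<exists>p0 q0. free_darts ?N = {p0, q0} \<and> white M p0 \<and> \<not> white M q0 \<and> e' p0 = q0 \<and> e' q0 = p0)
     \<and> (\<forall>h\<in>D - A. edge ?N h \<noteq> h \<longrightarrow> edge ?N h = e' h)"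
  proof cases
    case n
    have x: "edge ?N (e p) = e q" "edge ?N (e q) = e p" using Nx Ny n by auto
    have PQ: "P \<in> D - A" "Q \<in> D - A" "P \<noteq> e p" "P \<noteq> e q" "Q \<noteq> e p" "Q \<noteq> e q"
      using f(4,5) PA QA n xP yQ xne by auto
    have fr: "free_darts ?N = {P, Q}"
    proof (intro set_eqI iffI)
      fix h assume "h \<in> free_darts ?N"
      then have h: "h \<in> D - A" "edge ?N h = h" by (auto simp: free_darts_def)
      then have "h \<noteq> e p" "h \<noteq> e q" using x s.ne by auto
      then have "edge M h = h" using Nother[OF h(1)] h(2) by simp
      then show "h \<in> {P, Q}" using f(11)[of h] h(1) by blast
    next
      fix h assume "h \<in> {P, Q}"
      then show "h \<in> free_darts ?N" using Nother[OF PQ(1,3,4)] Nother[OF PQ(2,5,6)] f(6,7) PQ(1,2)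
        by (auto simp: free_darts_def)
    qed
    have "P \<noteq> p" "P \<noteq> q" "Q \<noteq> p" "Q \<noteq> q" using n f(2,3) wp wq by auto
    then have sw: "e' P = Q" "e' Q = P" using s.sw_other[of P] s.sw_other[of Q] PQ f(8,9) by auto
    have "edge ?N h = e' h" if h: "h \<in> D - A" "edge ?N h \<noteq> h" for h
    proof (cases "h = e p \<or> h = e q")
      case True then show ?thesis using x s.sw_simps by auto
    next
      case False
      then have "edge ?N h = edge M h" using Nother h by auto
      moreover have "h \<notin> {P, Q}" using h fr by (auto simp: free_darts_def)
      then have "e h = edge M h" by (rule f(10))
      moreover have "h \<noteq> p" "h \<noteq> q" using h pA by auto
      ultimately show ?thesis using s.sw_other[of h] False by simp
    qed
    moreover have "free_darts M - A = {P, Q}" using f(1) PQ(1,2) by auto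
    moreover have "edge M p \<noteq> p" "edge M q \<noteq> q" using fp fq n by auto
    moreover have "\<exists>p0 q0. free_darts ?N = {p0, q0} \<and> white M p0 \<and> \<not> white M q0 \<and> e' p0 = q0 \<and> e' q0 = p0"
      using fr sw f(2,3) by blast
    ultimately show ?thesis using fr by simp
  next
    case p
    have y: "edge ?N (e q) = e q" using Ny p by auto
    have xQ: "e p = Q" using xP p by simp
    have NQ: "edge ?N Q = Q"
    proof -
      have "edge M Q = Q" "Q \<notin> A" using f QA p by auto
      then show ?thesis by (simp add: edge_contract)
    qed
    have fr: "free_darts ?N = {e q, Q}"
    proof (intro set_eqI iffI)
      fix h assume "h \<in> free_darts ?N"
      then have h: "h \<in> D - A" "edge ?N h = h" by (auto simp: free_darts_def)
      show "h \<in> {e q, Q}"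
      proof (rule ccontr)
        assume n: "h \<notin> {e q, Q}"
        then have "edge M h = h" using Nother[OF h(1)] h xQ by auto
        then have "h = P" using f(11)[of h] h n by auto
        then show False using h PA p by auto
      qed
    next
      fix h assume "h \<in> {e q, Q}"
      then show "h \<in> free_darts ?N" using NQ y xyD xQ by (auto simp: free_darts_def)
    qed
    have "edge ?N h = e' h" if h: "h \<in> D - A" "edge ?N h \<noteq> h" for h
    proof -
      have h': "h \<noteq> e q" "h \<noteq> e p" using h y NQ xQ by auto
      then have "edge ?N h = edge M h" using Nother h by auto
      moreover have "h \<notin> {P, Q}" using h' h xQ p pA by auto
      then have "e h = edge M h" by (rule f(10))
      moreover have "h \<noteq> p" "h \<noteq> q" using h pA by auto
      ultimately show ?thesis using s.sw_other[of h] h' by simp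
    qed
    moreover have sw: "e' (e q) = Q" "e' Q = e q" using s.sw_simps xQ by auto
    moreover have "free_darts M - A = {Q}" using f PA QA p by auto
    moreover have "edge M p = p" "edge M q \<noteq> q" using fp fq p by auto
    moreover have "\<exists>p0 q0. free_darts ?N = {p0, q0} \<and> white M p0 \<and> \<not> white M q0 \<and> e' p0 = q0 \<and> e' q0 = p0"
      using fr sw f(2,3) xyw by blast
    ultimately show ?thesis using fr by (simp add: insert_commute)
  next
    case q
    have x: "edge ?N (e p) = e p" using Nx q by auto
    have yP: "e q = P" using yQ q by simp
    have NP: "edge ?N P = P"
    proof -
      have "edge M P = P" "P \<notin> A" using f PA q by auto
      then show ?thesis by (simp add: edge_contract)
    qed
    have fr: "free_darts ?N = {P, e p}"
    proof (intro set_eqI iffI)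
      fix h assume "h \<in> free_darts ?N"
      then have h: "h \<in> D - A" "edge ?N h = h" by (auto simp: free_darts_def)
      show "h \<in> {P, e p}"
      proof (rule ccontr)
        assume n: "h \<notin> {P, e p}"
        then have "edge M h = h" using Nother[OF h(1)] h yP by auto
        then have "h = Q" using f(11)[of h] h n by auto
        then show False using h QA q by auto
      qed
    next
      fix h assume "h \<in> {P, e p}"
      then show "h \<in> free_darts ?N" using NP x xyD yP by (auto simp: free_darts_def)
    qed
    have "edge ?N h = e' h" if h: "h \<in> D - A" "edge ?N h \<noteq> h" for h
    proof -
      have h': "h \<noteq> e q" "h \<noteq> e p" using h x NP yP by auto
      then have "edge ?N h = edge M h" using Nother h by auto
      moreover have "h \<notin> {P, Q}" using h' h yP q pA by auto
      then have "e h = edge M h" by (rule f(10))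
      moreover have "h \<noteq> p" "h \<noteq> q" using h pA by auto
      ultimately show ?thesis using s.sw_other[of h] h' by simp
    qed
    moreover have sw: "e' (e p) = P" "e' P = e p" using s.sw_simps yP by auto
    moreover have "free_darts M - A = {P}" using f PA QA q by auto
    moreover have "edge M q = q" "edge M p \<noteq> p" using fp fq q by auto
    moreover have "\<exists>p0 q0. free_darts ?N = {p0, q0} \<and> white M p0 \<and> \<not> white M q0 \<and> e' p0 = q0 \<and> e' q0 = p0"
      using fr sw f(2,3) xyw by blast
    ultimately show ?thesis using fr by (simp add: insert_commute)
  qed
  then show "free_darts ?N = (free_darts M - A) \<union> (if edge M p = p then {e q} else {})
     \<union> (if edge M q = q then {e p} else {})" by (rule conjunct1)
  obtain p0 q0 where N: "free_darts ?N = {p0, q0}" "white M p0" "\<not> white M q0"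
    "e' p0 = q0" "e' q0 = p0"
    using main[THEN conjunct2, THEN conjunct1] by (elim exE conjE) (rule that)
  have Ne: "edge ?N h = e' h" if "h \<in> D - A" "edge ?N h \<noteq> h" for h
    using main[THEN conjunct2, THEN conjunct2] that by simp
  have cmN: "closed_map (D - A) r e' (white M)" by (rule counts_Un(4)[OF s.closed_map_sw AD Ar Ae'])
  have bij: "bij_betw r (D - A) (D - A)"
  proof (rule bij_betwI'[rule_format])
    show "r x = r y \<longleftrightarrow> x = y" if "x \<in> D - A" "y \<in> D - A" for x y
      using that W(3) by (metis DiffD1)
    show "r x \<in> D - A" if "x \<in> D - A" for x using that closed_mapD(2)[OF cmN] by blast
    show "\<exists>x\<in>D - A. y = r x" if "y \<in> D - A" for y
      using that closed_mapD(2,3)[OF cmN] by (intro bexI[of _ "r (r (r y))"]) auto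
  qed
  have "wf_hmap ?N"
    unfolding wf_hmap_def
  proof (intro conjI ballI)
    fix h assume "h \<in> darts ?N"
    then have h: "h \<in> D - A" by simp
    show "card (orbit (rot ?N) h) = 4" using wf h by (simp add: wf_hmap_def)
    show "white ?N (rot ?N h) = white ?N h" using W h by simp
    show "edge ?N h \<in> darts ?N" using Ne[OF h] h closed_mapD(6)[OF cmN h] by (cases "edge ?N h = h") auto
    show "edge ?N (edge ?N h) = h"
    proof (cases "edge ?N h = h")
      case False
      have k: "e' h \<in> D - A" "e' (e' h) = h" using closed_mapD(6,7)[OF cmN h] by auto
      have "edge ?N (e' h) \<noteq> e' h"
      proof
        assume "edge ?N (e' h) = e' h"
        then have "e' h \<in> free_darts ?N" using k(1) by (simp add: free_darts_def)
        then have "e' h = p0 \<or> e' h = q0" unfolding N(1) by simp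
        then have "e' (e' h) = q0 \<or> e' (e' h) = p0" using N(4,5) by (elim disjE) simp_all
        then have "h \<in> {p0, q0}" unfolding k(2) by blast
        then have "h \<in> free_darts ?N" unfolding N(1) .
        then show False using False by (simp add: free_darts_def)
      qed
      then have "edge ?N (e' h) = e' (e' h)" by (rule Ne[OF k(1)])
      then show ?thesis unfolding Ne[OF h False] k(2) .
    qed simp
    show "edge ?N h \<noteq> h \<longrightarrow> white ?N (edge ?N h) \<noteq> white ?N h"
      using Ne[OF h] closed_mapD(8)[OF cmN h] by auto
  qed (use W(1) bij in auto)
  then show tpN: "two_point_map ?N" using N by (auto simp: two_point_map_def)
  show "ce ?N h = e' h" if h: "h \<in> D - A" for h
  proof (cases "h \<in> {p0, q0}")
    case True
    have "other_free ?N p0 = q0" "other_free ?N q0 = p0"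
      unfolding other_free_def N(1) using N(2,3) by (auto intro!: the_equality)
    moreover have "h \<in> free_darts ?N" using True unfolding N(1) .
    ultimately have "ce ?N h = (if h = p0 then q0 else p0)"
      using True by (auto simp: closure_map_def)
    then show ?thesis using True N(4,5) by (auto split: if_splits)
  next
    case False
    then have nf: "h \<notin> free_darts ?N" unfolding N(1) .
    then have "edge ?N h \<noteq> h" using h by (simp add: free_darts_def)
    then show ?thesis using Ne[OF h] nf by (simp add: closure_map_def)
  qed
qed

end

section \<open>Contracting melons\<close>

lemma orbit_vx:
  assumes "r (r (r (r h))) = h"
  shows "orbit r h = vx r h"
proof
  have "z \<in> vx r h" if "z \<in> orbit r h" for z
    using that by induction (auto simp: vx_def assms)
  then show "orbit r h \<subseteq> vx r h" by auto
  have "r h \<in> orbit r h" "r (r h) \<in> orbit r h" "r (r (r h)) \<in> orbit r h" "r (r (r (r h))) \<in> orbit r h"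
    by (intro orbit.intros)+
  then show "vx r h \<subseteq> orbit r h" using assms by (auto simp: vx_def)
qed

lemma melonic_two_point: "melonic M \<Longrightarrow> two_point_map M"
  by (induction rule: melonic.induct) (auto simp: elementary_melon_def)

lemma elementaryE:
  assumes "elementary_melon M"
  obtains a b where "white M a" "\<not> white M b" "free_darts M = {a, b}" "darts M = block (rot M) a b"
    "edge M (rot M a) = rot M (rot M (rot M b))" "edge M (rot M (rot M a)) = rot M (rot M b)"
    "edge M (rot M (rot M (rot M a))) = rot M b" "a \<in> darts M" "b \<in> darts M"
proof -
  obtain a b where ab: "darts M = orbit (rot M) a \<union> orbit (rot M) b" "white M a" "\<not> white M b"
    "free_darts M = {a, b}" "\<forall>i\<in>{1, 2, 3}. edge M ((rot M ^^ i) a) = (rot M ^^ (4 - i)) b"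
    and tp: "two_point_map M" using assms unfolding elementary_melon_def by blast
  have wf: "wf_hmap M" using tp by (simp add: two_point_map_def)
  have d: "a \<in> darts M" "b \<in> darts M" using ab(4) by (auto simp: free_darts_def)
  have "orbit (rot M) a = vx (rot M) a" "orbit (rot M) b = vx (rot M) b"
    using wf_hmapD(3)[OF wf] d by (auto intro!: orbit_vx)
  then show thesis
    using ab d by (intro that[of a b]) (auto simp: block_def funpow123)
qed

text \<open>Such a set witnesses that the two sides of the closing edge lie in different faces.\<close>

definition face_cert :: "'a hmap \<Rightarrow> 'a set \<Rightarrow> bool" where
  "face_cert M W \<longleftrightarrow> W \<subseteq> darts M \<and> (\<forall>h\<in>darts M. rot M (ce M h) \<in> W \<longleftrightarrow> h \<in> W) \<and>
     (\<forall>h\<in>free_darts M. h \<in> W \<longleftrightarrow> white M h)"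

lemma rot_ne:
  assumes "closed_map D r e w" "h \<in> D"
  shows "r h \<noteq> h" "r (r h) \<noteq> h" "r (r (r h)) \<noteq> h" "r (r h) \<noteq> r h" "r (r (r h)) \<noteq> r h"
    "r (r (r h)) \<noteq> r (r h)"
  using closed_mapD(2,3,4,10)[OF assms(1)] assms(2) by metis+

text \<open>The certificate is the face \<open>{a, rot M b}\<close> of the closed melon, bounded by
  the closing edge and the third edge.\<close>

lemma elementary_cert:
  assumes "elementary_melon M"
  shows "\<exists>W. face_cert M W"
proof -
  obtain a b where ab: "white M a" "\<not> white M b" "free_darts M = {a, b}" "darts M = block (rot M) a b"
    "edge M (rot M a) = rot M (rot M (rot M b))" "edge M (rot M (rot M a)) = rot M (rot M b)"
    "edge M (rot M (rot M (rot M a))) = rot M b" "a \<in> darts M" "b \<in> darts M"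
    using elementaryE[OF assms] by metis
  have tp: "two_point_map M" using assms by (simp add: elementary_melon_def)
  note cm = two_point_closed_map[OF tp]
  note c = closed_mapD[OF cm]
  obtain P Q where f: "free_darts M = {P, Q}" "white M P" "\<not> white M Q"
    "ce M P = Q" "ce M Q = P" "\<And>h. h \<notin> {P, Q} \<Longrightarrow> ce M h = edge M h"
    using two_pointE[OF tp] by metis
  have PQ: "P = a" "Q = b" using f(1-3) ab(1-3) by auto
  let ?r = "rot M"
  have n: "?r (?r (?r a)) \<noteq> a" "?r (?r (?r a)) \<noteq> b"
    using rot_ne[OF cm ab(8)] ab c(2,5) by metis+
  have e3: "ce M (?r (?r (?r a))) = ?r b" using f(6) PQ n ab(7) by auto
  then have eb: "ce M (?r b) = ?r (?r (?r a))" using c(2,7) ab by metis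
  have F: "?r (ce M a) = ?r b" "?r (ce M (?r b)) = a" using f PQ eb c(3) ab by auto
  have "?r (ce M h) \<in> {a, ?r b} \<longleftrightarrow> h \<in> {a, ?r b}" if "h \<in> darts M" for h
  proof -
    have "?r b \<in> darts M" using c(2) ab by simp
    then have "?r (ce M h) = ?r b \<Longrightarrow> h = a" "?r (ce M h) = a \<Longrightarrow> h = ?r b"
      using F inj_onD[OF closed_map_inj(3)[OF cm]] that ab(8) by metis+
    then show ?thesis using F by blast
  qed
  moreover have "b \<noteq> a" "b \<noteq> ?r b" using ab c(10) by metis+
  ultimately have "face_cert M {a, ?r b}" using ab c(2) by (auto simp: face_cert_def)
  then show ?thesis by blast
qed

text \<open>The two faces along the edge from \<open>x\<close> to \<open>y\<close> that is restored
  by the contraction now run through the melon: one passes from \<open>x\<close> over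
  \<open>r a\<close> and \<open>b\<close> to \<open>r y\<close>, the other from \<open>y\<close>
  over \<open>r b\<close> and \<open>a\<close> to \<open>r x\<close>. The four new half-edges
  therefore inherit membership from \<open>x\<close> and \<open>y\<close>, while the two bigons
  inside the melon stay out.\<close>

lemma insert_cert:
  assumes tp: "two_point_map M" and BD: "B \<subseteq> darts M" and el: "elementary_melon (submap M B)"
    and tpN: "two_point_map (contract M B)" and W0: "face_cert (contract M B) W0"
  shows "\<exists>W. face_cert M W"
proof -
  obtain a b where ab: "white M a" "\<not> white M b" "free_darts (submap M B) = {a, b}" "B = block (rot M) a b"
    and es: "edge (submap M B) (rot M a) = rot M (rot M (rot M b))"
      "edge (submap M B) (rot M (rot M a)) = rot M (rot M b)"
    "edge (submap M B) (rot M (rot M (rot M a))) = rot M b" and abB: "a \<in> B" "b \<in> B"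
    using elementaryE[OF el] by (metis submap_simps)
  have tpB: "two_point_map (submap M B)" using el by (simp add: elementary_melon_def)
  interpret sp: subpair M B a b by unfold_locales (use tp BD tpB ab in auto)
  have "ce M a \<noteq> b"
  proof
    assume "ce M a = b"
    then have "free_darts (contract M B) = {}" by (rule sp.both_free(3))
    then show False using tpN by (auto simp: two_point_map_def)
  qed
  then interpret k: contraction M B a b by unfold_locales
  let ?r = "rot M" and ?e = "ce M"
  define x y where "x = ?e a" and "y = ?e b"
  note c = sp.cD
  have abD: "a \<in> darts M" "b \<in> darts M" using abB BD by auto
  have na: "?r a \<noteq> a" "?r (?r a) \<noteq> a" "?r (?r (?r a)) \<noteq> a" "?r (?r a) \<noteq> ?r a" "?r (?r (?r a)) \<noteq> ?r a"
    "?r (?r (?r a)) \<noteq> ?r (?r a)" by (rule rot_ne[OF sp.cm abD(1)])+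
  have nb: "?r b \<noteq> b" "?r (?r b) \<noteq> b" "?r (?r (?r b)) \<noteq> b" "?r (?r b) \<noteq> ?r b" "?r (?r (?r b)) \<noteq> ?r b"
    "?r (?r (?r b)) \<noteq> ?r (?r b)" by (rule rot_ne[OF sp.cm abD(2)])+
  have rD: "?r a \<in> darts M" "?r (?r a) \<in> darts M" "?r (?r (?r a)) \<in> darts M"
    "?r b \<in> darts M" "?r (?r b) \<in> darts M" "?r (?r (?r b)) \<in> darts M" using c(2) abD by auto
  have wr: "white M (?r a)" "white M (?r (?r a))" "white M (?r (?r (?r a)))"
    "\<not> white M (?r b)" "\<not> white M (?r (?r b))" "\<not> white M (?r (?r (?r b)))" using c(5) abD rD ab by auto
  have nab: "u \<noteq> v" if "white M u" "\<not> white M v" for u v using that by auto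
  have inner: "?e h = edge (submap M B) h" if "h \<in> B" "h \<noteq> a" "h \<noteq> b" for h
    using sp.A_inner[of h] sp.A_inner_ce[of h] that by (simp add: edge_submap)
  have rB: "?r a \<in> B" "?r (?r a) \<in> B" "?r (?r (?r a)) \<in> B" "?r b \<in> B" "?r (?r b) \<in> B" "?r (?r (?r b)) \<in> B"
    using ab(4) by (auto simp: block_def vx_def)
  have e1: "?e (?r a) = ?r (?r (?r b))" using inner[OF rB(1)] na es nab[OF wr(1) ab(2)] by simp
  have e2: "?e (?r (?r a)) = ?r (?r b)" using inner[OF rB(2)] na es nab[OF wr(2) ab(2)] by simp
  have e3: "?e (?r (?r (?r a))) = ?r b" using inner[OF rB(3)] na es nab[OF wr(3) ab(2)] by simp
  have e4: "?e (?r (?r (?r b))) = ?r a" "?e (?r (?r b)) = ?r (?r a)" "?e (?r b) = ?r (?r (?r a))"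
    using e1 e2 e3 c(7) rD by metis+
  have xyD: "x \<in> darts M - B" "y \<in> darts M - B" using k.s.xyD k.xy_out by (auto simp: x_def y_def)
  have exy: "?e x = a" "?e y = b" using c(7) abD by (auto simp: x_def y_def)
  have xw: "\<not> white M x" "white M y" using c(8) abD ab by (auto simp: x_def y_def)
  define Wb where "Wb h \<longleftrightarrow> (h \<in> {?r a, b} \<and> x \<in> W0) \<or> (h \<in> {?r b, a} \<and> y \<in> W0)" for h
  define W where "W = W0 \<union> {h. Wb h}"
  have W0D: "W0 \<subseteq> darts M - B" using W0 by (simp add: face_cert_def)
  have f0: "?r (k.e' h) \<in> W0 \<longleftrightarrow> h \<in> W0" if "h \<in> darts M - B" for h
  proof -
    have "\<forall>h\<in>darts M - B. ?r (ce (contract M B) h) \<in> W0 \<longleftrightarrow> h \<in> W0"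
      using W0 by (simp add: face_cert_def)
    from bspec[OF this that] show ?thesis unfolding k.two_point_contract(2)[OF that] .
  qed
  have out: "h \<in> W \<longleftrightarrow> h \<in> W0" if "h \<notin> B" for h using that rB abB by (auto simp: W_def Wb_def)
  have ins: "h \<in> W \<longleftrightarrow> Wb h" if "h \<in> B" for h using that W0D by (auto simp: W_def)
  have rout: "?r h \<notin> B" if "h \<in> darts M - B" for h
    using rclosed_iff[OF sp.cm sp.Ar, of h] that by auto
  have sw: "k.e' x = y" "k.e' y = x" using k.s.sw_simps by (auto simp: x_def y_def)
  have Wb: "Wb a \<longleftrightarrow> y \<in> W0" "Wb (?r b) \<longleftrightarrow> y \<in> W0" "Wb b \<longleftrightarrow> x \<in> W0" "Wb (?r a) \<longleftrightarrow> x \<in> W0"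
    "\<not> Wb (?r (?r a))" "\<not> Wb (?r (?r (?r a)))" "\<not> Wb (?r (?r b))" "\<not> Wb (?r (?r (?r b)))"
  proof -
    note d = nab[OF ab(1) ab(2)] nab[OF ab(1) wr(4)] nab[OF wr(1) ab(2)] nab[OF wr(1) wr(4)]
      nab[OF wr(2) ab(2)] nab[OF wr(2) wr(4)] nab[OF wr(3) ab(2)] nab[OF wr(3) wr(4)]
      nab[OF wr(1) wr(5)] nab[OF wr(1) wr(6)] nab[OF ab(1) wr(5)] nab[OF ab(1) wr(6)]
    show "Wb a \<longleftrightarrow> y \<in> W0" "Wb (?r b) \<longleftrightarrow> y \<in> W0" "Wb b \<longleftrightarrow> x \<in> W0" "Wb (?r a) \<longleftrightarrow> x \<in> W0"
      "\<not> Wb (?r (?r a))" "\<not> Wb (?r (?r (?r a)))" "\<not> Wb (?r (?r b))" "\<not> Wb (?r (?r (?r b)))"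
      using d d[symmetric] na nb na[symmetric] nb[symmetric] by (simp_all add: Wb_def)
  qed
  have clos: "?r (?e h) \<in> W \<longleftrightarrow> h \<in> W" if h: "h \<in> darts M" for h
  proof (cases "h \<in> B")
    case True
    then consider "h = a" | "h = ?r a" | "h = ?r (?r a)" | "h = ?r (?r (?r a))"
      | "h = b" | "h = ?r b" | "h = ?r (?r b)" | "h = ?r (?r (?r b))"
      unfolding ab(4) block_def vx_def by blast
    then show ?thesis
    proof cases
      case 1
      have "?r x \<in> W \<longleftrightarrow> y \<in> W0" using out[OF rout[OF xyD(1)]] f0[OF xyD(2)] sw by simp
      then show ?thesis using 1 ins[OF True] Wb by (simp add: x_def)
    next
      case 2
      have "?r (?r (?r (?r b))) = b" using c(3) abD by simp
      then show ?thesis using 2 ins[OF True] ins[OF abB(2)] Wb e1 by simp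
    next
      case 3
      then show ?thesis using ins[OF True] ins[OF rB(6)] Wb e2 by simp
    next
      case 4
      then show ?thesis using ins[OF True] ins[OF rB(5)] Wb e3 by simp
    next
      case 5
      have "?r y \<in> W \<longleftrightarrow> x \<in> W0" using out[OF rout[OF xyD(2)]] f0[OF xyD(1)] sw by simp
      then show ?thesis using 5 ins[OF True] Wb by (simp add: y_def)
    next
      case 6
      have "?r (?r (?r (?r a))) = a" using c(3) abD by simp
      then show ?thesis using 6 ins[OF True] ins[OF abB(1)] Wb e4 by simp
    next
      case 7
      then show ?thesis using ins[OF True] ins[OF rB(3)] Wb e4 by simp
    next
      case 8
      then show ?thesis using ins[OF True] ins[OF rB(2)] Wb e4 by simp
    qed
  next
    case False
    then have hB: "h \<in> darts M - B" using h by simp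
    consider "h = x" | "h = y" | "h \<noteq> x" "h \<noteq> y" by blast
    then show ?thesis
    proof cases
      case 1
      then show ?thesis using exy ins[OF rB(1)] Wb out[OF False] by simp
    next
      case 2
      then show ?thesis using exy ins[OF rB(4)] Wb out[OF False] by simp
    next
      case 3
      have "k.e' h = ?e h" using 3 k.s.sw_other[of h] hB abB by (auto simp: x_def y_def)
      moreover have "?e h \<in> darts M - B"
      proof -
        have "k.e' h \<in> darts M - B"
          using closed_mapD(6)[OF counts_Un(4)[OF k.s.closed_map_sw BD sp.Ar k.Ae'] hB] .
        then show ?thesis using \<open>k.e' h = ?e h\<close> by simp
      qed
      ultimately show ?thesis using out[OF False] out[OF rout] f0[OF hB] by simp
    qed
  qed
  have fr: "h \<in> W \<longleftrightarrow> white M h" if h: "h \<in> free_darts M" for h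
  proof (cases "h \<in> B")
    case True
    then have "h \<in> {a, b}" using sp.free_in_A[of h] h by (auto simp: free_darts_def)
    then show ?thesis
    proof (elim insertE emptyE)
      assume ha: "h = a"
      then have "y \<in> free_darts (contract M B)"
        using h k.two_point_contract(3) by (simp add: free_darts_def y_def)
      then have "y \<in> W0" using W0 xw by (auto simp: face_cert_def)
      then show ?thesis using ha ins[OF abB(1)] Wb ab by simp
    next
      assume hb: "h = b"
      then have "x \<in> free_darts (contract M B)"
        using h k.two_point_contract(3) by (simp add: free_darts_def x_def)
      then have "x \<notin> W0" using W0 xw by (auto simp: face_cert_def)
      then show ?thesis using hb ins[OF abB(2)] Wb ab by simp
    qed
  next
    case False
    then have "h \<in> free_darts (contract M B)" using h k.two_point_contract(3) by simp
    then show ?thesis using W0 out[OF False] by (auto simp: face_cert_def)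
  qed
  have "W \<subseteq> darts M" using W0D BD rB abB by (auto simp: W_def Wb_def)
  then have "face_cert M W" using clos fr by (auto simp: face_cert_def)
  then show ?thesis by blast
qed

lemma melonic_cert: "melonic M \<Longrightarrow> \<exists>W. face_cert M W"
proof (induction rule: melonic.induct)
  case (elementary M) then show ?case by (rule elementary_cert)
next
  case (insert M A)
  then show ?case using insert_cert[OF insert(1,2,3) melonic_two_point[OF insert(4)]] by blast
qed

text \<open>The invariant of melon removal, in units of \<open>excess\<close>, that is with
  \<open>k\<close> four times 2g + l.\<close>

definition rooted_bound :: "'a hmap \<Rightarrow> int \<Rightarrow> bool" where
  "rooted_bound M k \<longleftrightarrow> two_point_map M \<and> ncomps (darts M) (rot M) (ce M) = 1
     \<and> excess (darts M) (rot M) (ce M) \<le> k"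

lemma ncomps_one_iff:
  assumes "ncomps D r e = 1" "u \<in> D" "v \<in> D"
  shows "(u, v) \<in> conn (mrel D r e)"
proof -
  obtain C where "cls (mrel D r e) ` D = {C}" using assms(1) by (auto simp: ncomps_def ncl_def card_1_singleton_iff)
  then show ?thesis using assms(2,3) by (simp add: cls_eq_iff[symmetric]) (metis imageI singletonD)
qed

lemma ncomps_oneI:
  assumes "x \<in> D" "\<And>u. u \<in> D \<Longrightarrow> (u, x) \<in> conn (mrel D r e)"
  shows "ncomps D r e = 1"
proof -
  have "cls (mrel D r e) u = cls (mrel D r e) x" if "u \<in> D" for u
    unfolding cls_eq_iff using assms(2)[OF that] .
  then have "cls (mrel D r e) ` D = {cls (mrel D r e) x}" using assms(1) by blast
  then show ?thesis by (simp add: ncomps_def ncl_def)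
qed

text \<open>The switch cuts \<open>A\<close> off and gains two faces and two straight orbits, which
  pays for the new component: 24 = 8 * 2 + 4 * 2. The part \<open>A\<close> takes a non-negative
  excess with it. If the closure joins \<open>p\<close> to \<open>q\<close>, then \<open>A\<close>
  is invariant and, by connectedness, everything.\<close>

lemma contract_bound:
  assumes M: "rooted_bound M k" and A: "melonic_submap M A"
  shows "darts (contract M A) = {} \<or> rooted_bound (contract M A) k"
proof -
  have tp: "two_point_map M" and one: "ncomps (darts M) (rot M) (ce M) = 1"
    and q: "excess (darts M) (rot M) (ce M) \<le> k" using M by (auto simp: rooted_bound_def)
  have AD: "A \<subseteq> darts M" and mel: "melonic (submap M A)" using A by (auto simp: melonic_submap_def)
  have tpA: "two_point_map (submap M A)" by (rule melonic_two_point[OF mel])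
  obtain p q where pq: "free_darts (submap M A) = {p, q}" "white M p" "\<not> white M q"
    using tpA by (auto simp: two_point_map_def)
  interpret sp: subpair M A p q by unfold_locales (use tp AD tpA pq in auto)
  show ?thesis
  proof (cases "ce M p = q")
    case True
    have "v \<in> A" if "v \<in> darts M" for v
    proof -
      have "(p, v) \<in> conn (mrel (darts M) (rot M) (ce M))"
        by (rule ncomps_one_iff[OF one]) (use sp.pA AD that in auto)
      then have "p \<in> A \<longleftrightarrow> v \<in> A"
        by (rule conn_closed) (rule mrel_closed[OF sp.cm sp.Ar sp.both_free(2)[OF True]])
      then show ?thesis using sp.pA by simp
    qed
    then show ?thesis by auto
  next
    case False
    then interpret k: contraction M A p q by unfold_locales
    let ?D = "darts M" and ?r = "rot M"
    let ?N = "contract M A"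
    let ?R = "mrel ?D ?r k.e'"
    note cm' = k.s.closed_map_sw
    have clA: "u \<in> A \<longleftrightarrow> v \<in> A" if "(u, v) \<in> ?R" for u v
      by (rule mrel_closed[OF cm' sp.Ar k.Ae' that])
    have sep: "(u, v) \<notin> conn ?R" if "u \<in> A" "v \<notin> A" for u v
      using conn_closed[OF _ clA, of u v] that by blast
    obtain W where W: "face_cert (submap M A) W" using melonic_cert[OF mel] by blast
    have ceA: "ce (submap M A) h = k.e' h" if h: "h \<in> A" for h
    proof (cases "h \<in> {p, q}")
      case True
      have "other_free (submap M A) p = q" "other_free (submap M A) q = p" by (rule k.of_sub)+
      then show ?thesis using True k.s.sw_simps pq(1) by (auto simp: closure_map_def)
    next
      case F: False
      then have "ce (submap M A) h = edge M h"
        using sp.A_inner[OF h] pq(1) by (auto simp: closure_map_def edge_submap)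
      moreover have "h \<noteq> ce M p" "h \<noteq> ce M q" using k.xy_out h by auto
      ultimately show ?thesis using k.s.sw_other[of h] F sp.A_inner_ce[OF h F] by auto
    qed
    \<comment> \<open>The condition on faces in \<open>sep_counts\<close>. This is what the
      certificate is for: inside \<open>A\<close> the switched map is the closure of the
      melon.\<close>
    have "(q, p) \<notin> conn (gr (\<lambda>h. ?r (k.e' h)) ?D)"
    proof
      assume "(q, p) \<in> conn (gr (\<lambda>h. ?r (k.e' h)) ?D)"
      then have "q \<in> W \<longleftrightarrow> p \<in> W"
      proof (rule conn_closed)
        fix u v assume "(u, v) \<in> gr (\<lambda>h. ?r (k.e' h)) ?D"
        then have u: "u \<in> ?D" "v = ?r (k.e' u)" by (auto simp: gr_def)
        show "u \<in> W \<longleftrightarrow> v \<in> W"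
        proof (cases "u \<in> A")
          case True
          have "\<forall>h\<in>A. ?r (ce (submap M A) h) \<in> W \<longleftrightarrow> h \<in> W"
            using W by (simp add: face_cert_def)
          from bspec[OF this True] show ?thesis unfolding ceA[OF True] u(2) by simp
        next
          case False
          then have "v \<notin> A" using u face_closed[OF cm' AD sp.Ar k.Ae'] by blast
          then show ?thesis using False W by (auto simp: face_cert_def)
        qed
      qed
      then show False using W pq by (auto simp: face_cert_def)
    qed
    then have cnt: "nfaces ?D ?r (ce M) + 2 \<le> nfaces ?D ?r k.e'" "nstraight ?D ?r (ce M) + 2 \<le> nstraight ?D ?r k.e'"
      using k.s.sep_counts sep sp.pA k.xy_out by auto
    have "excess ?D ?r k.e' \<le> excess ?D ?r (ce M)" using cnt k.s.ncomps_sw unfolding excess_def by linarith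
    moreover have "excess ?D ?r k.e' = excess A ?r k.e' + excess (?D - A) ?r k.e'"
      by (rule excess_Un(1)[OF cm' AD sp.Ar k.Ae'])
    moreover have "0 \<le> excess A ?r k.e'" by (rule excess_nonneg[OF closed_map_sub[OF cm' AD sp.Ar k.Ae']])
    ultimately have q1: "excess (?D - A) ?r k.e' \<le> k" using q by linarith
    have Y: "?D - A \<subseteq> ?D" "\<And>h. h \<in> ?D - A \<Longrightarrow> ?r h \<in> ?D - A" "\<And>h. h \<in> ?D - A \<Longrightarrow> k.e' h \<in> ?D - A"
      using closed_mapD(2,6)[OF counts_Un(4)[OF cm' AD sp.Ar k.Ae']] by blast+
    have xD: "ce M p \<in> ?D - A" using k.xy_out k.s.xyD by auto
    \<comment> \<open>A path to \<open>ce M p\<close> in the old map uses the new relation and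
      possibly the link from \<open>p\<close>. As \<open>p\<close> cannot be reached from outside
      \<open>A\<close>, the link is never taken.\<close>
    have c1: "ncomps (?D - A) ?r k.e' = 1"
    proof (rule ncomps_oneI[OF xD])
      fix u assume u: "u \<in> ?D - A"
      have "(u, ce M p) \<in> conn (mrel ?D ?r (ce M))" by (rule ncomps_one_iff[OF one]) (use u xD in auto)
      moreover have "mrel ?D ?r (ce M) \<subseteq> conn (insert (p, ce M p) ?R)"
        using k.s.rel_sub[of "gr ?r ?D"] by (simp add: mrel_def Un_commute)
      ultimately have "(u, ce M p) \<in> conn (insert (p, ce M p) ?R)" using conn_mono by blast
      moreover have "(u, p) \<notin> conn ?R" using sep[of p u] u sp.pA conn_sym by fastforce
      ultimately have "(u, ce M p) \<in> conn ?R" using conn_insert by fast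
      then have "cls ?R u = cls ?R (ce M p)" by (simp add: cls_eq_iff)
      then show "(u, ce M p) \<in> conn (mrel (?D - A) ?r k.e')"
        using cls_mrel_sub[OF cm' Y u] cls_mrel_sub[OF cm' Y xD] by (simp add: cls_eq_iff[symmetric])
    qed
    have ce: "ce ?N h = k.e' h" if "h \<in> ?D - A" for h by (rule k.two_point_contract(2)[OF that])
    have "gr (ce ?N) (?D - A) = gr k.e' (?D - A)" using ce by (auto simp: gr_def)
    moreover have "gr (\<lambda>h. ?r (ce ?N h)) (?D - A) = gr (\<lambda>h. ?r (k.e' h)) (?D - A)"
      "gr (\<lambda>h. ?r (?r (ce ?N h))) (?D - A) = gr (\<lambda>h. ?r (?r (k.e' h))) (?D - A)"
      using ce by (auto simp: gr_def)
    ultimately have "ncomps (?D - A) ?r (ce ?N) = ncomps (?D - A) ?r k.e'"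
      "excess (?D - A) ?r (ce ?N) = excess (?D - A) ?r k.e'"
      by (simp_all add: excess_def ncomps_def nfaces_def nstraight_def mrel_def)
    then have "rooted_bound ?N k"
      using q1 c1 k.two_point_contract(1) by (simp add: rooted_bound_def)
    then show ?thesis ..
  qed
qed

lemma melon_steps_bound:
  assumes "melon_step\<^sup>*\<^sup>* M M'" "rooted_bound M k"
  shows "darts M' = {} \<or> rooted_bound M' k"
  using assms
proof (induction rule: rtranclp_induct)
  case (step N N')
  obtain A where A: "melonic_submap N A" "N' = contract N A" using step(2) by (auto simp: melon_step_def)
  show ?case
  proof (cases "darts N = {}")
    case True
    then show ?thesis using A by simp
  next
    case False
    then show ?thesis using step contract_bound A by blast
  qed
qed simp

section \<open>Genus and grade\<close>

lemma orbit_cls: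
  assumes "finite D" "inj_on f D" "\<And>h. h \<in> D \<Longrightarrow> f h \<in> D" "h \<in> D"
  shows "orbit f h = cls (gr f D) h"
proof
  show "orbit f h \<subseteq> cls (gr f D) h"
    using funpow_conn_gr[OF assms(3,4)] by (auto simp: orbit_altdef cls_def)
  show "cls (gr f D) h \<subseteq> orbit f h"
  proof
    fix z assume "z \<in> cls (gr f D) h"
    then obtain n where n: "z = (f ^^ n) h"
      using conn_gr_funpow[OF assms] by (auto simp: cls_def)
    obtain m where m: "m > 0" "(f ^^ m) h = h" using funpow_period[OF assms] by blast
    have "z = (f ^^ (n + m)) h" using n m(2) by (simp add: funpow_add)
    then show "z \<in> orbit f h" using m(1) unfolding orbit_altdef by blast
  qed
qed

lemma card_classes:
  assumes "finite D" "\<And>h. h \<in> D \<Longrightarrow> f h \<in> D" "\<And>h. h \<in> D \<Longrightarrow> card (cls (gr f D) h) = k"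
  shows "k * card (cls (gr f D) ` D) = card D"
proof -
  have cl: "u \<in> D \<longleftrightarrow> v \<in> D" if "(u, v) \<in> gr f D" for u v using that assms(2) by (auto simp: gr_def)
  have "(\<Sum>C\<in>cls (gr f D) ` D. card C) = card D"
    using sum_cls[OF assms(1), of "gr f D" "\<lambda>_. 1::nat"] cl by simp
  moreover have "(\<Sum>C\<in>cls (gr f D) ` D. card C) = (\<Sum>C\<in>cls (gr f D) ` D. k)"
    by (rule sum.cong) (use assms(3) in auto)
  ultimately show ?thesis by (simp add: mult.commute)
qed

text \<open>With V = |D|/4 and E = |D|/2, eliminating g from the grade gives 8g + 4l = 24 + 3|D| -
  8F - 8\<phi>. It remains to see that there are at least 2\<phi> straight orbits.\<close>

lemma rooted_map_bound:
  assumes "rooted_map M" "rooted_genus M = real g" "rooted_grade M = real l"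
  shows "rooted_bound M (4 * (2 * int g + int l))"
proof -
  have tp: "two_point_map M" using assms(1) by (simp add: rooted_map_def)
  have wf: "wf_hmap M" using tp by (simp add: two_point_map_def)
  let ?D = "darts M" and ?r = "rot M" and ?e = "ce M" and ?N = "closure_map M"
  note cm = two_point_closed_map[OF tp]
  note c = closed_mapD[OF cm]
  obtain p where p: "p \<in> ?D" using two_pointE[OF tp] by metis
  have one: "ncomps ?D ?r ?e = 1"
  proof (rule ncomps_oneI[OF p])
    fix u assume "u \<in> ?D"
    then have "(u, p) \<in> {(x, y). x \<in> ?D \<and> (y = ?r x \<or> y = ?e x)}\<^sup>*"
      using assms(1) p by (simp add: rooted_map_def connected_map_def)
    moreover have "{(x, y). x \<in> ?D \<and> (y = ?r x \<or> y = ?e x)} \<subseteq> mrel ?D ?r ?e \<union> (mrel ?D ?r ?e)\<inverse>"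
      by (auto simp: mrel_def gr_def)
    ultimately show "(u, p) \<in> conn (mrel ?D ?r ?e)" unfolding conn_def using rtrancl_mono by blast
  qed
  have V: "4 * card (vertices ?N) = card ?D"
  proof -
    have o: "orbit ?r h = cls (gr ?r ?D) h" if "h \<in> ?D" for h
      by (rule orbit_cls) (use c closed_map_inj(1)[OF cm] that in auto)
    have "vertices ?N = cls (gr ?r ?D) ` ?D" unfolding vertices_def using o by auto
    moreover have "card (cls (gr ?r ?D) h) = 4" if "h \<in> ?D" for h
      unfolding o[OF that, symmetric] using wf that by (simp add: wf_hmap_def)
    ultimately show ?thesis using card_classes[OF c(1), of ?r 4] c(2) by simp
  qed
  have E: "2 * card (edges ?N) = card ?D"
  proof -
    have o: "{h, ?e h} = cls (gr ?e ?D) h" if h: "h \<in> ?D" for h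
    proof -
      have "orbit ?e h = cls (gr ?e ?D) h" by (rule orbit_cls) (use c closed_map_inj(2)[OF cm] h in auto)
      moreover have "z \<in> {h, ?e h}" if "z \<in> orbit ?e h" for z
        using that by induction (use c(7)[OF h] in auto)
      moreover have "?e h \<in> orbit ?e h" "?e (?e h) \<in> orbit ?e h" by (intro orbit.intros)+
      ultimately show ?thesis using c(7)[OF h] by auto
    qed
    have "edges ?N = cls (gr ?e ?D) ` ?D" unfolding edges_def using o by auto
    moreover have "card (cls (gr ?e ?D) h) = 2" if "h \<in> ?D" for h
      using o[OF that, symmetric] c(9)[OF that] by auto
    ultimately show ?thesis using card_classes[OF c(1), of ?e 2] c(6) by simp
  qed
  have F: "card (faces ?N) = nfaces ?D ?r ?e"
  proof -
    have "orbit (?r \<circ> ?e) h = cls (gr (\<lambda>h. ?r (?e h)) ?D) h" if "h \<in> ?D" for h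
      unfolding comp_def by (rule orbit_cls) (use c closed_map_inj(3)[OF cm] that in auto)
    then have "faces ?N = cls (gr (\<lambda>h. ?r (?e h)) ?D) ` ?D" unfolding faces_def by auto
    then show ?thesis by (simp add: nfaces_def ncl_def)
  qed
  have S: "2 * card (straight_cycles ?N) \<le> nstraight ?D ?r ?e"
  proof -
    let ?t = "\<lambda>h. ?r (?r (?e h))"
    let ?R = "gr ?t ?D"
    let ?g = "\<lambda>C. C \<union> ?e ` C"
    let ?A = "cls ?R ` ?D"
    have o: "orbit (?r \<circ> ?r \<circ> ?e) h = cls ?R h" if "h \<in> ?D" for h
      unfolding comp_def by (rule orbit_cls) (use c closed_map_inj(4)[OF cm] that in auto)
    have st: "straight_cycles ?N = ?g ` ?A" unfolding straight_cycles_def Let_def using o by auto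
    have cD: "cls ?R h \<subseteq> ?D" if "h \<in> ?D" for h
    proof -
      have "u \<in> ?D \<longleftrightarrow> v \<in> ?D" if "(u, v) \<in> ?R" for u v using that c(2,6) by (auto simp: gr_def)
      then show ?thesis using conn_closed[of h _ ?R ?D] that unfolding cls_def by blast
    qed
    have rv: "(?e u, ?e v) \<in> conn ?R" if "(u, v) \<in> conn ?R" "u \<in> ?D" for u v
      using that(1)
    proof (induction rule: conn_induct)
      case (step y z)
      then have y: "y \<in> ?D" "z = ?t y" by (auto simp: gr_def)
      have "(?e z, ?t (?e z)) \<in> ?R" unfolding gr_def using c(2,6) y by blast
      moreover have "?t (?e z) = ?e y" using c y by simp
      ultimately have X: "(?e z, ?e y) \<in> ?R" by simp
      show ?case by (rule conn_trans[OF step(3) conn_sym[OF conn_base[OF X]]])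
    next
      case (bwd y z)
      then have y: "z \<in> ?D" "y = ?t z" by (auto simp: gr_def)
      have "(?e y, ?t (?e y)) \<in> ?R" unfolding gr_def using c(2,6) y by blast
      moreover have "?t (?e y) = ?e z" using c y by simp
      ultimately have X: "(?e y, ?e z) \<in> ?R" by simp
      show ?case by (rule conn_trans[OF bwd(3) conn_base[OF X]])
    qed simp
    have im: "?e ` cls ?R h = cls ?R (?e h)" if h: "h \<in> ?D" for h
    proof
      show "?e ` cls ?R h \<subseteq> cls ?R (?e h)" using rv h by (auto simp: cls_def)
      show "cls ?R (?e h) \<subseteq> ?e ` cls ?R h"
      proof
        fix z assume z: "z \<in> cls ?R (?e h)"
        then have "?e z \<in> cls ?R h" using rv[of "?e h" z] c h by (auto simp: cls_def)
        moreover have "z \<in> ?D" using z cD[of "?e h"] c h by auto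
        ultimately show "z \<in> ?e ` cls ?R h" using c(7) by (metis imageI)
      qed
    qed
    \<comment> \<open>An undirected straight cycle arises from an orbit and from its image under
      \<open>?e\<close>, the same walk reversed; \<open>straight_reversal\<close> makes the two
      distinct.\<close>
    have fib: "2 \<le> card {C \<in> ?A. ?g C = Y}" if Y: "Y \<in> ?g ` ?A" for Y
    proof -
      obtain h where h: "h \<in> ?D" "Y = ?g (cls ?R h)" using Y by auto
      have g2: "?g (cls ?R (?e h)) = Y" using im[OF h(1)] im[of "?e h"] c h by auto
      have ne: "cls ?R h \<noteq> cls ?R (?e h)" using straight_reversal[OF cm h(1)] by (simp add: cls_eq_iff)
      have "{cls ?R h, cls ?R (?e h)} \<subseteq> {C \<in> ?A. ?g C = Y}" using h g2 c(6) by auto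
      then have "card {cls ?R h, cls ?R (?e h)} \<le> card {C \<in> ?A. ?g C = Y}"
        using c(1) by (intro card_mono) auto
      then show ?thesis using ne by simp
    qed
    have "card ?A = (\<Sum>Y\<in>?g ` ?A. card {C \<in> ?A. ?g C = Y})"
      using sum.image_gen[of ?A "\<lambda>_. 1::nat" ?g] c(1) by simp
    moreover have "(\<Sum>Y\<in>?g ` ?A. 2) \<le> (\<Sum>Y\<in>?g ` ?A. card {C \<in> ?A. ?g C = Y})"
      using fib by (rule sum_mono)
    ultimately show ?thesis unfolding st nstraight_def ncl_def by simp
  qed
  have r: "real (card ?D) = 4 * real (card (vertices ?N))" "real (card ?D) = 2 * real (card (edges ?N))"
    using V E by linarith+
  have rs: "2 * real (card (straight_cycles ?N)) \<le> real (nstraight ?D ?r ?e)" using S by linarith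
  have g: "2 - (real (card (faces ?N)) - real (card (edges ?N)) + real (card (vertices ?N))) = 2 * real g"
    using assms(2) by (simp add: rooted_genus_def map_genus_def)
  have l: "2 * (1 + real g + real (card (edges ?N)) - 3 * real (card (vertices ?N)) / 2
          - real (card (straight_cycles ?N))) = real l"
    using assms(3) assms(2) unfolding rooted_grade_def rooted_genus_def map_grade_def by simp
  have "24 + 3 * real (card ?D) - 8 * real (nfaces ?D ?r ?e) - 4 * real (nstraight ?D ?r ?e)
      \<le> 8 * real g + 4 * real l"
    using r rs g l F by simp
  then have "real_of_int (excess ?D ?r ?e) \<le> real_of_int (4 * (2 * int g + int l))"
    unfolding excess_def one by simp
  then have "excess ?D ?r ?e \<le> 4 * (2 * int g + int l)" by linarith
  then show ?thesis using tp one by (simp add: rooted_bound_def)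
qed

section \<open>Dipoles as half-edge data\<close>

definition dipole_tuple :: "('a \<Rightarrow> 'a) \<Rightarrow> 'a \<Rightarrow> 'a \<Rightarrow> nat \<Rightarrow> 'a dipole" where
  "dipole_tuple r a b j = (if j = 2 then O_type else U_type, (a, b), ((r ^^ j) a, (r ^^ (4 - j)) b))"

definition dipole_at :: "'a hmap \<Rightarrow> 'a \<Rightarrow> 'a \<Rightarrow> nat \<Rightarrow> bool" where
  "dipole_at M a b j \<longleftrightarrow> a \<in> darts M \<and> b \<in> darts M \<and> white M a \<and> \<not> white M b \<and> dip (rot M) (edge M) a b j"

lemma cut_melon_iff: "cut_melon M t s s' \<longleftrightarrow> (\<exists>a b j. dipole_at M a b j \<and> (t, s, s') = dipole_tuple (rot M) a b j)"
  unfolding cut_melon_def dipole_at_def dip_def dipole_tuple_def by blast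

text \<open>Two edge maps coexist from here on: counts refer to the closure \<open>e\<close>,
  dipoles to \<open>edge M\<close>, where the root edge is cut and its ends \<open>R\<close> are
  fixed points. They agree off \<open>R\<close>.\<close>

locale reduced_map =
  fixes M :: "'a hmap" and k
  assumes bound: "rooted_bound M k" and nomelon: "\<nexists>A. melonic_submap M A"
begin

abbreviation "D \<equiv> darts M"
abbreviation "r \<equiv> rot M"
abbreviation "e \<equiv> ce M"
abbreviation "R \<equiv> free_darts M"
abbreviation "dd \<equiv> dipole_darts M"

lemma tp: "two_point_map M" and one: "ncomps D r e = 1" and qk: "excess D r e \<le> k"
  using bound by (auto simp: rooted_bound_def)

lemma wf: "wf_hmap M" using tp by (simp add: two_point_map_def)

lemmas cm = two_point_closed_map[OF tp]
lemmas c = closed_mapD[OF cm]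
lemmas W = wf_hmapD[OF wf]

lemma R_facts: "R \<subseteq> D" "R \<noteq> {}" "h \<in> R \<Longrightarrow> e h \<in> R" "h \<in> R \<Longrightarrow> h' \<in> R \<Longrightarrow> h' = h \<or> h' = e h"
  "h \<notin> R \<Longrightarrow> e h = edge M h" "h \<in> D \<Longrightarrow> h \<in> R \<longleftrightarrow> edge M h = h"
proof -
  obtain p q where pq: "R = {p, q}" "e p = q" "e q = p" using two_pointE[OF tp] by metis
  show "R \<subseteq> D" by (auto simp: free_darts_def)
  show "R \<noteq> {}" "h \<in> R \<Longrightarrow> e h \<in> R" "h \<in> R \<Longrightarrow> h' \<in> R \<Longrightarrow> h' = h \<or> h' = e h" using pq by auto
  show "h \<notin> R \<Longrightarrow> e h = edge M h" by (simp add: closure_map_def)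
  show "h \<in> D \<Longrightarrow> h \<in> R \<longleftrightarrow> edge M h = h" by (simp add: free_darts_def)
qed

lemma R_back: "h \<in> D \<Longrightarrow> e h \<in> R \<longleftrightarrow> h \<in> R"
  using R_facts(3) c(7) by metis

lemma whole:
  assumes "X \<subseteq> D" "\<And>h. h \<in> X \<Longrightarrow> r h \<in> X" "\<And>h. h \<in> X \<Longrightarrow> e h \<in> X" "x \<in> X"
  shows "X \<inter> R \<noteq> {}"
proof -
  have "D \<subseteq> X"
  proof
    fix v assume "v \<in> D"
    then have "(x, v) \<in> conn (mrel D r e)" using ncomps_one_iff[OF one] assms(1,4) by blast
    then have "x \<in> X \<longleftrightarrow> v \<in> X" by (rule conn_closed) (rule mrel_closed[OF cm assms(2,3)])
    then show "v \<in> X" using assms(4) by simp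
  qed
  then show ?thesis using R_facts(1,2) by blast
qed

lemma rpow: "h \<in> D \<Longrightarrow> (r ^^ n) h \<in> D"
  using funpow_in[of D r] W(2) by auto

lemma rwhite: "h \<in> D \<Longrightarrow> white M ((r ^^ n) h) = white M h"
  using W(5) rpow by (induction n) auto

text \<open>An inner edge of a dipole joins a white to a black half-edge, so its ends are not fixed
  by \<open>edge M\<close>. It is not the root edge and survives in the closure.\<close>

lemma dipole_atD:
  assumes "dipole_at M a b j"
  shows "a \<in> D" "b \<in> D" "white M a" "\<not> white M b" "dip r (edge M) a b j" "dip r e a b j" "1 \<le> j" "j \<le> 3"
proof -
  show 1: "a \<in> D" "b \<in> D" "white M a" "\<not> white M b" "dip r (edge M) a b j" using assms by (auto simp: dipole_at_def)
  show "1 \<le> j" "j \<le> 3" using 1(5) by (auto simp: dip_def)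
  have "e ((r ^^ i) a) = (r ^^ (4 - i)) b" if "i \<in> {1, 2, 3} - {j}" for i
  proof -
    have eq: "edge M ((r ^^ i) a) = (r ^^ (4 - i)) b" using 1(5) that by (auto simp: dip_def)
    then have "edge M ((r ^^ i) a) \<noteq> (r ^^ i) a" using rwhite 1 by metis
    then have "(r ^^ i) a \<notin> R" by (simp add: free_darts_def)
    then show ?thesis using eq R_facts(5) by simp
  qed
  then show "dip r e a b j" using 1(5) by (auto simp: dip_def)
qed

lemma dipole_at_flip:
  assumes "dipole_at M a b j"
  shows "dipole_at M ((r ^^ j) a) ((r ^^ (4 - j)) b) (4 - j)"
    "dipole_tuple r ((r ^^ j) a) ((r ^^ (4 - j)) b) (4 - j) = flip (dipole_tuple r a b j)"
proof -
  note d = dipole_atD[OF assms]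
  have f: "dip r (edge M) ((r ^^ j) a) ((r ^^ (4 - j)) b) (4 - j)"
    using W(2,3) d(1,2) by (cases rule: dip_cases[OF d(5)]) (use d(5) in \<open>auto simp: dip_simps funpow123\<close>)
  then show "dipole_at M ((r ^^ j) a) ((r ^^ (4 - j)) b) (4 - j)"
    using d rpow rwhite by (simp add: dipole_at_def)
  have "(r ^^ (4 - j)) ((r ^^ j) a) = a" "(r ^^ (4 - (4 - j))) ((r ^^ (4 - j)) b) = b"
    using W(2,3) d(1,2) by (cases rule: dip_cases[OF d(5)]; auto simp: funpow123)+
  then show "dipole_tuple r ((r ^^ j) a) ((r ^^ (4 - j)) b) (4 - j) = flip (dipole_tuple r a b j)"
    by (cases rule: dip_cases[OF d(5)]) (auto simp: dipole_tuple_def)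
qed

lemma is_dipole_iff: "is_dipole M d \<longleftrightarrow> (\<exists>a b j. dipole_at M a b j \<and> d = dipole_tuple r a b j)"
proof -
  obtain t s s' where d: "d = (t, s, s')" by (cases d)
  have "\<exists>a b j. dipole_at M a b j \<and> (t, s, s') = dipole_tuple r a b j" if h: "\<exists>a b j. dipole_at M a b j \<and> (t, s', s) = dipole_tuple r a b j"
  proof -
    obtain a b j where m: "dipole_at M a b j" "(t, s', s) = dipole_tuple r a b j" using h by blast
    then have "(t, s, s') = flip (dipole_tuple r a b j)" by (metis flip.simps)
    then show ?thesis using dipole_at_flip[OF m(1)] by metis
  qed
  then show ?thesis unfolding d is_dipole.simps cut_melon_iff by blast
qed

lemma is_dipole_flip: "is_dipole M (flip d) \<longleftrightarrow> is_dipole M d"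
  by (cases d) auto

lemma flip_flip [simp]: "flip (flip d) = d"
  by (cases d) auto

lemma dd_dipole_tuple: "a \<in> D \<Longrightarrow> b \<in> D \<Longrightarrow> dd (dipole_tuple r a b j) = block r a b"
  using orbit_vx[of r a] orbit_vx[of r b] W(3) by (simp add: dipole_tuple_def block_def)

lemma dipole_facts:
  assumes "is_dipole M (t, (a, b), (a', b'))"
  shows "a \<in> D" "b \<in> D" "a' \<in> D" "b' \<in> D" "white M a" "\<not> white M b" "white M a'" "\<not> white M b'"
    "a \<noteq> a'" "b \<noteq> b'" "dd (t, (a, b), (a', b')) = block r a b" "a' \<in> vx r a" "b' \<in> vx r b"
    "h \<in> block r a b \<Longrightarrow> h \<notin> {a, b, a', b'} \<Longrightarrow> edge M h \<in> block r a b \<and> edge M h \<notin> {a, b, a', b'} \<and> h \<notin> R"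
    "\<exists>j. dipole_at M a b j \<and> a' = (r ^^ j) a \<and> b' = (r ^^ (4 - j)) b \<and> t = (if j = 2 then O_type else U_type)"
proof -
  obtain j where m: "dipole_at M a b j" and t: "t = (if j = 2 then O_type else U_type)"
    and a': "a' = (r ^^ j) a" "b' = (r ^^ (4 - j)) b"
    using assms unfolding is_dipole_iff by (auto simp: dipole_tuple_def)
  note d = dipole_atD[OF m]
  show "a \<in> D" "b \<in> D" "white M a" "\<not> white M b" by fact+
  show "a' \<in> D" "b' \<in> D" "white M a'" "\<not> white M b'" using rpow rwhite d a' by auto
  show "\<exists>j. dipole_at M a b j \<and> a' = (r ^^ j) a \<and> b' = (r ^^ (4 - j)) b \<and> t = (if j = 2 then O_type else U_type)"
    using m t a' by blast
  show "a \<noteq> a'" "b \<noteq> b'" unfolding a'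
    using rot_ne[OF cm d(1)] rot_ne[OF cm d(2)]
    by (cases rule: dip_cases[OF d(5)]; simp add: funpow123; metis)+
  show "dd (t, (a, b), (a', b')) = block r a b" using dd_dipole_tuple[OF d(1,2), of j] by (simp add: dipole_tuple_def a' t)
  show "a' \<in> vx r a" "b' \<in> vx r b" unfolding a'
    by (cases rule: dip_cases[OF d(5)]; simp add: funpow123 vx_def)+
  show "edge M h \<in> block r a b \<and> edge M h \<notin> {a, b, a', b'} \<and> h \<notin> R"
    if h: "h \<in> block r a b" "h \<notin> {a, b, a', b'}"
  proof -
    have hD: "h \<in> D" using h block_closed(1)[OF cm d(1,2)] by auto
    have eh: "e h \<in> block r a b" "e h \<notin> {a, b, a', b'}"
      using block_inner[OF cm d(1-4,6) h(1)] h(2) unfolding a' by auto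
    have "h \<notin> R"
    proof
      assume hR: "h \<in> R"
      have eR: "e h \<in> R" using R_facts(3) hR .
      \<comment> \<open>A white root half-edge in the block cannot be an inner one, since those are
        sent by \<open>edge M\<close> to black half-edges. The black case reduces to this by
        crossing the root edge.\<close>
      have I: "z \<in> {a, b, a', b'}" if z: "z \<in> block r a b" "z \<in> R" "white M z" for z
      proof -
        have fx: "edge M z = z" using z(2) by (simp add: free_darts_def)
        have nb: "z \<notin> vx r b" using z(3) W(2,5) d by (auto simp: vx_def)
        have E: "i \<in> {1, 2, 3} - {j} \<Longrightarrow> edge M ((r ^^ i) a) = (r ^^ (4 - i)) b" for i
          using d(5) by (auto simp: dip_def)
        have ne: "(r ^^ i) a \<noteq> (r ^^ l) b" for i l using rwhite d by metis
        have "z \<in> vx r a" using z(1) nb by (auto simp: block_def)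
        then consider "z = a" | "z = (r ^^ Suc 0) a" | "z = (r ^^ 2) a" | "z = (r ^^ 3) a"
          by (auto simp: vx_def funpow123)
        then show ?thesis
        proof cases
          case 2 then show ?thesis using E[of 1] fx ne[of 1 3] a' by (cases "j = 1") auto
        next
          case 3 then show ?thesis using E[of 2] fx ne[of 2 2] a' by (cases "j = 2") auto
        next
          case 4 then show ?thesis using E[of 3] fx ne[of 3 1] a' by (cases "j = 3") auto
        qed simp
      qed
      show False
      proof (cases "white M h")
        case True then show False using I h hR by blast
      next
        case False
        then have "white M (e h)" using c(8)[OF hD] by simp
        then show False using I eh eR by blast
      qed
    qed
    then show ?thesis using eh R_facts(5) by simp
  qed
qed

lemma flip_facts:
  assumes "is_dipole M d"
  shows "dd (flip d) = dd d" "flip d \<noteq> d"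
proof -
  obtain t a b a' b' where d: "d = (t, (a, b), (a', b'))" by (metis surj_pair)
  have f: "is_dipole M (t, (a', b'), (a, b))" using assms is_dipole_flip[of d] by (simp add: d)
  note A = dipole_facts[OF assms[unfolded d]] and B = dipole_facts[OF f]
  have v: "vx r x = vx r y" if "x \<in> vx r y" "y \<in> D" for x y
    using that W(2,3) unfolding vx_def by (elim insertE emptyE) auto
  show "dd (flip d) = dd d"
    using A(11) B(11) v[OF A(12) A(1)] v[OF A(13) A(2)] by (simp add: d block_def)
  show "flip d \<noteq> d" using A(9) by (auto simp: d)
qed

text \<open>If the edge joining two darts of a side is an edge of the map, the dipole is a melon.\<close>

lemma nontriv:
  assumes dp: "is_dipole M (t, (a, b), s')" and "e a = b"
  shows "a \<in> R"
proof (rule ccontr)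
  assume aR: "a \<notin> R"
  obtain a' b' where s': "s' = (a', b')" by force
  have f: "is_dipole M (t, (a', b'), (a, b))" using dp is_dipole_flip[of "(t, (a, b), s')"] by (simp add: s')
  obtain j where m: "dipole_at M a' b' j" "a = (r ^^ j) a'" "b = (r ^^ (4 - j)) b'"
    using dipole_facts(15)[OF f] by blast
  note d = dipole_atD[OF m(1)]
  have eab: "edge M ((r ^^ j) a') = (r ^^ (4 - j)) b'" using assms(2) aR R_facts(5) m by metis
  have E: "edge M ((r ^^ i) a') = (r ^^ (4 - i)) b'" if "i \<in> {1, 2, 3}" for i
    using d(5) eab that by (cases "i = j") (auto simp: dip_def)
  define A where "A = block r a' b'"
  have AD: "A \<subseteq> D" and Ar: "\<And>h. h \<in> A \<Longrightarrow> r h \<in> A"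
    using block_closed[OF cm d(1,2)] by (auto simp: A_def)
  have E': "edge M (r a') = r (r (r b'))" "edge M (r (r a')) = r (r b')" "edge M (r (r (r a'))) = r b'"
    using E[of 1] E[of 2] E[of 3] by (simp_all add: funpow123)
  have rD: "r a' \<in> D" "r (r a') \<in> D" "r (r (r a')) \<in> D" using W(2) d by auto
  have E'': "edge M (r (r (r b'))) = r a'" "edge M (r (r b')) = r (r a')" "edge M (r b') = r (r (r a'))"
    using E' W(7) rD by metis+
  have wr: "white M (r a')" "white M (r (r a'))" "white M (r (r (r a')))"
    "\<not> white M (r b')" "\<not> white M (r (r b'))" "\<not> white M (r (r (r b')))" using W(2,5) d rD by auto
  have na: "r a' \<noteq> a'" "r (r a') \<noteq> a'" "r (r (r a')) \<noteq> a'" "r b' \<noteq> b'" "r (r b') \<noteq> b'" "r (r (r b')) \<noteq> b'"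
    using rot_ne[OF cm] d by auto
  have inA: "edge M h \<in> A \<and> edge M h \<noteq> h" if "h \<in> A" "h \<noteq> a'" "h \<noteq> b'" for h
  proof -
    have "h \<in> {r a', r (r a'), r (r (r a')), r b', r (r b'), r (r (r b'))}"
      using that by (auto simp: A_def block_def vx_def)
    then show ?thesis using E' E'' wr
      by (elim insertE emptyE) (simp_all add: A_def block_def vx_def, metis+)
  qed
  have out: "edge M z = z \<or> edge M z \<notin> A" if z: "z = a' \<or> z = b'" for z
  proof (rule ccontr)
    assume n: "\<not> ?thesis"
    have zD: "z \<in> D" using z d by auto
    have zz: "edge M (edge M z) = z" using W(7) zD by auto
    have "edge M z \<in> {a', b'}"
    proof (rule ccontr)
      assume o: "edge M z \<notin> {a', b'}"
      then have "edge M z \<in> {r a', r (r a'), r (r (r a')), r b', r (r b'), r (r (r b'))}"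
        using n by (auto simp: A_def block_def vx_def)
      then have "edge M (edge M z) \<noteq> a' \<and> edge M (edge M z) \<noteq> b'"
        using E' E'' na wr d(3,4) by (elim insertE emptyE) (simp_all, metis+)
      then show False using zz z by auto
    qed
    then have ab: "edge M a' = b'" "edge M b' = a'" using n z zz by auto
    have all: "edge M h \<in> A \<and> edge M h \<noteq> h" if h: "h \<in> A" for h
    proof (cases "h = a' \<or> h = b'")
      case True
      then show ?thesis using ab d(3,4) by (auto simp: A_def block_def vx_def)
    next
      case False then show ?thesis using inA[OF h] by auto
    qed
    have nR: "h \<notin> R" if "h \<in> A" for h using all[OF that] by (simp add: free_darts_def)
    have "A \<inter> R \<noteq> {}"
      by (rule whole[OF AD Ar, of a']) (use all nR R_facts(5) in \<open>auto simp: A_def block_def vx_def\<close>)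
    then show False using nR by auto
  qed
  have es: "edge (submap M A) h = edge M h" if "h \<in> A" "h \<noteq> a'" "h \<noteq> b'" for h
    using inA[OF that] by (simp add: edge_submap)
  have ea: "edge (submap M A) a' = a'" "edge (submap M A) b' = b'"
    using out[of a'] out[of b'] by (auto simp: edge_submap)
  have abA: "a' \<in> A" "b' \<in> A" by (auto simp: A_def block_def vx_def)
  have fr: "free_darts (submap M A) = {a', b'}"
    using ea es inA abA by (auto simp: free_darts_def) metis
  have fin: "finite A" using AD W(1) finite_subset by auto
  have wfA: "wf_hmap (submap M A)"
    unfolding wf_hmap_def
  proof (intro conjI ballI)
    show "bij_betw (rot (submap M A)) (darts (submap M A)) (darts (submap M A))"
    proof (simp, rule bij_betwI'[rule_format])
      show "r x = r y \<longleftrightarrow> x = y" if "x \<in> A" "y \<in> A" for x y using that AD W(3) by (metis subsetD)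
      show "r x \<in> A" if "x \<in> A" for x using that Ar by blast
      show "\<exists>x\<in>A. y = r x" if "y \<in> A" for y
        using that Ar AD W(3) by (intro bexI[of _ "r (r (r y))"]) auto
    qed
    fix h assume "h \<in> darts (submap M A)"
    then have h: "h \<in> A" by simp
    have hD: "h \<in> D" using h AD by auto
    show "card (orbit (rot (submap M A)) h) = 4" using wf hD by (simp add: wf_hmap_def)
    show "white (submap M A) (rot (submap M A) h) = white (submap M A) h" using W(5) hD by simp
    show "edge (submap M A) h \<in> darts (submap M A)" using h by (simp add: edge_submap)
    show "edge (submap M A) (edge (submap M A) h) = h"
      using h W(7)[OF hD] by (simp add: edge_submap)
    show "edge (submap M A) h \<noteq> h \<longrightarrow> white (submap M A) (edge (submap M A) h) \<noteq> white (submap M A) h"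
      using W(8)[OF hD] by (simp add: edge_submap)
  qed (use fin in simp)
  have "two_point_map (submap M A)" using wfA fr d(3,4) by (auto simp: two_point_map_def)
  moreover have "A = orbit r a' \<union> orbit r b'"
    using orbit_vx[of r a'] orbit_vx[of r b'] W(3) d by (simp add: A_def block_def)
  moreover have "\<forall>i\<in>{1, 2, 3}. edge (submap M A) ((r ^^ i) a') = (r ^^ (4 - i)) b'"
  proof -
    have "r a' \<in> A" "r (r a') \<in> A" "r (r (r a')) \<in> A" by (auto simp: A_def block_def vx_def)
    moreover have "r a' \<noteq> b'" "r (r a') \<noteq> b'" "r (r (r a')) \<noteq> b'" using wr d(4) by metis+
    ultimately show ?thesis using es na E' by (simp add: funpow123)
  qed
  ultimately have "elementary_melon (submap M A)"
    unfolding elementary_melon_def submap_simps using fr d(3,4) by blast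
  then have "melonic_submap M A" using AD by (auto simp: melonic_submap_def intro: melonic.elementary)
  then show False using nomelon by blast
qed

end

declare is_dipole.simps [simp del] dipole_darts.simps [simp del]

section \<open>Rows of dipoles and the existence of maximal disjoint families\<close>

definition three_chain :: "'a hmap \<Rightarrow> 'a dipole \<Rightarrow> 'a dipole \<Rightarrow> 'a dipole \<Rightarrow> bool" where
  "three_chain M d1 d d2 \<longleftrightarrow> is_dipole M d1 \<and> is_dipole M d \<and> is_dipole M d2 \<and> joined M d1 d \<and> joined M d d2
     \<and> dipole_darts M d1 \<inter> dipole_darts M d = {} \<and> dipole_darts M d \<inter> dipole_darts M d2 = {}
     \<and> dipole_darts M d1 \<inter> dipole_darts M d2 = {}"

text \<open>The middle of five dipoles in a row, written as three overlapping rows of three. In this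
  form rigidity applies to \<open>d\<close> and to both of its neighbours.\<close>

definition deep :: "'a hmap \<Rightarrow> 'a dipole \<Rightarrow> bool" where
  "deep M d \<longleftrightarrow> (\<exists>d0 d1 d2 d3. three_chain M d1 d d2 \<and> three_chain M d0 d1 d \<and> three_chain M d d2 d3)"

context reduced_map
begin

lemma dd_D: "is_dipole M d \<Longrightarrow> dd d \<subseteq> D" "is_dipole M d \<Longrightarrow> h \<in> dd d \<Longrightarrow> r h \<in> dd d"
  "is_dipole M d \<Longrightarrow> finite (dd d) \<and> card (dd d) \<le> 8" "is_dipole M d \<Longrightarrow> dd d \<noteq> {}"
proof -
  assume d: "is_dipole M d"
  obtain t a b a' b' where dt: "d = (t, (a, b), (a', b'))" by (metis surj_pair)
  note A = dipole_facts[OF d[unfolded dt]]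
  show "dd d \<subseteq> D" unfolding dt A(11) by (rule block_closed(1)[OF cm A(1,2)])
  show "h \<in> dd d \<Longrightarrow> r h \<in> dd d" unfolding dt A(11) by (rule block_closed(2)[OF cm A(1,2)])
  show "finite (dd d) \<and> card (dd d) \<le> 8" unfolding dt A(11) by (simp add: card_block)
  show "dd d \<noteq> {}" unfolding dt A(11) by (auto simp: block_def vx_def)
qed

lemma sides_dd:
  assumes "is_dipole M (t, (a, b), (a', b'))"
  shows "a \<in> dd (t, (a, b), (a', b'))" "b \<in> dd (t, (a, b), (a', b'))"
    "a' \<in> dd (t, (a, b), (a', b'))" "b' \<in> dd (t, (a, b), (a', b'))"
  using dipole_facts(11,12,13)[OF assms] by (auto simp: block_def vx_def)

lemma inner_dd:
  assumes "is_dipole M (t, (a, b), (a', b'))" "h \<in> dd (t, (a, b), (a', b'))" "h \<notin> {a, b, a', b'}"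
  shows "e h \<in> dd (t, (a, b), (a', b'))" "e h \<notin> {a, b, a', b'}" "h \<notin> R" "edge M h \<in> dd (t, (a, b), (a', b'))"
  using dipole_facts(11)[OF assms(1)] dipole_facts(14)[OF assms(1), of h] assms(2,3) R_facts(5) by auto

text \<open>A set of dipoles all of whose sides are joined within the set would be the whole map and
  leave no place for the root.\<close>

lemma no_closed:
  assumes "DD \<noteq> {}" "\<And>d. d \<in> DD \<Longrightarrow> is_dipole M d"
    and "\<And>t a b a' b' z. (t, (a, b), (a', b')) \<in> DD \<Longrightarrow> z \<in> {a, b, a', b'} \<Longrightarrow> z \<notin> R \<and> e z \<in> \<Union>(dd ` DD)"
  shows False
proof -
  let ?X = "\<Union>(dd ` DD)"
  have X: "h \<notin> R \<and> e h \<in> ?X" if h: "h \<in> ?X" for h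
  proof -
    obtain d where d: "d \<in> DD" "h \<in> dd d" using h by auto
    obtain t a b a' b' where dt: "d = (t, (a, b), (a', b'))" by (metis surj_pair)
    show ?thesis
    proof (cases "h \<in> {a, b, a', b'}")
      case True
      have "(t, (a, b), (a', b')) \<in> DD" using d(1) dt by simp
      then show ?thesis using True by (rule assms(3))
    next
      case False
      have dp: "is_dipole M (t, (a, b), (a', b'))" and hd: "h \<in> dd (t, (a, b), (a', b'))"
        using assms(2)[OF d(1)] d(2) dt by simp_all
      have "e h \<in> dd d" using inner_dd(1)[OF dp hd False] dt by simp
      then have "e h \<in> ?X" by (rule UN_I[OF d(1)])
      then show ?thesis using inner_dd(3)[OF dp hd False] by simp
    qed
  qed
  obtain d where d: "d \<in> DD" using assms(1) by auto
  obtain x where x: "x \<in> dd d" using dd_D(4)[OF assms(2)[OF d]] by auto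
  have "?X \<inter> R \<noteq> {}"
  proof (rule whole)
    show "?X \<subseteq> D" using dd_D(1) assms(2) by blast
    show "r h \<in> ?X" if "h \<in> ?X" for h using that dd_D(2) assms(2) by blast
    show "e h \<in> ?X" if "h \<in> ?X" for h using X that by blast
    show "x \<in> ?X" using x d by blast
  qed
  then show False using X by blast
qed

lemma joined_iff:
  assumes "is_dipole M (t1, s1, (x, y))" "is_dipole M (t, (a, b), s')"
  shows "joined M (t1, s1, (x, y)) (t, (a, b), s') \<longleftrightarrow> edge M x = b \<and> edge M y = a"
    and "joined M (t1, s1, (x, y)) (t, (a, b), s') \<Longrightarrow>
      x = e b \<and> y = e a \<and> e x = b \<and> e y = a \<and> a \<notin> R \<and> b \<notin> R \<and> x \<notin> R \<and> y \<notin> R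
      \<and> edge M b = x \<and> edge M a = y"
proof -
  show 1: "joined M (t1, s1, (x, y)) (t, (a, b), s') \<longleftrightarrow> edge M x = b \<and> edge M y = a" by simp
  assume "joined M (t1, s1, (x, y)) (t, (a, b), s')"
  then have ed: "edge M x = b" "edge M y = a" using 1 by auto
  obtain u v where s1: "s1 = (u, v)" by force
  obtain u' v' where s': "s' = (u', v')" by force
  note A = dipole_facts[OF assms(1)[unfolded s1]] and B = dipole_facts[OF assms(2)[unfolded s']]
  have ne: "edge M x \<noteq> x" "edge M y \<noteq> y" using ed A(7,8) B(5,6) by auto
  have nR: "x \<notin> R" "y \<notin> R" using ne by (simp_all add: free_darts_def)
  then have ex: "e x = b" "e y = a" using R_facts(5) ed by auto
  then have eb: "e b = x" "e a = y" using c(7) A(3,4) by metis+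
  then have "a \<notin> R" "b \<notin> R" using nR R_facts(3) by metis+
  moreover then have "edge M b = x" "edge M a = y" using R_facts(5) eb by auto
  ultimately show "x = e b \<and> y = e a \<and> e x = b \<and> e y = a \<and> a \<notin> R \<and> b \<notin> R \<and> x \<notin> R \<and> y \<notin> R
      \<and> edge M b = x \<and> edge M a = y" using ex eb nR by auto
qed

lemma joined_flip:
  assumes "is_dipole M d1" "is_dipole M d" "joined M d1 d"
  shows "joined M (flip d) (flip d1)"
proof -
  obtain t1 s1 x y where d1: "d1 = (t1, s1, (x, y))" by (metis surj_pair)
  obtain t a b s' where d: "d = (t, (a, b), s')" by (metis surj_pair)
  show ?thesis using joined_iff(2)[of t1 s1 x y t a b s'] assms by (simp add: d1 d)
qed

lemma three_chain_flip: "three_chain M d1 d d2 \<Longrightarrow> three_chain M (flip d2) (flip d) (flip d1)"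
  unfolding three_chain_def using joined_flip is_dipole_flip flip_facts(1) by (metis Int_commute)

lemma deep_flip: "deep M d \<Longrightarrow> deep M (flip d)"
  unfolding deep_def using three_chain_flip by metis

lemma finite_dipoles: "finite {d. is_dipole M d}"
proof -
  have "{d. is_dipole M d} \<subseteq> (\<lambda>(a, b, j). dipole_tuple r a b j) ` (D \<times> D \<times> {1, 2, 3})"
  proof
    fix d assume "d \<in> {d. is_dipole M d}"
    then obtain a b j where "dipole_at M a b j" "d = dipole_tuple r a b j" using is_dipole_iff by auto
    then show "d \<in> (\<lambda>(a, b, j). dipole_tuple r a b j) ` (D \<times> D \<times> {1, 2, 3})"
      by (intro image_eqI[of _ _ "(a, b, j)"]) (auto simp: dipole_at_def dip_def)
  qed
  then show ?thesis by (rule finite_subset) (use W(1) in auto)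
qed

lemma exists_family:
  obtains F where "\<And>d. d \<in> F \<Longrightarrow> is_dipole M d"
    "\<And>d d'. d \<in> F \<Longrightarrow> d' \<in> F \<Longrightarrow> d \<noteq> d' \<Longrightarrow> dd d \<inter> dd d' = {}"
    "\<And>d. is_dipole M d \<Longrightarrow> \<exists>d'\<in>F. dd d \<inter> dd d' \<noteq> {}"
proof -
  define C where "C = {F. F \<subseteq> {d. is_dipole M d} \<and> (\<forall>d\<in>F. \<forall>d'\<in>F. d \<noteq> d' \<longrightarrow> dd d \<inter> dd d' = {})}"
  have "finite C" unfolding C_def using finite_dipoles by (auto intro: finite_subset[OF _ finite_Pow_iff[THEN iffD2]])
  moreover have "{} \<in> C" by (simp add: C_def)
  ultimately obtain F where F: "F \<in> C" "\<And>G. G \<in> C \<Longrightarrow> F \<subseteq> G \<Longrightarrow> F = G"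
    using finite_has_maximal[of C] by blast
  show thesis
  proof (rule that[of F])
    show "is_dipole M d" if "d \<in> F" for d using F(1) that by (auto simp: C_def)
    show "dd d \<inter> dd d' = {}" if "d \<in> F" "d' \<in> F" "d \<noteq> d'" for d d' using F(1) that by (auto simp: C_def)
    show "\<exists>d'\<in>F. dd d \<inter> dd d' \<noteq> {}" if d: "is_dipole M d" for d
    proof (rule ccontr)
      assume n: "\<not> ?thesis"
      then have "insert d F \<in> C" using F(1) d by (auto simp: C_def)
      then have "d \<in> F" using F(2)[of "insert d F"] by blast
      then show False using n dd_D(4)[OF d] by blast
    qed
  qed
qed

end

section \<open>The sides of a maximal disjoint family of dipoles\<close>

locale dipole_family = reduced_map +
  fixes F :: "'a dipole set"
  assumes Fd: "\<And>d. d \<in> F \<Longrightarrow> is_dipole M d"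
    and Fdisj: "\<And>d d'. d \<in> F \<Longrightarrow> d' \<in> F \<Longrightarrow> d \<noteq> d' \<Longrightarrow> dd d \<inter> dd d' = {}"
    and Fmax: "\<And>d. is_dipole M d \<Longrightarrow> \<exists>d'\<in>F. dd d \<inter> dd d' \<noteq> {}"
begin

text \<open>A dipole and its flip occupy the same half-edges, so \<open>F\<close> contains only one
  of them. Adding the other orientation lets \<open>S\<close> collect both sides as first
  sides.\<close>

definition "Fs = F \<union> flip ` F"
definition "S = (\<lambda>d. fst (snd d)) ` Fs"

lemma Fs_dip: "d \<in> Fs \<Longrightarrow> is_dipole M d" and Fs_flip: "d \<in> Fs \<Longrightarrow> flip d \<in> Fs"
proof -
  show "d \<in> Fs \<Longrightarrow> is_dipole M d" unfolding Fs_def using Fd is_dipole_flip by blast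
  assume "d \<in> Fs"
  then consider "d \<in> F" | f where "f \<in> F" "d = flip f" unfolding Fs_def by blast
  then show "flip d \<in> Fs"
  proof cases
    case 2
    then have "flip d = f" by (simp only: flip_flip)
    then show ?thesis using 2(1) unfolding Fs_def by simp
  qed (unfold Fs_def, blast)
qed

lemma Fs_disj: "d \<in> Fs \<Longrightarrow> d' \<in> Fs \<Longrightarrow> dd d \<inter> dd d' \<noteq> {} \<Longrightarrow> d' = d \<or> d' = flip d"
proof -
  assume d: "d \<in> Fs" "d' \<in> Fs" "dd d \<inter> dd d' \<noteq> {}"
  obtain f f' where f: "f \<in> F" "d = f \<or> d = flip f" "f' \<in> F" "d' = f' \<or> d' = flip f'"
    using d(1,2) unfolding Fs_def by blast
  then have "dd d = dd f" "dd d' = dd f'" using flip_facts(1)[OF Fd] by metis+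
  then have "f = f'" using Fdisj f d(3) by metis
  then show ?thesis using f flip_flip by metis
qed

lemma S_iff: "s \<in> S \<longleftrightarrow> (\<exists>t s'. (t, s, s') \<in> Fs)"
  by (force simp: S_def)

lemma S_D: assumes "(a, b) \<in> S" shows "a \<in> D" "b \<in> D" "white M a" "\<not> white M b"
proof -
  obtain t s' where "(t, (a, b), s') \<in> Fs" using assms S_iff by auto
  then have "is_dipole M (t, (a, b), (fst s', snd s'))" using Fs_dip by (simp only: prod.collapse)
  from dipole_facts(1,2,5,6)[OF this] show "a \<in> D" "b \<in> D" "white M a" "\<not> white M b" .
qed

lemma S_in_block:
  assumes "(t, (a, b), (a', b')) \<in> Fs" "(x, y) \<in> S" "x \<in> dd (t, (a, b), (a', b')) \<or> y \<in> dd (t, (a, b), (a', b'))"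
  shows "(x, y) = (a, b) \<or> (x, y) = (a', b')"
proof -
  obtain t2 x' y' where d2: "(t2, (x, y), (x', y')) \<in> Fs" using assms(2) S_iff by force
  have "dd (t, (a, b), (a', b')) \<inter> dd (t2, (x, y), (x', y')) \<noteq> {}"
    using assms(3) sides_dd[OF Fs_dip[OF d2]] by blast
  then have "(t2, (x, y), (x', y')) = (t, (a, b), (a', b')) \<or> (t2, (x, y), (x', y')) = flip (t, (a, b), (a', b'))"
    using Fs_disj[OF assms(1) d2] by blast
  then show ?thesis by auto
qed

lemma Sd_in_block:
  assumes "(t, (a, b), (a', b')) \<in> Fs" "z \<in> fst ` S \<union> snd ` S" "z \<in> dd (t, (a, b), (a', b'))"
  shows "z \<in> {a, b, a', b'}"
proof -
  obtain x y where xy: "(x, y) \<in> S" "z = x \<or> z = y" using assms(2) by auto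
  then have "(x, y) = (a, b) \<or> (x, y) = (a', b')" using S_in_block[OF assms(1) xy(1)] assms(3) by blast
  then show ?thesis using xy by auto
qed

lemma rpow_ne:
  assumes "a \<in> D" "i \<in> {1, 2, 3}" "j \<in> {1, 2, 3}" "i \<noteq> j"
  shows "(r ^^ i) a \<noteq> a" "(r ^^ i) a \<noteq> (r ^^ j) a"
  using rot_ne[OF cm assms(1)] rot_ne[OF cm assms(1), symmetric] assms(2-4) by (auto simp: funpow123)

text \<open>Inner half-edges of a member lie in its own block, where the only sides are its own two;
  distinct powers of the rotation keep them apart.\<close>

lemma closable_S: "closable D r e (white M) S"
  unfolding closable_def
proof (intro conjI allI impI)
  show "S \<subseteq> D \<times> D" using S_D by auto
  fix a b assume ab: "(a, b) \<in> S"
  show "white M a" "\<not> white M b" using S_D ab by auto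
  obtain t a' b' where d: "(t, (a, b), (a', b')) \<in> Fs" using ab S_iff by force
  note dp = Fs_dip[OF d]
  obtain j where j: "dipole_at M a b j" "a' = (r ^^ j) a" "b' = (r ^^ (4 - j)) b"
    using dipole_facts(15)[OF dp] by blast
  note m = dipole_atD[OF j(1)]
  have j3: "j \<in> {1, 2, 3}" "4 - j \<in> {1, 2, 3}" using m(7,8) by auto
  have "e ((r ^^ i) a) = (r ^^ (4 - i)) b \<and> (r ^^ i) a \<notin> fst ` S \<union> snd ` S
        \<and> (r ^^ (4 - i)) b \<notin> fst ` S \<union> snd ` S" (is "?P i") if i: "i \<in> {1, 2, 3} - {j}" for i
  proof -
    have i3: "i \<in> {1, 2, 3}" "4 - i \<in> {1, 2, 3}" "i \<noteq> j" "4 - i \<noteq> 4 - j" using i m(7,8) by auto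
    have in_dd: "(r ^^ n) z \<in> dd (t, (a, b), (a', b'))" if "z \<in> dd (t, (a, b), (a', b'))" for n z
      by (rule funpow_in) (use that dd_D(2)[OF dp] in auto)
    have "(r ^^ i) a \<notin> {a, b, a', b'}"
      using rpow_ne[OF m(1) i3(1) j3(1) i3(3)] rwhite[OF m(1)] m(3,4) dipole_facts(8)[OF dp] j(2) by auto
    moreover have "(r ^^ (4 - i)) b \<notin> {a, b, a', b'}"
      using rpow_ne[OF m(2) i3(2) j3(2) i3(4)] rwhite[OF m(2)] m(3,4) dipole_facts(7)[OF dp] j(3) by auto
    moreover have "(r ^^ i) a \<in> dd (t, (a, b), (a', b'))" "(r ^^ (4 - i)) b \<in> dd (t, (a, b), (a', b'))"
      using in_dd sides_dd[OF dp] by auto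
    ultimately have "(r ^^ i) a \<notin> fst ` S \<union> snd ` S" "(r ^^ (4 - i)) b \<notin> fst ` S \<union> snd ` S"
      using Sd_in_block[OF d, of "(r ^^ i) a"] Sd_in_block[OF d, of "(r ^^ (4 - i)) b"] by metis+
    moreover have "e ((r ^^ i) a) = (r ^^ (4 - i)) b" using m(6) i unfolding dip_def by (elim conjE) (rule bspec)
    ultimately show ?thesis by blast
  qed
  then show "\<exists>j\<in>{1, 2, 3}. \<forall>i\<in>{1, 2, 3} - {j}. e ((r ^^ i) a) = (r ^^ (4 - i)) b \<and>
      (r ^^ i) a \<notin> fst ` S \<union> snd ` S \<and> (r ^^ (4 - i)) b \<notin> fst ` S \<union> snd ` S"
    by (intro bexI[OF _ j3(1)] ballI)
  fix x y assume xy: "(x, y) \<in> S"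
  show "a = x \<longleftrightarrow> b = y"
    using S_in_block[OF d xy] sides_dd[OF dp] dipole_facts(9,10)[OF dp] by auto
qed

lemma no_dipole_outside:
  assumes "dipole_at M a b j" "block r a b \<subseteq> D - \<Union>(dd ` F)"
  shows False
proof -
  have "is_dipole M (dipole_tuple r a b j)" using assms(1) is_dipole_iff by blast
  then obtain d' where "d' \<in> F" "dd (dipole_tuple r a b j) \<inter> dd d' \<noteq> {}" using Fmax by blast
  moreover have "dd (dipole_tuple r a b j) = block r a b" using dd_dipole_tuple dipole_atD(1,2)[OF assms(1)] by auto
  ultimately show False using assms(2) by blast
qed

lemma outside_block:
  assumes "h \<in> D - \<Union>(dd ` F)" "h' \<in> D - \<Union>(dd ` F)" "a \<in> vx r h" "b \<in> vx r h'"
  shows "block r a b \<subseteq> D - \<Union>(dd ` F)"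
proof -
  have r': "r z \<in> D - \<Union>(dd ` F)" if z: "z \<in> D - \<Union>(dd ` F)" for z
  proof -
    have "r z \<notin> dd d" if d: "d \<in> F" for d
      using rclosed_iff[OF cm dd_D(2)[OF Fd[OF d]], of z] z d by blast
    then show ?thesis using z W(2) by blast
  qed
  have "vx r z \<subseteq> D - \<Union>(dd ` F)" if "z \<in> D - \<Union>(dd ` F)" for z
    unfolding vx_def using that r' by auto
  note v = this
  have "a \<in> D - \<Union>(dd ` F)" "b \<in> D - \<Union>(dd ` F)"
    using v[OF assms(1)] v[OF assms(2)] assms(3,4) by (simp_all only: subset_iff)
  from v[OF this(1)] v[OF this(2)] show ?thesis unfolding block_def by (rule Un_least)
qed

text \<open>The bigon yields a dipole of the closure. Its two edges avoid the root, so it is a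
  dipole of \<open>M\<close> as well, and lying outside all blocks it contradicts the maximality of
  the family.\<close>

lemma face_outside:
  assumes h: "h \<in> D - \<Union>(dd ` F)" "e h \<notin> \<Union>(dd ` F)" "r (e (r (e h))) = h" "h \<notin> R" "r (e h) \<notin> R" and w: "white M h"
  shows False
proof -
  have eD: "e h \<in> D - \<Union>(dd ` F)" using h c(6) by blast
  have D1: "h \<in> D" "r (e h) \<in> D" using h c(2,6) by auto
  have f: "dip r e (r h) (r (r (r (e h)))) 1" by (rule face_dip[OF cm D1(1) h(3) w])
  have r3: "r (r (r h)) = e (r (e h))" using h(3) c(2,3,6) D1 by metis
  have "r (r (r h)) \<notin> R" unfolding r3 using R_back[OF D1(2)] h(5) by simp
  moreover have "r (r (r (r h))) \<notin> R" using c(3) D1 h(4) by simp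
  ultimately have "dip r (edge M) (r h) (r (r (r (e h)))) 1" using f R_facts(5) by (simp add: dip_simps)
  then have m: "dipole_at M (r h) (r (r (r (e h)))) 1"
    using D1 w W(2,5) c(6,8) by (simp add: dipole_at_def)
  show False by (rule no_dipole_outside[OF m outside_block[OF h(1) eD]]) (auto simp: vx_def)
qed

lemma straight_outside:
  assumes h: "h \<in> D - \<Union>(dd ` F)" "e h \<notin> \<Union>(dd ` F)" "r (r (e (r (r (e h))))) = h" "h \<notin> R" "r (r (e h)) \<notin> R"
    and w: "white M h"
  shows False
proof -
  have eD: "e h \<in> D - \<Union>(dd ` F)" using h c(6) by blast
  have D1: "h \<in> D" "r (r (e h)) \<in> D" using h c(2,6) by auto
  have f: "dip r e (r (r (r h))) (r (e h)) 2" by (rule straight_dip[OF cm D1(1) h(3) w])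
  have r3: "r (r h) = e (r (r (e h)))" using h(3) c(2,3,6) D1 by metis
  have "r (r h) \<notin> R" unfolding r3 using R_back[OF D1(2)] h(5) by simp
  then have "r (r (r (r (r (r h))))) \<notin> R" using c(2,3) D1 by simp
  moreover have "r (r (r (r h))) \<notin> R" using c(3) D1 h(4) by simp
  ultimately have "dip r (edge M) (r (r (r h))) (r (e h)) 2" using f R_facts(5) by (simp add: dip_simps)
  then have m: "dipole_at M (r (r (r h))) (r (e h)) 2"
    using D1 w W(2,5) c(6,8) by (simp add: dipole_at_def)
  show False by (rule no_dipole_outside[OF m outside_block[OF h(1) eD]]) (auto simp: vx_def)
qed

lemma card_S: "card S = 2 * card F"
proof -
  have fin: "finite F" using finite_dipoles Fd by (meson finite_subset mem_Collect_eq subsetI)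
  have 1: "inj_on (\<lambda>d. fst (snd d)) Fs"
  proof (rule inj_onI)
    fix d d' assume d: "d \<in> Fs" "d' \<in> Fs" "fst (snd d) = fst (snd d')"
    obtain t a b a' b' where dt: "d = (t, (a, b), (a', b'))" by (metis surj_pair)
    obtain t2 a2 b2 where dt2: "d' = (t2, (a, b), (a2, b2))" using d(3) dt by (metis fst_conv snd_conv surj_pair)
    have "dd d \<inter> dd d' \<noteq> {}" using sides_dd(1)[OF Fs_dip[OF d(1)[unfolded dt]]]
      sides_dd(1)[OF Fs_dip[OF d(2)[unfolded dt2]]] dt dt2 by blast
    then have "d' = d \<or> d' = flip d" using Fs_disj d by blast
    then show "d = d'" using dipole_facts(9)[OF Fs_dip[OF d(1)[unfolded dt]]] dt dt2 by auto
  qed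
  have 2: "F \<inter> flip ` F = {}"
  proof (rule ccontr)
    assume "F \<inter> flip ` F \<noteq> {}"
    then obtain d where d: "d \<in> F" "flip d \<in> F" by auto
    then have "dd d \<inter> dd (flip d) = {}" using Fdisj[of d "flip d"] flip_facts(2)[OF Fd] by metis
    then show False using flip_facts(1)[OF Fd[OF d(1)]] dd_D(4)[OF Fd[OF d(1)]] by simp
  qed
  have "inj_on flip F" by (rule inj_onI) (metis flip_flip)
  then have "card Fs = 2 * card F" unfolding Fs_def using 2 fin by (simp add: card_Un_disjoint card_image)
  then show ?thesis unfolding S_def using 1 by (simp add: card_image)
qed

sublocale fam: family D r e "white M" S "dd ` F" R
proof
  show "closed_map D r e (white M)" by (rule cm)
  show "closable D r e (white M) S" by (rule closable_S)
  show "ncomps D r e = 1" by (rule one)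
  show "disjoint (dd ` F)"
  proof (unfold disjoint_def, intro ballI impI)
    fix A B assume A: "A \<in> dd ` F" and B: "B \<in> dd ` F" and n: "A \<noteq> B"
    obtain d where d: "A = dd d" "d \<in> F" using A by (rule imageE)
    obtain d' where d': "B = dd d'" "d' \<in> F" using B by (rule imageE)
    have "d \<noteq> d'" using n d(1) d'(1) by metis
    then show "A \<inter> B = {}" unfolding d(1) d'(1) by (rule Fdisj[OF d(2) d'(2)])
  qed
  show "B \<subseteq> D" "B \<noteq> {}" "card B \<le> 8" "h \<in> B \<Longrightarrow> r h \<in> B" if B: "B \<in> dd ` F" for B h
  proof -
    obtain d where d: "B = dd d" "d \<in> F" using B by (rule imageE)
    note dp = Fd[OF d(2)]
    show "B \<subseteq> D" "B \<noteq> {}" "card B \<le> 8" "h \<in> B \<Longrightarrow> r h \<in> B"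
      unfolding d(1) using dd_D[OF dp] by simp_all
  qed
  show "e h \<in> B \<and> e h \<notin> fst ` S \<union> snd ` S"
    if B: "B \<in> dd ` F" "h \<in> B" "h \<notin> fst ` S \<union> snd ` S" for B h
  proof -
    obtain d where d: "d \<in> F" "B = dd d" using B by auto
    obtain t a b a' b' where dt: "d = (t, (a, b), (a', b'))" by (metis surj_pair)
    have dF: "(t, (a, b), (a', b')) \<in> Fs" "(t, (a', b'), (a, b)) \<in> Fs"
      using d dt Fs_flip[of d] by (auto simp: Fs_def)
    have "(a, b) \<in> S" "(a', b') \<in> S" using S_iff dF by blast+
    then have "h \<notin> {a, b, a', b'}" using B(3) by force
    then have "e h \<in> B" "e h \<notin> {a, b, a', b'}"
      using inner_dd[OF Fs_dip[OF dF(1)]] B(2) d(2) dt by blast+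
    then show ?thesis using Sd_in_block[OF dF(1)] d(2) dt by blast
  qed
  show "a \<in> B \<longleftrightarrow> b \<in> B" if B: "B \<in> dd ` F" "(a, b) \<in> S" for B a b
  proof -
    obtain d where d: "d \<in> F" "B = dd d" using B by auto
    obtain t x y x' y' where dt: "d = (t, (x, y), (x', y'))" by (metis surj_pair)
    have dF: "(t, (x, y), (x', y')) \<in> Fs" using d dt by (auto simp: Fs_def)
    show ?thesis using S_in_block[OF dF B(2)] sides_dd[OF Fs_dip[OF dF]] d(2) dt by blast
  qed
  show "fst ` S \<union> snd ` S \<subseteq> \<Union>(dd ` F)"
  proof -
    have "a \<in> \<Union>(dd ` F) \<and> b \<in> \<Union>(dd ` F)" if ab: "(a, b) \<in> S" for a b
    proof -
      obtain t a' b' where d: "(t, (a, b), (a', b')) \<in> Fs" using ab S_iff by force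
      obtain f where f: "f \<in> F" "(t, (a, b), (a', b')) = f \<or> (t, (a, b), (a', b')) = flip f"
        using d unfolding Fs_def by blast
      then have "dd (t, (a, b), (a', b')) = dd f" using flip_facts(1)[OF Fd[OF f(1)]] by metis
      then have "a \<in> dd f" "b \<in> dd f" using sides_dd[OF Fs_dip[OF d]] by simp_all
      then show ?thesis using f(1) by blast
    qed
    then show ?thesis by force
  qed
  have "finite F" using finite_dipoles Fd by (meson finite_subset mem_Collect_eq subsetI)
  then show "2 * card (dd ` F) \<le> card S" unfolding card_S using card_image_le[of F dd] by simp
  show "R \<subseteq> D" by (rule R_facts)
  show "e h \<in> R" if "h \<in> R" for h by (rule R_facts(3)[OF that])
  show "y = x \<or> y = e x" if "x \<in> R" "y \<in> R" for x y by (rule R_facts(4)[OF that])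
  show "a \<in> R" if ab: "(a, b) \<in> S" "e a = b" for a b
  proof -
    obtain t s' where "(t, (a, b), s') \<in> Fs" using ab S_iff by auto
    then show ?thesis using nontriv[OF Fs_dip ab(2)] by blast
  qed
  show "h \<in> R \<or> r (e h) \<in> R" if h: "h \<in> D - \<Union>(dd ` F)" "e h \<notin> \<Union>(dd ` F)" "e (r (e h)) \<notin> \<Union>(dd ` F)"
      "r (e (r (e h))) = h" for h
  proof (rule ccontr)
    assume n: "\<not> ?thesis"
    have hD: "h \<in> D" "e h \<in> D" "r (e h) \<in> D" using h c(2,6) by auto
    show False
    proof (cases "white M h")
      case True then show False using face_outside[OF h(1,2,4)] n by blast
    next
      case False
      \<comment> \<open>A bigon contains a half-edge of each colour; for black \<open>h\<close> the
        dipole is built from the other one.\<close>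
      have w: "white M (r (e h))" using False c(5,8) hD by auto
      have out: "r (e h) \<in> D - \<Union>(dd ` F)"
        using outside_block[OF h(1), of "e h" h "r (e h)"] h c(6) by (auto simp: vx_def block_def)
      show False
        using face_outside[OF out h(3) _ _ _ w] h(4) n by simp
    qed
  qed
  show "h \<in> R \<or> r (r (e h)) \<in> R" if h: "h \<in> D - \<Union>(dd ` F)" "e h \<notin> \<Union>(dd ` F)" "e (r (r (e h))) \<notin> \<Union>(dd ` F)"
      "r (r (e (r (r (e h))))) = h" for h
  proof (rule ccontr)
    assume n: "\<not> ?thesis"
    have hD: "h \<in> D" "e h \<in> D" "r (e h) \<in> D" "r (r (e h)) \<in> D" using h c(2,6) by auto
    show False
    proof (cases "white M h")
      case True then show False using straight_outside[OF h(1,2,4)] n by blast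
    next
      case False
      have w: "white M (r (r (e h)))" using False c(5,8) hD by auto
      have out: "r (r (e h)) \<in> D - \<Union>(dd ` F)"
        using outside_block[OF h(1), of "e h" h "r (r (e h))"] h c(6) by (auto simp: vx_def block_def)
      show False
        using straight_outside[OF out h(3) _ _ _ w] h(4) n by simp
    qed
  qed
qed

end

section \<open>From joined sides of the family to deep dipoles\<close>

context dipole_family
begin

definition interior :: "'a dipole \<Rightarrow> bool" where
  "interior d \<longleftrightarrow> fam.jn (fst (snd d)) \<and> fam.jn (snd (snd d))"

lemma jn_joined:
  assumes "d \<in> Fs" "fam.jn (fst (snd d))"
  shows "\<exists>d1\<in>Fs. joined M d1 d"
proof -
  obtain t a b s' where d: "d = (t, (a, b), s')" by (metis surj_pair)
  have j: "a \<notin> R" "b \<notin> R" "(e b, e a) \<in> S" using assms(2) by (auto simp: d fam.jn_def)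
  have ab: "a \<in> D" "b \<in> D" using S_D[of a b] S_iff assms(1) d by blast+
  obtain t1 s1 where d1: "(t1, (e b, e a), s1) \<in> Fs" using j(3) S_iff by blast
  have "flip (t1, (e b, e a), s1) \<in> Fs" by (rule Fs_flip[OF d1])
  moreover have "edge M (e b) = b" "edge M (e a) = a"
    using R_facts(5) R_back c(7) ab j by metis+
  ultimately show ?thesis by (intro bexI[of _ "flip (t1, (e b, e a), s1)"]) (simp_all add: d)
qed

lemma jn_joined':
  assumes "d \<in> Fs" "fam.jn (snd (snd d))"
  shows "\<exists>d2\<in>Fs. joined M d d2"
proof -
  have "fst (snd (flip d)) = snd (snd d)" by (cases d) simp
  then obtain d1 where d1: "d1 \<in> Fs" "joined M d1 (flip d)"
    using jn_joined[OF Fs_flip[OF assms(1)]] assms(2) by auto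
  have "joined M (flip (flip d)) (flip d1)"
    by (rule joined_flip[OF Fs_dip[OF d1(1)] Fs_dip[OF Fs_flip[OF assms(1)]] d1(2)])
  then show ?thesis using Fs_flip[OF d1(1)] by auto
qed

text \<open>All three are members of the family, so they are disjoint unless two of them agree up to
  orientation. Each such coincidence is absurd: one or two dipoles would form a ring without place
  for the root, or a side would close up on itself as in a melon, or both sides of \<open>d\<close>
  would share a half-edge.\<close>

lemma interior_three_chain:
  assumes d: "d \<in> Fs" "interior d" and d1: "d1 \<in> Fs" "joined M d1 d" and d2: "d2 \<in> Fs" "joined M d d2"
  shows "three_chain M d1 d d2"
proof -
  obtain t a b a' b' where dt: "d = (t, (a, b), (a', b'))" by (metis surj_pair)
  obtain t1 u v x y where d1t: "d1 = (t1, (u, v), (x, y))" by (metis surj_pair)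
  obtain t2 x' y' u' v' where d2t: "d2 = (t2, (x', y'), (u', v'))" by (metis surj_pair)
  note p = Fs_dip[OF d(1)] and p1 = Fs_dip[OF d1(1)] and p2 = Fs_dip[OF d2(1)]
  note A = dipole_facts[OF p[unfolded dt]]
  have J1: "x = e b \<and> y = e a \<and> e x = b \<and> e y = a \<and> a \<notin> R \<and> b \<notin> R \<and> x \<notin> R \<and> y \<notin> R
      \<and> edge M b = x \<and> edge M a = y"
    using joined_iff(2)[OF p1[unfolded d1t] p[unfolded dt]] d1(2) d1t dt by blast
  have J2: "a' = e y' \<and> b' = e x' \<and> e a' = y' \<and> e b' = x' \<and> x' \<notin> R \<and> y' \<notin> R \<and> a' \<notin> R \<and> b' \<notin> R
      \<and> edge M y' = a' \<and> edge M x' = b'"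
    using joined_iff(2)[OF p[unfolded dt] p2[unfolded d2t]] d2(2) d2t dt by blast
  have f: "is_dipole M (t, (a', b'), (a, b))" using Fs_dip[OF Fs_flip[OF d(1)]] dt by simp
  have nt: "e a \<noteq> b" "e a' \<noteq> b'"
    using nontriv[OF p[unfolded dt]] nontriv[OF f] J1 J2 by blast+
  note sd = sides_dd[OF p[unfolded dt]] and sd1 = sides_dd[OF p1[unfolded d1t]] and sd2 = sides_dd[OF p2[unfolded d2t]]
  have self: False if "e b = a'" "e a = b'"
  proof (rule no_closed[of "{d}"])
    fix ta aa ba aa' ba' z assume "(ta, (aa, ba), (aa', ba')) \<in> {d}" and z: "z \<in> {aa, ba, aa', ba'}"
    then have "z \<in> {a, b, a', b'}" using dt by auto
    moreover have "e a' = b" "e b' = a" using that c(7) A(1,2) by metis+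
    ultimately show "z \<notin> R \<and> e z \<in> \<Union>(dd ` {d})" using that J1 J2 sd dt by auto
  qed (use p in auto)
  have 1: "dd d1 \<inter> dd d = {}"
  proof (rule ccontr)
    assume "dd d1 \<inter> dd d \<noteq> {}"
    then have "d = d1 \<or> d = flip d1" using Fs_disj d1 d by blast
    then have "(x, y) = (a', b') \<or> (x, y) = (a, b)" using dt d1t by auto
    then show False
    proof
      assume "(x, y) = (a', b')"
      then have "e b = a'" "e a = b'" using J1 by (metis prod.inject)+
      then show False by (rule self)
    next
      assume "(x, y) = (a, b)"
      then have "e a = b" using J1 by (metis prod.inject)
      then show False using nt(1) by simp
    qed
  qed
  have 2: "dd d \<inter> dd d2 = {}"
  proof (rule ccontr)
    assume "dd d \<inter> dd d2 \<noteq> {}"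
    then have "d2 = d \<or> d2 = flip d" using Fs_disj d2 d by blast
    then have "(x', y') = (a', b') \<or> (x', y') = (a, b)" using dt d2t by auto
    then show False
    proof
      assume "(x', y') = (a', b')"
      then have "e a' = b'" using J2 by (metis prod.inject)
      then show False using nt(2) by simp
    next
      assume "(x', y') = (a, b)"
      then have "e a' = b" "e b' = a" using J2 by (metis prod.inject)+
      then show False using self c(7) A(3,4) by metis
    qed
  qed
  have 3: "dd d1 \<inter> dd d2 = {}"
  proof (rule ccontr)
    assume "dd d1 \<inter> dd d2 \<noteq> {}"
    then consider "d2 = d1" | "d2 = flip d1" using Fs_disj d2 d1 by blast
    then show False
    proof cases
      case 1
      then have eq: "u = x'" "v = y'" using d1t d2t by auto
      show False
      proof (rule no_closed[of "{d, d1}"])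
        fix ta aa ba aa' ba' z assume "(ta, (aa, ba), (aa', ba')) \<in> {d, d1}" and z: "z \<in> {aa, ba, aa', ba'}"
        then have "z \<in> {a, b, a', b'} \<or> z \<in> {u, v, x, y}" using dt d1t by auto
        moreover have "z \<notin> R \<and> e z \<in> dd d1" if "z \<in> {a, b, a', b'}" for z
        proof -
          have "e a \<in> dd d1" "e b \<in> dd d1" "e a' \<in> dd d1" "e b' \<in> dd d1"
            using J1 J2 sd1 d1t eq by metis+
          moreover have "a \<notin> R" "b \<notin> R" "a' \<notin> R" "b' \<notin> R" using J1 J2 by blast+
          ultimately show ?thesis using that by blast
        qed
        moreover have "z \<notin> R \<and> e z \<in> dd d" if "z \<in> {u, v, x, y}" for z
        proof -
          have "e u \<in> dd d" "e v \<in> dd d" "e x \<in> dd d" "e y \<in> dd d"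
            using J1 J2 sd dt eq by metis+
          moreover have "u \<notin> R" "v \<notin> R" "x \<notin> R" "y \<notin> R" using J1 J2 eq by blast+
          ultimately show ?thesis using that by blast
        qed
        ultimately show "z \<notin> R \<and> e z \<in> \<Union>(dd ` {d, d1})" by blast
      qed (use p p1 in auto)
    next
      case 2
      then have "x = x'" using d1t d2t by auto
      then have "b = b'" using J1 J2 by metis
      then show False using A(10) by simp
    qed
  qed
  show ?thesis using p p1 p2 d1(2) d2(2) 1 2 3 by (simp add: three_chain_def)
qed

lemma interior_deep:
  assumes d: "d \<in> Fs" "interior d" and d1: "d1 \<in> Fs" "joined M d1 d" "interior d1"
    and d2: "d2 \<in> Fs" "joined M d d2" "interior d2"
  shows "deep M d"
proof -
  obtain d0 where d0: "d0 \<in> Fs" "joined M d0 d1" using jn_joined[OF d1(1)] d1(3) by (auto simp: interior_def)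
  obtain d3 where d3: "d3 \<in> Fs" "joined M d2 d3" using jn_joined'[OF d2(1)] d2(3) by (auto simp: interior_def)
  show ?thesis unfolding deep_def
    using interior_three_chain[OF d d1(1,2) d2(1,2)] interior_three_chain[OF d1(1,3) d0 d(1) d1(2)]
      interior_three_chain[OF d2(1,3) d(1) d2(2) d3] by blast
qed

lemma finite_card_UN:
  assumes "finite X" "\<And>x. x \<in> X \<Longrightarrow> finite (f x) \<and> card (f x) \<le> 8"
  shows "card (\<Union>x\<in>X. f x) \<le> 8 * card X" "finite (\<Union>x\<in>X. f x)"
proof -
  have "card (\<Union>x\<in>X. f x) \<le> (\<Sum>x\<in>X. card (f x))" by (rule card_UN_le[OF assms(1)])
  also have "\<dots> \<le> (\<Sum>x\<in>X. 8)" using assms(2) by (intro sum_mono) auto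
  finally show "card (\<Union>x\<in>X. f x) \<le> 8 * card X" by simp
  show "finite (\<Union>x\<in>X. f x)" using assms by auto
qed

text \<open>A member of the family fails to be deep only if it or one of its neighbours has an
  unjoined side. The former lie in \<open>Y\<close>, at most 8 half-edges per unjoined side. The
  latter are reached by crossing an edge from \<open>Y\<close>, at most 8 half-edges for each
  element of \<open>Y\<close>. In all 8 + 64 = 72.\<close>

lemma deep_count:
  "card (D - \<Union>{dd d | d. deep M d}) \<le> card (D - \<Union>(dd ` F)) + 72 * card {p \<in> S. \<not> fam.jn p}"
proof -
  let ?N = "{p \<in> S. \<not> fam.jn p}"
  define Y where "Y = (\<Union>p\<in>?N. block r (fst p) (snd p))"
  define Q where "Q y = \<Union>{dd d | d. d \<in> Fs \<and> e y \<in> dd d}" for y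
  have finN: "finite ?N" using fam.finS by simp
  have Y: "card Y \<le> 8 * card ?N" "finite Y"
  proof -
    have cb: "finite (block r (fst p) (snd p)) \<and> card (block r (fst p) (snd p)) \<le> 8" for p
      by (simp add: card_block)
    show "card Y \<le> 8 * card ?N" "finite Y" unfolding Y_def by (rule finite_card_UN[OF finN cb])+
  qed
  have NI: "dd d \<subseteq> Y" if d: "d \<in> Fs" "\<not> interior d" for d
  proof -
    obtain t a b a' b' where dt: "d = (t, (a, b), (a', b'))" by (metis surj_pair)
    have f: "(t, (a', b'), (a, b)) \<in> Fs" using Fs_flip[OF d(1)] dt by simp
    have S: "(a, b) \<in> S" "(a', b') \<in> S" using S_iff d(1) f dt by blast+
    have "dd d = block r a b" using dipole_facts(11) Fs_dip[OF d(1)] dt by blast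
    moreover have "dd d = block r a' b'"
      using dipole_facts(11)[OF Fs_dip[OF f]] flip_facts(1)[OF Fs_dip[OF d(1)]] dt by simp
    moreover have "(a, b) \<in> ?N \<or> (a', b') \<in> ?N" using d(2) S by (auto simp: interior_def dt)
    ultimately show ?thesis unfolding Y_def by force
  qed
  have Q: "finite (Q y) \<and> card (Q y) \<le> 8" for y
  proof (cases "\<exists>d\<in>Fs. e y \<in> dd d")
    case True
    then obtain d where d: "d \<in> Fs" "e y \<in> dd d" by auto
    have "dd d' = dd d" if "d' \<in> Fs" "e y \<in> dd d'" for d'
      using Fs_disj[OF d(1) that(1)] d that flip_facts(1)[OF Fs_dip[OF d(1)]] by auto
    then have "Q y \<subseteq> dd d" unfolding Q_def by blast
    then show ?thesis using dd_D(3)[OF Fs_dip[OF d(1)]] by (meson card_mono finite_subset le_trans)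
  next
    case False
    then have "Q y = {}" unfolding Q_def by blast
    then show ?thesis by simp
  qed
  have QY: "card (\<Union>y\<in>Y. Q y) \<le> 8 * card Y" "finite (\<Union>y\<in>Y. Q y)"
    using finite_card_UN[OF Y(2), of Q] Q by auto
  have "D - \<Union>{dd d | d. deep M d} \<subseteq> (D - \<Union>(dd ` F)) \<union> Y \<union> (\<Union>y\<in>Y. Q y)"
  proof
    fix h assume h: "h \<in> D - \<Union>{dd d | d. deep M d}"
    show "h \<in> (D - \<Union>(dd ` F)) \<union> Y \<union> (\<Union>y\<in>Y. Q y)"
    proof (rule ccontr)
      assume n: "\<not> ?thesis"
      then obtain d where dF: "d \<in> F" and hd: "h \<in> dd d" using h by blast
      have d: "d \<in> Fs" using dF by (simp add: Fs_def)
      have int: "interior d" using NI[OF d] hd n by blast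
      then obtain d1 d2 where d1: "d1 \<in> Fs" "joined M d1 d" and d2: "d2 \<in> Fs" "joined M d d2"
        using jn_joined[OF d] jn_joined'[OF d] by (auto simp: interior_def)
      obtain t a b a' b' where dt: "d = (t, (a, b), (a', b'))" by (metis surj_pair)
      obtain t1 s1 x y where d1t: "d1 = (t1, s1, (x, y))" by (metis surj_pair)
      obtain t2 x' y' s2 where d2t: "d2 = (t2, (x', y'), s2)" by (metis surj_pair)
      note sd = sides_dd[OF Fs_dip[OF d, unfolded dt]]
      have eY: "h \<in> Q z" if "e z \<in> dd d" for z unfolding Q_def using d hd that by blast
      have i1: "interior d1"
      proof (rule ccontr)
        assume "\<not> interior d1"
        then have "dd d1 \<subseteq> Y" by (rule NI[OF d1(1)])
        moreover have "y \<in> dd d1" using sides_dd(4)[of t1 "fst s1" "snd s1" x y] Fs_dip[OF d1(1)] d1t by simp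
        moreover have "e y = a"
          using joined_iff(2)[OF Fs_dip[OF d1(1), unfolded d1t] Fs_dip[OF d, unfolded dt]] d1(2) d1t dt by blast
        ultimately show False using eY[of y] sd dt n by blast
      qed
      have i2: "interior d2"
      proof (rule ccontr)
        assume "\<not> interior d2"
        then have "dd d2 \<subseteq> Y" by (rule NI[OF d2(1)])
        moreover have "x' \<in> dd d2" using sides_dd(1)[of t2 x' y' "fst s2" "snd s2"] Fs_dip[OF d2(1)] d2t by simp
        moreover have "e x' = b'"
          using joined_iff(2)[OF Fs_dip[OF d, unfolded dt] Fs_dip[OF d2(1), unfolded d2t]] d2(2) d2t dt by metis
        ultimately show False using eY[of x'] sd dt n by blast
      qed
      have "deep M d" by (rule interior_deep[OF d int d1 i1 d2 i2])
      then show False using h hd by blast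
    qed
  qed
  then have "card (D - \<Union>{dd d | d. deep M d}) \<le> card ((D - \<Union>(dd ` F)) \<union> Y \<union> (\<Union>y\<in>Y. Q y))"
    using W(1) Y(2) QY(2) by (intro card_mono) auto
  also have "\<dots> \<le> card (D - \<Union>(dd ` F)) + card Y + card (\<Union>y\<in>Y. Q y)"
    using card_Un_le[of "(D - \<Union>(dd ` F)) \<union> Y" "\<Union>y\<in>Y. Q y"] card_Un_le[of "D - \<Union>(dd ` F)" Y] by linarith
  finally show ?thesis using Y(1) QY(1) by linarith
qed

end

context reduced_map
begin

definition "shallow = D - \<Union>{dd d | d. deep M d}"

text \<open>Outside the family there are at most 20000 (5 \<open>k\<close> + 18) half-edges. The
  unjoined sides number at most half of 5 \<open>k\<close> + 18 and cost 72 each, which adds 36 to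
  the factor.\<close>

lemma shallow_bound: "int (card shallow) \<le> 20036 * (5 * k + 18)"
proof -
  obtain F where F: "\<And>d. d \<in> F \<Longrightarrow> is_dipole M d"
    "\<And>d d'. d \<in> F \<Longrightarrow> d' \<in> F \<Longrightarrow> d \<noteq> d' \<Longrightarrow> dd d \<inter> dd d' = {}"
    "\<And>d. is_dipole M d \<Longrightarrow> \<exists>d'\<in>F. dd d \<inter> dd d' \<noteq> {}"
    using exists_family by metis
  interpret f: dipole_family M k F by unfold_locales (use F in auto)
  have "int (card (D - \<Union>(dd ` F))) \<le> 100000 * excess D r e + 360000"
    using f.fam.family_bounds(2) by simp
  then have "int (card shallow) \<le> 100180 * k + 360648"
    using f.deep_count f.fam.family_bounds(1) qk unfolding shallow_def by linarith
  then show ?thesis by simp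
qed

section \<open>Rigidity inside chains\<close>

lemma vx_eq: "x \<in> vx r y \<Longrightarrow> y \<in> D \<Longrightarrow> vx r x = vx r y"
  using W(2,3) unfolding vx_def by (elim insertE emptyE) auto

lemma vx_sub: "is_dipole M d \<Longrightarrow> x \<in> dd d \<Longrightarrow> vx r x \<subseteq> dd d"
  using dd_D(2) by (simp add: vx_def)

lemma vx_white: "x \<in> D \<Longrightarrow> u \<in> vx r x \<Longrightarrow> white M u = white M x \<and> u \<in> D"
  using W(2,5) by (auto simp: vx_def)

text \<open>The white half-edges of the two sides determine the index of the cut edge, and any inner
  edge then determines the black vertex with its position.\<close>

lemma dipole_unique:
  assumes "is_dipole M (t, (a, b), (a', b'))" "is_dipole M (t2, (a, y), (a', y'))"
  shows "(t2, (a, y), (a', y')) = (t, (a, b), (a', b'))"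
proof -
  obtain j where j: "dipole_at M a b j" "a' = (r ^^ j) a" "b' = (r ^^ (4 - j)) b" "t = (if j = 2 then O_type else U_type)"
    using dipole_facts(15)[OF assms(1)] by blast
  obtain i where i: "dipole_at M a y i" "a' = (r ^^ i) a" "y' = (r ^^ (4 - i)) y" "t2 = (if i = 2 then O_type else U_type)"
    using dipole_facts(15)[OF assms(2)] by blast
  note m = dipole_atD[OF j(1)] and m' = dipole_atD[OF i(1)]
  have ij: "i = j"
    using j(2) i(2) rot_ne[OF cm m(1)] rot_ne[OF cm m(1), symmetric]
    by (cases rule: dip_cases[OF m(5)]; cases rule: dip_cases[OF m'(5)]) (simp_all add: funpow123)
  have "b = y"
    using m(5) m'(5) W(2,3) m(2) m'(2) unfolding ij
    by (cases rule: dip_cases[OF m(5)]) (simp_all add: dip_simps, metis+)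
  then show ?thesis using ij i j by simp
qed

lemma two_inner:
  assumes "is_dipole M (t, (a, b), (a', b'))"
  obtains u1 u2 where "u1 \<noteq> u2" "vx r a - {a, a'} = {u1, u2}" "edge M u1 \<in> vx r b" "edge M u2 \<in> vx r b"
proof -
  obtain j where j: "dipole_at M a b j" "a' = (r ^^ j) a" using dipole_facts(15)[OF assms] by blast
  note m = dipole_atD[OF j(1)]
  note n = rot_ne[OF cm m(1)] rot_ne[OF cm m(1), symmetric]
  show thesis
  proof (cases rule: dip_cases[OF m(5)])
    case 1
    show thesis
      by (rule that[of "r (r a)" "r (r (r a))"])
        (use m(5) n j(2) 1 in \<open>auto simp: dip_simps funpow123 vx_def\<close>)
  next
    case 2
    show thesis
      by (rule that[of "r a" "r (r (r a))"])
        (use m(5) n j(2) 2 in \<open>auto simp: dip_simps funpow123 vx_def\<close>)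
  next
    case 3
    show thesis
      by (rule that[of "r a" "r (r a)"])
        (use m(5) n j(2) 3 in \<open>auto simp: dip_simps funpow123 vx_def\<close>)
  qed
qed

lemma two_inner_black:
  assumes "is_dipole M (t, (a, b), (a', b'))"
  obtains v1 v2 where "v1 \<noteq> v2" "v1 \<in> vx r b" "v2 \<in> vx r b" "edge M v1 \<in> vx r a" "edge M v2 \<in> vx r a"
proof -
  obtain u1 u2 where u: "u1 \<noteq> u2" "vx r a - {a, a'} = {u1, u2}" "edge M u1 \<in> vx r b" "edge M u2 \<in> vx r b"
    using two_inner[OF assms] by metis
  have uv: "u1 \<in> vx r a" "u2 \<in> vx r a" using u(2) by auto
  then have "u1 \<in> D" "u2 \<in> D" using vx_white dipole_facts(1)[OF assms] by blast+
  then have ee: "edge M (edge M u1) = u1" "edge M (edge M u2) = u2" using W(7) by auto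
  then have "edge M u1 \<noteq> edge M u2" using u(1) by metis
  then show thesis using that[of "edge M u1" "edge M u2"] u uv ee by simp
qed

text \<open>A dipole consists of two vertices with two parallel edges. Parallel edges that start at
  one vertex of \<open>d\<close> must be its two inner edges; so \<open>d'\<close> has the same
  vertices and inner edges as \<open>d\<close>, and the remaining half-edges form the same
  sides.\<close>

lemma rigid:
  assumes three_chain: "three_chain M d1 d d2" and d': "is_dipole M d'" and ov: "dd d' \<inter> dd d \<noteq> {}"
  shows "d' = d \<or> d' = flip d"
proof -
  obtain t a b a' b' where dt: "d = (t, (a, b), (a', b'))" by (metis surj_pair)
  obtain t1 u v x1 y1 where d1t: "d1 = (t1, (u, v), (x1, y1))" by (metis surj_pair)
  obtain t2 x2 y2 u' v' where d2t: "d2 = (t2, (x2, y2), (u', v'))" by (metis surj_pair)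
  obtain t3 x y x' y' where d't: "d' = (t3, (x, y), (x', y'))" by (metis surj_pair)
  have p: "is_dipole M d" "is_dipole M d1" "is_dipole M d2" and jj: "joined M d1 d" "joined M d d2"
    and dj: "dd d1 \<inter> dd d = {}" "dd d \<inter> dd d2 = {}" "dd d1 \<inter> dd d2 = {}" using three_chain by (auto simp: three_chain_def)
  note A = dipole_facts[OF p(1)[unfolded dt]] and B = dipole_facts[OF d'[unfolded d't]]
  have J1: "edge M b = x1" "edge M a = y1"
    using joined_iff(2)[OF p(2)[unfolded d1t] p(1)[unfolded dt]] jj(1) d1t dt by simp_all
  have J2: "edge M a' = y2" "edge M b' = x2"
    using jj(2) d2t dt by simp_all
  have E1: "edge M z \<in> dd d1" if "z \<in> {a, b}" for z
    using that J1 sides_dd(3,4)[OF p(2)[unfolded d1t]] d1t by auto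
  have E2: "edge M z \<in> dd d2" if "z \<in> {a', b'}" for z
    using that J2 sides_dd(1,2)[OF p(3)[unfolded d2t]] d2t by auto
  have E3: "edge M z \<in> dd d" if "z \<in> dd d" "z \<notin> {a, b, a', b'}" for z
    using inner_dd(4)[OF p(1)[unfolded dt]] that dt by blast
  have reach: "z' \<in> X" if "X = dd d \<or> X = dd d1 \<or> X = dd d2" "z \<in> X" "z \<in> vx r w0" "z' \<in> vx r w0" "w0 \<in> D" for X z z' w0
  proof -
    have "z' \<in> vx r z" using vx_eq[OF that(3,5)] that(4) by simp
    then show ?thesis using vx_sub p that(1,2) by blast
  qed
  \<comment> \<open>Two half-edges at one vertex of \<open>d\<close> that lead to a common vertex
    are inner. An outer one leads to \<open>d1\<close> or \<open>d2\<close>; by disjointness the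
    second would then belong to the same side, where each colour occurs only once.\<close>
  have L: "u1 \<notin> {a, b, a', b'}" if u: "u1 \<in> dd d" "u2 \<in> dd d" "u1 \<noteq> u2" "white M u1 = white M u2"
      "edge M u1 \<in> vx r w0" "edge M u2 \<in> vx r w0" "w0 \<in> D" for u1 u2 w0
  proof
    assume "u1 \<in> {a, b, a', b'}"
    then consider "u1 \<in> {a, b}" | "u1 \<in> {a', b'}" by auto
    then show False
    proof cases
      case 1
      have "edge M u2 \<in> dd d1" using reach[of "dd d1" "edge M u1" w0 "edge M u2"] E1[OF 1] u by blast
      then have "u2 \<in> {a, b}" using E2[of u2] E3[of u2] u(2) dj by blast
      then show False using 1 u(3,4) A(5,6) by auto
    next
      case 2
      have "edge M u2 \<in> dd d2" using reach[of "dd d2" "edge M u1" w0 "edge M u2"] E2[OF 2] u by blast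
      then have "u2 \<in> {a', b'}" using E1[of u2] E3[of u2] u(2) dj by blast
      then show False using 2 u(3,4) A(7,8) by auto
    qed
  qed
  have ddd: "dd d = block r a b" "dd d' = block r x y" using A(11) B(11) dt d't by auto
  have whites: "z \<in> vx r a" if "z \<in> dd d" "white M z" for z
    using that vx_white[OF A(2), of z] A(6) by (auto simp: ddd block_def)
  have blacks: "z \<in> vx r b" if "z \<in> dd d" "\<not> white M z" for z
    using that vx_white[OF A(1), of z] A(5) by (auto simp: ddd block_def)
  have vab: "vx r a \<subseteq> dd d" "vx r b \<subseteq> dd d" by (auto simp: ddd block_def)
  obtain h where h: "h \<in> dd d'" "h \<in> dd d" using ov by blast
  \<comment> \<open>A common black half-edge suffices as well: by \<open>L\<close> an inner edge of
    \<open>d'\<close> at the black vertex is also inner for \<open>d\<close>, and crossing it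
    identifies the white vertices.\<close>
  have xa: "vx r x = vx r a"
  proof (cases "white M h")
    case True
    then have "h \<in> vx r x" using h(1) vx_white[OF B(2), of h] B(6) by (auto simp: ddd block_def)
    moreover have "h \<in> vx r a" by (rule whites[OF h(2) True])
    ultimately show ?thesis using vx_eq A(1) B(1) by metis
  next
    case False
    then have "h \<in> vx r y" using h(1) vx_white[OF B(1), of h] B(5) by (auto simp: ddd block_def)
    moreover have "h \<in> vx r b" by (rule blacks[OF h(2) False])
    ultimately have yb: "vx r y = vx r b" using vx_eq A(2) B(2) by metis
    obtain v1 v2 where v: "v1 \<noteq> v2" "v1 \<in> vx r y" "v2 \<in> vx r y" "edge M v1 \<in> vx r x" "edge M v2 \<in> vx r x"
      using two_inner_black[OF d'[unfolded d't]] by metis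
    have vd: "v1 \<in> dd d" "v2 \<in> dd d" using v(2,3) yb vab by auto
    have "white M v1 = white M v2" using vx_white[OF B(2)] v(2,3) by metis
    then have "v1 \<notin> {a, b, a', b'}" using L[OF vd v(1) _ v(4,5) B(1)] by simp
    then have "edge M v1 \<in> dd d" by (rule E3[OF vd(1)])
    moreover have "white M (edge M v1)" using vx_white[OF B(1) v(4)] B(5) by simp
    ultimately have "edge M v1 \<in> vx r a" by (rule whites)
    then show ?thesis using vx_eq A(1) B(1) v(4) by metis
  qed
  obtain u1 u2 where u: "u1 \<noteq> u2" "vx r x - {x, x'} = {u1, u2}" "edge M u1 \<in> vx r y" "edge M u2 \<in> vx r y"
    using two_inner[OF d'[unfolded d't]] by metis
  have ux: "u1 \<in> vx r x" "u2 \<in> vx r x" using u(2) by auto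
  have ud: "u1 \<in> dd d" "u2 \<in> dd d" using ux xa vab by auto
  have uw: "white M u1 = white M u2" using vx_white[OF B(1)] ux by metis
  have "u1 \<notin> {a, b, a', b'}" "u2 \<notin> {a, b, a', b'}"
    using L[OF ud u(1) uw u(3,4) B(2)] L[OF ud(2,1) u(1)[symmetric] uw[symmetric] u(4,3) B(2)] by auto
  moreover have "a \<in> vx r x" "a' \<in> vx r x" using xa A(12) by (auto simp: vx_def)
  ultimately have "a \<notin> vx r x - {x, x'} \<and> a \<in> vx r x" "a' \<notin> vx r x - {x, x'} \<and> a' \<in> vx r x"
    unfolding u(2) by auto
  then have "a \<in> {x, x'}" "a' \<in> {x, x'}" by simp_all
  then consider "x = a" "x' = a'" | "x = a'" "x' = a" using A(9) by auto
  then show ?thesis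
  proof cases
    case 1
    have "d' = d"
      using dipole_unique[OF p(1)[unfolded dt], of t3 y y'] d' unfolding d't dt 1 by simp
    then show ?thesis ..
  next
    case 2
    have "is_dipole M (t, (a', b'), (a, b))" using p(1) is_dipole_flip[of d] by (simp add: dt)
    from dipole_unique[OF this, of t3 y y'] have "d' = flip d" using d' unfolding d't dt 2 by simp
    then show ?thesis ..
  qed
qed

end

context reduced_map
begin

section \<open>Maximal chains\<close>

lemma chainD:
  assumes "chain M ds"
  shows "ds \<noteq> []" "d \<in> set ds \<Longrightarrow> is_dipole M d" "i < length ds \<Longrightarrow> is_dipole M (ds ! i)"
    "Suc i < length ds \<Longrightarrow> joined M (ds ! i) (ds ! Suc i)"
    "i < length ds \<Longrightarrow> j < length ds \<Longrightarrow> i \<noteq> j \<Longrightarrow> dd (ds ! i) \<inter> dd (ds ! j) = {}"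
proof -
  show "ds \<noteq> []" "d \<in> set ds \<Longrightarrow> is_dipole M d" "i < length ds \<Longrightarrow> is_dipole M (ds ! i)"
    "Suc i < length ds \<Longrightarrow> joined M (ds ! i) (ds ! Suc i)"
    using assms unfolding chain_def by simp_all
  have "dd (ds ! i) \<inter> dd (ds ! j) = {}" if "i < j" "j < length ds" for i j
    using assms that unfolding chain_def by blast
  then show "i < length ds \<Longrightarrow> j < length ds \<Longrightarrow> i \<noteq> j \<Longrightarrow> dd (ds ! i) \<inter> dd (ds ! j) = {}"
    by (metis Int_commute linorder_neqE_nat)
qed

lemma chain_rev:
  assumes "chain M ds"
  shows "chain M (map flip (rev ds))"
proof -
  note C = chainD[OF assms]
  let ?n = "length ds"
  have nth: "map flip (rev ds) ! i = flip (ds ! (?n - Suc i))" if "i < ?n" for i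
    using that by (simp add: rev_nth)
  have "isolated_dipole M (hd (map flip (rev ds)))" if "length (map flip (rev ds)) = 1"
  proof -
    obtain d where d: "ds = [d]" using \<open>length (map flip (rev ds)) = 1\<close> by (cases ds) auto
    have iso: "isolated_dipole M d" using assms d unfolding chain_def by simp
    then have dp: "is_dipole M d" by (simp add: isolated_dipole_def)
    have "isolated_dipole M (flip d)"
      unfolding isolated_dipole_def flip_facts(1)[OF dp] flip_flip
      using iso is_dipole_flip[of d] unfolding isolated_dipole_def by blast
    then show ?thesis by (simp add: d)
  qed
  moreover have "\<forall>d\<in>set (map flip (rev ds)). is_dipole M d" using C(2) is_dipole_flip by auto
  moreover have "joined M (map flip (rev ds) ! i) (map flip (rev ds) ! Suc i)"
    if i: "Suc i < length (map flip (rev ds))" for i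
  proof -
    define m where "m = ?n - Suc (Suc i)"
    have m: "Suc m < ?n" "?n - Suc i = Suc m" using i by (auto simp: m_def)
    have "joined M (flip (ds ! Suc m)) (flip (ds ! m))"
      by (rule joined_flip) (use C(3,4) m in auto)
    then show ?thesis using nth[of i] nth[of "Suc i"] i m by (simp add: m_def)
  qed
  moreover have "dd (map flip (rev ds) ! i) \<inter> dd (map flip (rev ds) ! j) = {}"
    if ij: "i < j" "j < length (map flip (rev ds))" for i j
  proof -
    have "dd (ds ! (?n - Suc i)) \<inter> dd (ds ! (?n - Suc j)) = {}" by (rule C(5)) (use ij in auto)
    then show ?thesis using nth[of i] nth[of j] ij flip_facts(1) C(3) by simp
  qed
  ultimately show ?thesis using C(1) unfolding chain_def by simp
qed

lemma maximal_rev: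
  assumes "maximal_chain M ds"
  shows "maximal_chain M (map flip (rev ds))"
proof -
  have "False" if d': "chain M ds'" "set (map flip (rev ds)) \<subset> set ds'" for ds'
  proof -
    have ch: "chain M (map flip (rev ds'))" by (rule chain_rev[OF d'(1)])
    have inj: "inj flip" by (rule injI) (metis flip_flip)
    have "flip ` set (map flip (rev ds)) \<subset> flip ` set ds'"
      using d'(2) inj by (metis image_strict_mono inj_on_subset subset_UNIV)
    moreover have "flip ` set (map flip (rev ds)) = set ds" by (simp add: image_image)
    ultimately have "set ds \<subset> set (map flip (rev ds'))" by simp
    then show False using assms ch unfolding maximal_chain_def by blast
  qed
  then show ?thesis using assms chain_rev unfolding maximal_chain_def by blast
qed

text \<open>A maximal chain cannot begin inside a longer one: otherwise it could be prolonged, unless the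
  prolongation meets its other end, in which case the chain closes up into a ring.\<close>

lemma maximal_head:
  assumes mx: "maximal_chain M ds" and dp: "deep M d"
  shows "dd (hd ds) \<inter> dd d = {}"
proof (rule ccontr)
  assume ov: "dd (hd ds) \<inter> dd d \<noteq> {}"
  have ch: "chain M ds" using mx by (simp add: maximal_chain_def)
  note C = chainD[OF ch]
  have hd: "hd ds = ds ! 0" "0 < length ds" using C(1) by (auto simp: hd_conv_nth)
  have hdd: "is_dipole M (hd ds)" using C(3) hd by simp
  have "hd ds = d \<or> hd ds = flip d"
    using dp rigid[OF _ hdd ov] unfolding deep_def by blast
  then have "deep M (hd ds)" using dp deep_flip by metis
  then obtain d0 d1 d2 where t1: "three_chain M d1 (hd ds) d2" and t0: "three_chain M d0 d1 (hd ds)"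
    unfolding deep_def by blast
  obtain t a b a' b' where dt: "hd ds = (t, (a, b), (a', b'))" by (metis surj_pair)
  obtain s1 u v x y where d1t: "d1 = (s1, (u, v), (x, y))" by (metis surj_pair)
  have p1: "is_dipole M d1" and j1: "joined M d1 (hd ds)" and dj: "dd d1 \<inter> dd (hd ds) = {}"
    using t1 by (auto simp: three_chain_def)
  have J: "x = e b \<and> y = e a \<and> e x = b \<and> e y = a \<and> a \<notin> R \<and> b \<notin> R \<and> x \<notin> R \<and> y \<notin> R
      \<and> edge M b = x \<and> edge M a = y"
    by (rule joined_iff(2)[OF p1[unfolded d1t] hdd[unfolded dt]]) (use j1 in \<open>simp only: d1t dt\<close>)
  note sd = sides_dd[OF hdd[unfolded dt], folded dt]
  have disj: "dd d1 \<inter> dd (ds ! i) = {}" if i: "i < length ds" for i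
  proof (cases "i = 0")
    case True then show ?thesis using dj hd by simp
  next
    case i0: False
    show ?thesis
    proof (rule ccontr)
      assume o: "dd d1 \<inter> dd (ds ! i) \<noteq> {}"
      have "ds ! i = d1 \<or> ds ! i = flip d1" using rigid[OF t0 C(3)[OF i]] o by blast
      then show False
      proof
        \<comment> \<open>Entered backwards, \<open>d1\<close> would have a predecessor in the chain
          that ends in \<open>a\<close>, a half-edge of the head which is not on the outgoing
          side.\<close>
        assume fl: "ds ! i = flip d1"
        obtain m where m: "i = Suc m" using i0 by (cases i) auto
        obtain t3 s3 x3 y3 where d3: "ds ! m = (t3, s3, (x3, y3))" by (metis surj_pair)
        have "joined M (ds ! m) (ds ! i)" using C(4) i m by simp
        then have "x3 = e y"
          using joined_iff(2)[of t3 s3 x3 y3 s1 x y "(u, v)"] C(3)[of m] C(3)[of i] i m d3 fl d1t by simp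
        then have x3: "x3 = a" using J by metis
        have s3: "s3 = (fst s3, snd s3)" by simp
        have p3: "is_dipole M (t3, (fst s3, snd s3), (x3, y3))" using C(3)[of m] i m d3 by simp
        have in3: "x3 \<in> dd (ds ! m)" using sides_dd(3)[OF p3] d3 by simp
        show False
        proof (cases "m = 0")
          case True
          then have "a' = x3" using d3 dt hd by simp
          then show False using x3 dipole_facts(9)[OF hdd[unfolded dt]] by simp
        next
          case False
          then have "dd (ds ! 0) \<inter> dd (ds ! m) = {}" using C(5)[of 0 m] i m C(1) by simp
          then show False using in3 x3 sd(1) hd by auto
        qed
      next
        \<comment> \<open>The outgoing side of \<open>d1\<close> leads to the head, so a successor
          of \<open>d1\<close> in the list would overlap the head. Thus \<open>d1\<close> is the
          last dipole, and the list closes up to a ring.\<close>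
        assume eq: "ds ! i = d1"
        show False
        proof (cases "Suc i < length ds")
          case True
          obtain t3 x3 y3 s3 where d3: "ds ! Suc i = (t3, (x3, y3), s3)" by (metis surj_pair)
          have q3: "is_dipole M (t3, (x3, y3), s3)" using C(3)[OF True] d3 by simp
          have "joined M (s1, (u, v), (x, y)) (t3, (x3, y3), s3)" using C(4)[OF True] unfolding eq d3 d1t .
          then have "e y = x3" using joined_iff(2)[OF p1[unfolded d1t] q3] by blast
          then have x3: "x3 = a" using J by metis
          have p3: "is_dipole M (t3, (x3, y3), (fst s3, snd s3))" using C(3)[of "Suc i"] True d3 by simp
          have "x3 \<in> dd (ds ! Suc i)" using sides_dd(1)[OF p3] d3 by simp
          moreover have "dd (ds ! 0) \<inter> dd (ds ! Suc i) = {}" using C(5)[of 0 "Suc i"] True C(1) by simp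
          ultimately show False using x3 sd(1) hd by auto
        next
          case last: False
          then have il: "Suc i = length ds" using i by simp
          show False
          proof (rule no_closed[of "set ds"])
            show "set ds \<noteq> {}" using C(1) by simp
            show "is_dipole M d" if "d \<in> set ds" for d using C(2) that by simp
            fix t3 a3 b3 a4 b4 z
            assume d3: "(t3, (a3, b3), (a4, b4)) \<in> set ds" and z: "z \<in> {a3, b3, a4, b4}"
            obtain m where m: "m < length ds" "ds ! m = (t3, (a3, b3), (a4, b4))"
              using d3 by (metis in_set_conv_nth)
            note p3 = C(3)[OF m(1), unfolded m(2)]
            have U: "h \<in> \<Union>(dd ` set ds)" if "h \<in> dd (ds ! n)" "n < length ds" for h n
              using that nth_mem by blast
            have A: "a3 \<notin> R \<and> b3 \<notin> R \<and> e a3 \<in> \<Union>(dd ` set ds) \<and> e b3 \<in> \<Union>(dd ` set ds)"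
            proof (cases m)
              case 0
              then have "a3 = a" "b3 = b" using m(2) dt hd by auto
              moreover have "e a \<in> dd (ds ! i)" "e b \<in> dd (ds ! i)"
                using J sides_dd[OF p1[unfolded d1t]] eq d1t by metis+
              ultimately show ?thesis using J U i by blast
            next
              case (Suc n)
              obtain t5 s5 x5 y5 where d5: "ds ! n = (t5, s5, (x5, y5))" by (metis surj_pair)
              have p5: "is_dipole M (t5, s5, (x5, y5))" using C(3)[of n] m(1) Suc d5 by simp
              have "joined M (ds ! n) (ds ! m)" using C(4)[of n] m(1) Suc by simp
              then have "a3 \<notin> R \<and> b3 \<notin> R \<and> e a3 = y5 \<and> e b3 = x5"
                using joined_iff(2)[OF p5 p3] unfolding d5 m(2) by blast
              moreover have "x5 \<in> dd (ds ! n)" "y5 \<in> dd (ds ! n)"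
                using sides_dd(3,4)[of t5 "fst s5" "snd s5" x5 y5] p5 d5 by simp_all
              ultimately show ?thesis using U[of _ n] m(1) Suc by simp
            qed
            have B: "a4 \<notin> R \<and> b4 \<notin> R \<and> e a4 \<in> \<Union>(dd ` set ds) \<and> e b4 \<in> \<Union>(dd ` set ds)"
            proof (cases "Suc m < length ds")
              case False
              then have "m = i" using il m(1) by simp
              then have "a4 = x" "b4 = y" using m(2) eq d1t by auto
              moreover have "e x \<in> dd (ds ! 0)" "e y \<in> dd (ds ! 0)" using J sd hd by metis+
              ultimately show ?thesis using J U hd by blast
            next
              case True
              obtain t5 x5 y5 s5 where d5: "ds ! Suc m = (t5, (x5, y5), s5)" by (metis surj_pair)
              have p5: "is_dipole M (t5, (x5, y5), s5)" using C(3)[OF True] d5 by simp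
              have "joined M (ds ! m) (ds ! Suc m)" using C(4)[OF True] .
              then have "a4 \<notin> R \<and> b4 \<notin> R \<and> e a4 = y5 \<and> e b4 = x5"
                using joined_iff(2)[OF p3 p5] unfolding d5 m(2) by blast
              moreover have "x5 \<in> dd (ds ! Suc m)" "y5 \<in> dd (ds ! Suc m)"
                using sides_dd(1,2)[of t5 x5 y5 "fst s5" "snd s5"] p5 d5 by simp_all
              ultimately show ?thesis using U[of _ "Suc m"] True by simp
            qed
            show "z \<notin> R \<and> e z \<in> \<Union>(dd ` set ds)" using A B z by blast
          qed
        qed
      qed
    qed
  qed
  have "chain M (d1 # ds)"
    unfolding chain_def
  proof (intro conjI allI impI ballI)
    show "is_dipole M d" if "d \<in> set (d1 # ds)" for d
    proof -
      have "d = d1 \<or> d \<in> set ds" using that by simp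
      then show ?thesis using p1 C(2) by metis
    qed
    show "isolated_dipole M (hd (d1 # ds))" if "length (d1 # ds) = 1" using that C(1) by simp
    show "joined M ((d1 # ds) ! i) ((d1 # ds) ! Suc i)" if "Suc i < length (d1 # ds)" for i
      using that C(4) j1 hd by (cases i) auto
    show "dd ((d1 # ds) ! i) \<inter> dd ((d1 # ds) ! j) = {}" if ij: "i < j \<and> j < length (d1 # ds)" for i j
    proof -
      obtain j' where j': "j = Suc j'" using ij by (cases j) auto
      show ?thesis using ij disj[of j'] C(5)[of "i - 1" j'] j' by (cases i) auto
    qed
  qed simp
  moreover have "d1 \<notin> set ds"
  proof
    assume "d1 \<in> set ds"
    then obtain i where i: "i < length ds" "ds ! i = d1" by (metis in_set_conv_nth)
    then have "dd d1 = {}" using disj[OF i(1)] by simp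
    then show False using dd_D(4)[OF p1] by simp
  qed
  then have "set ds \<subset> set (d1 # ds)" by auto
  ultimately show False using mx unfolding maximal_chain_def by blast
qed

text \<open>The outer side of the first dipole is covered by \<open>maximal_head\<close>, that of
  the last one by reversing the chain.\<close>

lemma maximal_sides:
  assumes mx: "maximal_chain M ds"
  shows "\<Union>(chain_sides ds) \<subseteq> shallow"
proof -
  have *: "side_set (fst (snd (hd ds))) \<subseteq> shallow" if mx: "maximal_chain M ds" for ds
  proof
    fix h assume h: "h \<in> side_set (fst (snd (hd ds)))"
    have ch: "chain M ds" using mx by (simp add: maximal_chain_def)
    have p: "is_dipole M (hd ds)" using chainD(1,2)[OF ch] by simp
    obtain t a b a' b' where dt: "hd ds = (t, (a, b), (a', b'))" by (metis surj_pair)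
    have hd: "h \<in> dd (hd ds)" using h sides_dd(1,2)[OF p[unfolded dt]] dt by auto
    have "h \<notin> dd d" if "deep M d" for d
      using hd maximal_head[OF mx that] by auto
    then show "h \<in> shallow" unfolding shallow_def using subsetD[OF dd_D(1)[OF p] hd] by auto
  qed
  have ne: "ds \<noteq> []" using mx chainD(1) by (simp add: maximal_chain_def)
  have "hd (map flip (rev ds)) = flip (last ds)" using ne by (simp add: hd_map hd_rev)
  moreover have "fst (snd (flip d)) = snd (snd d)" for d :: "'a dipole" by (cases d) simp
  ultimately have "side_set (snd (snd (last ds))) \<subseteq> shallow" using *[OF maximal_rev[OF mx]] by simp
  then show ?thesis using *[OF mx] by (simp add: chain_sides_def)
qed

lemma extend_chain:
  assumes "chain M ds"
  shows "\<exists>ds'. maximal_chain M ds' \<and> set ds \<subseteq> set ds'"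
proof -
  let ?C = "{set ds | ds. chain M ds}"
  have "?C \<subseteq> Pow {d. is_dipole M d}" using chainD(2) by blast
  then have fin: "finite ?C" using finite_dipoles by (meson finite_Pow_iff finite_subset)
  have mem: "set ds \<in> ?C" using assms by blast
  obtain m where m: "m \<in> ?C" "set ds \<subseteq> m" "\<forall>b\<in>?C. m \<subseteq> b \<longrightarrow> m = b"
    using finite_has_maximal2[OF fin mem] by (elim bexE conjE) (rule that)
  obtain ds' where ds': "chain M ds'" "m = set ds'" using m(1) by blast
  have "\<not> set ds' \<subset> set ds2" if "chain M ds2" for ds2
  proof -
    have "set ds2 \<in> ?C" using that by blast
    then show ?thesis using m(3) ds'(2) by auto
  qed
  then have "maximal_chain M ds'" using ds'(1) unfolding maximal_chain_def by blast
  then show ?thesis using m(2) ds'(2) by blast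
qed

text \<open>A deep dipole and its neighbour form a chain, hence lie in a maximal one. The outer
  sides of that chain are shallow, so the half-edges of the deep dipole are inner and
  disappear.\<close>

lemma scheme_darts: "s_darts (chain_scheme M) \<subseteq> shallow"
proof
  fix h assume "h \<in> s_darts (chain_scheme M)"
  then have h: "h \<in> D" "\<And>ds. maximal_chain M ds \<Longrightarrow> h \<notin> chain_inner M ds"
    by (auto simp: chain_scheme_def Let_def)
  show "h \<in> shallow"
  proof (rule ccontr)
    assume n: "h \<notin> shallow"
    then obtain d where d: "deep M d" "h \<in> dd d" using h(1) unfolding shallow_def by blast
    then obtain d1 d2 where t: "three_chain M d1 d d2" unfolding deep_def by blast
    have "chain M [d1, d]"
      using t unfolding chain_def three_chain_def by (auto simp: less_Suc_eq nth_Cons')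
    then obtain ds where ds: "maximal_chain M ds" "set [d1, d] \<subseteq> set ds" using extend_chain by blast
    have "h \<in> (\<Union>d\<in>set ds. dd d)" using ds(2) d(2) by auto
    then have "h \<in> \<Union>(chain_sides ds)" using h(2)[OF ds(1)] unfolding chain_inner_def by blast
    then show False using maximal_sides[OF ds(1)] n by blast
  qed
qed

end

section \<open>Finitely many schemes\<close>

definition small :: "nat \<Rightarrow> 'a scheme \<Rightarrow> bool" where
  "small n S \<longleftrightarrow> (\<exists>Y. finite Y \<and> card Y \<le> n \<and> s_darts S \<subseteq> Y \<and> (\<forall>(t, X)\<in>s_chains S. \<Union>X \<subseteq> Y))"

lemma scheme_small:
  assumes "rooted_map M" "rooted_genus M = real g" "rooted_grade M = real l" "is_scheme_of S M"
  shows "small (nat (20036 * (5 * (4 * (2 * int g + int l)) + 18))) S"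
proof -
  let ?k = "4 * (2 * int g + int l)"
  obtain M' where M': "melon_step\<^sup>*\<^sup>* M M'" "\<nexists>A. melonic_submap M' A" "S = chain_scheme M'"
    using assms(4) by (auto simp: is_scheme_of_def melon_reduced_def)
  have "darts M' = {} \<or> rooted_bound M' ?k"
    by (rule melon_steps_bound[OF M'(1) rooted_map_bound[OF assms(1-3)]])
  then show ?thesis
  proof
    \<comment> \<open>Melon removal may consume the whole map and leave the bare root edge, which
      has no half-edges.\<close>
    assume e: "darts M' = {}"
    have "\<not> maximal_chain M' ds" for ds
    proof
      assume "maximal_chain M' ds"
      then have ch: "chain M' ds" by (simp add: maximal_chain_def)
      then have "is_dipole M' (hd ds)" by (simp add: chain_def)
      then show False using e by (cases "hd ds") (auto simp: is_dipole.simps cut_melon_def)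
    qed
    then have "s_darts S = {}" "s_chains S = {}" unfolding M'(3) chain_scheme_def Let_def using e by auto
    then show ?thesis unfolding small_def by (intro exI[of _ "{}"]) auto
  next
    assume "rooted_bound M' ?k"
    then interpret reduced_map M' ?k by unfold_locales (use M' in auto)
    have "\<Union>X \<subseteq> shallow" if "(t, X) \<in> s_chains S" for t X
      using that maximal_sides unfolding M'(3) chain_scheme_def Let_def by auto
    moreover have "card shallow \<le> nat (20036 * (5 * ?k + 18))" using shallow_bound by linarith
    moreover have "finite shallow" using W(1) by (simp add: shallow_def)
    ultimately show ?thesis unfolding small_def using scheme_darts M'(3) by blast
  qed
qed

text \<open>Functions on all natural numbers are cut down to finitely many by the default values 0
  and \<open>False\<close> from \<open>n\<close> on; isomorphism only evaluates them on
  \<open>s_darts\<close>.\<close>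

definition codes :: "nat \<Rightarrow> nat scheme set" where
  "codes n = (\<lambda>(K, f, g, h, w, C). \<lparr>s_darts = K, s_rot = f, s_opp = g, s_edge = h, s_white = w, s_chains = C\<rparr>) `
     (Pow {..<n} \<times> {f. \<forall>x. (x \<in> {..<n} \<longrightarrow> f x \<in> {..<n}) \<and> (x \<notin> {..<n} \<longrightarrow> f x = 0)}
       \<times> {f. \<forall>x. (x \<in> {..<n} \<longrightarrow> f x \<in> {..<n}) \<and> (x \<notin> {..<n} \<longrightarrow> f x = 0)}
       \<times> {f. \<forall>x. (x \<in> {..<n} \<longrightarrow> f x \<in> {..<n}) \<and> (x \<notin> {..<n} \<longrightarrow> f x = 0)}
       \<times> {f. \<forall>x. (x \<in> {..<n} \<longrightarrow> f x \<in> UNIV) \<and> (x \<notin> {..<n} \<longrightarrow> f x = False)}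
       \<times> Pow (UNIV \<times> Pow (Pow {..<n})))"

lemma finite_codes: "finite (codes n)"
proof -
  have "(UNIV :: chain_type set) \<subseteq> {O_type, U_type, B_type}"
    using chain_type.exhaust by blast
  then have "finite (UNIV :: chain_type set)" using finite_subset by blast
  then show ?thesis unfolding codes_def
    by (intro finite_imageI finite_cartesian_product finite_set_of_finite_funs
        finite_Pow_iff[THEN iffD2] finite_lessThan finite) simp_all
qed

lemma scheme_isoI:
  assumes "bij_betw f (s_darts S) (s_darts T)"
    "\<And>h. h \<in> s_darts S \<Longrightarrow> f (s_rot S h) = s_rot T (f h) \<and> f (s_opp S h) = s_opp T (f h)
      \<and> f (s_edge S h) = s_edge T (f h) \<and> s_white T (f h) = s_white S h"
    "s_chains T = (\<lambda>(t, X). (t, (\<lambda>s. f ` s) ` X)) ` s_chains S"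
  shows "T \<in> scheme_iso `` {S}"
  unfolding scheme_iso_def Image_singleton_iff mem_Collect_eq prod.case
  using assms by (intro exI[of _ f] conjI ballI) auto

text \<open>The half-edges are renumbered by an injection \<open>f\<close> into an initial segment,
  the structure maps are conjugated by it on \<open>s_darts\<close>, and default values fill the
  rest.\<close>

lemma scheme_code:
  fixes S :: "nat scheme"
  assumes "small n S"
  shows "\<exists>T\<in>codes (4 * n). scheme_iso `` {S} = scheme_iso `` {T}"
proof -
  obtain Y where Y0: "finite Y" "card Y \<le> n" "s_darts S \<subseteq> Y" "\<forall>(t, X)\<in>s_chains S. \<Union>X \<subseteq> Y"
    using assms unfolding small_def by (elim exE conjE) (rule that)
  have "\<Union>X \<subseteq> Y" if "(t, X) \<in> s_chains S" for t X using bspec[OF Y0(4) that] by simp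
  note Y = Y0(1-3) this
  let ?K = "s_darts S"
  \<comment> \<open>The structure maps may leave \<open>s_darts\<close>, yet an isomorphism also
    compares the values taken there. Hence \<open>f\<close> must be injective on the three images
    too, which gives the factor 4.\<close>
  define U where "U = Y \<union> s_rot S ` ?K \<union> s_opp S ` ?K \<union> s_edge S ` ?K"
  have fK: "finite ?K" by (rule finite_subset[OF Y(3,1)])
  have KU: "?K \<subseteq> U" using Y by (auto simp: U_def)
  have finU: "finite U" using Y fK by (simp add: U_def)
  have "card ?K \<le> n" using card_mono[OF Y(1,3)] Y(2) by linarith
  then have im: "card (f ` ?K) \<le> n" for f :: "nat \<Rightarrow> nat" using card_image_le[OF fK, of f] by linarith
  have "card U \<le> 4 * n"
    unfolding U_def
    using card_Un_le[of "Y \<union> s_rot S ` ?K \<union> s_opp S ` ?K" "s_edge S ` ?K"]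
      card_Un_le[of "Y \<union> s_rot S ` ?K" "s_opp S ` ?K"] card_Un_le[of Y "s_rot S ` ?K"]
      im[of "s_rot S"] im[of "s_opp S"] im[of "s_edge S"] Y(2) by linarith
  then have "card U \<le> card {..<4 * n}" by simp
  then obtain f where f: "inj_on f U" "f ` U \<subseteq> {..<4 * n}"
    using card_le_inj[OF finU] by blast
  define i where "i = inv_into U f"
  have i: "i (f x) = x" if "x \<in> U" for x using f(1) that by (simp add: i_def)
  have fK0: "f x < 4 * n" if "x \<in> U" for x using f(2) that by blast
  define P where "P F = (\<lambda>x. if x \<in> f ` ?K then f (F (i x)) else 0)" for F
  define T where "T = \<lparr>s_darts = f ` ?K, s_rot = P (s_rot S), s_opp = P (s_opp S), s_edge = P (s_edge S),
    s_white = (\<lambda>x. x \<in> f ` ?K \<and> s_white S (i x)),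
    s_chains = (\<lambda>(t, X). (t, (\<lambda>s. f ` s) ` X)) ` s_chains S\<rparr>"
  have P: "P F (f x) = f (F x)" if "x \<in> ?K" for F x using that i KU by (auto simp: P_def)
  have PF: "P F \<in> {f. \<forall>x. (x \<in> {..<4 * n} \<longrightarrow> f x \<in> {..<4 * n}) \<and> (x \<notin> {..<4 * n} \<longrightarrow> f x = 0)}"
    if "F ` ?K \<subseteq> U" for F
  proof -
    have "P F x < 4 * n" if "x < 4 * n" for x
    proof (cases "x \<in> f ` ?K")
      case True
      then obtain h where h: "h \<in> ?K" "x = f h" by blast
      then have "F h \<in> U" using \<open>F ` ?K \<subseteq> U\<close> by blast
      then show ?thesis using P h fK0 by simp
    next
      case False then show ?thesis using that by (simp add: P_def)
    qed
    moreover have "P F x = 0" if "\<not> x < 4 * n" for x using that fK0 KU by (auto simp: P_def)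
    ultimately show ?thesis by simp
  qed
  have "T \<in> codes (4 * n)"
    unfolding codes_def
  proof (rule image_eqI)
    let ?w = "\<lambda>x. x \<in> f ` ?K \<and> s_white S (i x)"
    let ?C = "(\<lambda>(t, X). (t, (\<lambda>s. f ` s) ` X)) ` s_chains S"
    show "T = (\<lambda>(K, f, g, h, w, C). \<lparr>s_darts = K, s_rot = f, s_opp = g, s_edge = h, s_white = w, s_chains = C\<rparr>)
        (f ` ?K, P (s_rot S), P (s_opp S), P (s_edge S), ?w, ?C)" by (simp add: T_def)
    have 1: "f ` ?K \<in> Pow {..<4 * n}" using f KU by blast
    have 2: "P (s_rot S) \<in> {f. \<forall>x. (x \<in> {..<4 * n} \<longrightarrow> f x \<in> {..<4 * n}) \<and> (x \<notin> {..<4 * n} \<longrightarrow> f x = 0)}"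
      "P (s_opp S) \<in> {f. \<forall>x. (x \<in> {..<4 * n} \<longrightarrow> f x \<in> {..<4 * n}) \<and> (x \<notin> {..<4 * n} \<longrightarrow> f x = 0)}"
      "P (s_edge S) \<in> {f. \<forall>x. (x \<in> {..<4 * n} \<longrightarrow> f x \<in> {..<4 * n}) \<and> (x \<notin> {..<4 * n} \<longrightarrow> f x = 0)}"
      by (rule PF, unfold U_def, blast)+
    have 3: "?w \<in> {f. \<forall>x. (x \<in> {..<4 * n} \<longrightarrow> f x \<in> UNIV) \<and> (x \<notin> {..<4 * n} \<longrightarrow> f x = False)}"
      using fK0 KU by auto
    have 4: "?C \<in> Pow (UNIV \<times> Pow (Pow {..<4 * n}))"
    proof -
      have "f z < 4 * n" if "(t, X) \<in> s_chains S" "s \<in> X" "z \<in> s" for t X s z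
        using Y(4)[OF that(1)] that(2,3) by (intro fK0) (auto simp: U_def)
      then show ?thesis by auto
    qed
    show "(f ` ?K, P (s_rot S), P (s_opp S), P (s_edge S), ?w, ?C) \<in>
       Pow {..<4 * n} \<times> {f. \<forall>x. (x \<in> {..<4 * n} \<longrightarrow> f x \<in> {..<4 * n}) \<and> (x \<notin> {..<4 * n} \<longrightarrow> f x = 0)}
       \<times> {f. \<forall>x. (x \<in> {..<4 * n} \<longrightarrow> f x \<in> {..<4 * n}) \<and> (x \<notin> {..<4 * n} \<longrightarrow> f x = 0)}
       \<times> {f. \<forall>x. (x \<in> {..<4 * n} \<longrightarrow> f x \<in> {..<4 * n}) \<and> (x \<notin> {..<4 * n} \<longrightarrow> f x = 0)}
       \<times> {f. \<forall>x. (x \<in> {..<4 * n} \<longrightarrow> f x \<in> UNIV) \<and> (x \<notin> {..<4 * n} \<longrightarrow> f x = False)}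
       \<times> Pow (UNIV \<times> Pow (Pow {..<4 * n}))"
      by (intro SigmaI 1 2 3 4)
  qed
  \<comment> \<open>Isomorphisms from \<open>S\<close> and from \<open>T\<close> correspond to one
    another by composing with \<open>i\<close> and \<open>f\<close>. This respects values outside
    \<open>s_darts\<close> because \<open>i\<close> inverts \<open>f\<close> on all of
    \<open>U\<close>.\<close>
  moreover have "scheme_iso `` {S} = scheme_iso `` {T}"
  proof (intro set_eqI iffI)
    fix Q assume "Q \<in> scheme_iso `` {S}"
    then obtain g where g: "bij_betw g ?K (s_darts Q)"
      "\<And>h. h \<in> ?K \<Longrightarrow> g (s_rot S h) = s_rot Q (g h) \<and> g (s_opp S h) = s_opp Q (g h)
        \<and> g (s_edge S h) = s_edge Q (g h) \<and> s_white Q (g h) = s_white S h"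
      "s_chains Q = (\<lambda>(t, X). (t, (\<lambda>s. g ` s) ` X)) ` s_chains S"
      by (auto simp: scheme_iso_def)
    have gi: "g (i (f x)) = g x" if "x \<in> U" for x using i that by simp
    have "bij_betw (g \<circ> i) (s_darts T) (s_darts Q)"
      unfolding T_def scheme.select_convs
    proof (rule bij_betw_trans)
      show "bij_betw i (f ` ?K) ?K"
        by (rule bij_betw_byWitness[where f' = f]) (use i KU in auto)
    qed (fact g(1))
    moreover have "(g \<circ> i) (s_rot T h) = s_rot Q ((g \<circ> i) h) \<and> (g \<circ> i) (s_opp T h) = s_opp Q ((g \<circ> i) h)
        \<and> (g \<circ> i) (s_edge T h) = s_edge Q ((g \<circ> i) h) \<and> s_white Q ((g \<circ> i) h) = s_white T h"
      if h: "h \<in> s_darts T" for h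
    proof -
      obtain x where x: "x \<in> ?K" "h = f x" using h by (auto simp: T_def)
      have "s_rot S x \<in> U" "s_opp S x \<in> U" "s_edge S x \<in> U" "x \<in> U" using x KU by (auto simp: U_def)
      then show ?thesis using x P g(2)[OF x(1)] i by (auto simp: T_def)
    qed
    moreover have "s_chains Q = (\<lambda>(t, X). (t, (\<lambda>s. (g \<circ> i) ` s) ` X)) ` s_chains T"
    proof -
      have ch: "(\<lambda>s. (g \<circ> i) ` s) ` (\<lambda>s. f ` s) ` X = (\<lambda>s. g ` s) ` X" if X: "(t, X) \<in> s_chains S" for t X
      proof -
        have "(g \<circ> i) ` f ` s = g ` s" if "s \<in> X" for s
        proof -
          have "s \<subseteq> U" using Y(4)[OF X] that by (auto simp: U_def)
          then have "g (i (f x)) = g x" if "x \<in> s" for x using gi that by blast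
          then show ?thesis by (simp add: image_image)
        qed
        then show ?thesis by (simp add: image_image)
      qed
      have "s_chains T = (\<lambda>(t, X). (t, (\<lambda>s. f ` s) ` X)) ` s_chains S" by (simp add: T_def)
      moreover have "(\<lambda>(t, X). (t, (\<lambda>s. (g \<circ> i) ` s) ` X)) ` (\<lambda>(t, X). (t, (\<lambda>s. f ` s) ` X)) ` s_chains S
          = (\<lambda>(t, X). (t, (\<lambda>s. g ` s) ` X)) ` s_chains S"
      proof (subst image_image, rule image_cong[OF refl])
        fix p assume p: "p \<in> s_chains S"
        obtain t X where tX: "p = (t, X)" by force
        show "(case case p of (t, X) \<Rightarrow> (t, (\<lambda>s. f ` s) ` X) of (t, X) \<Rightarrow> (t, (\<lambda>s. (g \<circ> i) ` s) ` X))
            = (case p of (t, X) \<Rightarrow> (t, (\<lambda>s. g ` s) ` X))"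
          unfolding tX prod.case ch[OF p[unfolded tX]] ..
      qed
      ultimately show ?thesis unfolding g(3) by metis
    qed
    ultimately show "Q \<in> scheme_iso `` {T}"
      by (rule scheme_isoI)
  next
    fix Q assume "Q \<in> scheme_iso `` {T}"
    then obtain g where g: "bij_betw g (s_darts T) (s_darts Q)"
      "\<And>h. h \<in> s_darts T \<Longrightarrow> g (s_rot T h) = s_rot Q (g h) \<and> g (s_opp T h) = s_opp Q (g h)
        \<and> g (s_edge T h) = s_edge Q (g h) \<and> s_white Q (g h) = s_white T h"
      "s_chains Q = (\<lambda>(t, X). (t, (\<lambda>s. g ` s) ` X)) ` s_chains T"
      by (auto simp: scheme_iso_def)
    have "bij_betw (g \<circ> f) ?K (s_darts Q)"
    proof (rule bij_betw_trans)
      show "bij_betw f ?K (s_darts T)"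
        unfolding T_def using f(1) KU by (auto simp: bij_betw_def intro: inj_on_subset)
    qed (fact g(1))
    moreover have "(g \<circ> f) (s_rot S h) = s_rot Q ((g \<circ> f) h) \<and> (g \<circ> f) (s_opp S h) = s_opp Q ((g \<circ> f) h)
        \<and> (g \<circ> f) (s_edge S h) = s_edge Q ((g \<circ> f) h) \<and> s_white Q ((g \<circ> f) h) = s_white S h"
      if h: "h \<in> ?K" for h
    proof -
      have "f h \<in> s_darts T" using h by (simp add: T_def)
      then show ?thesis using g(2)[of "f h"] P[OF h] i[of h] h KU by (auto simp: T_def)
    qed
    moreover have "s_chains Q = (\<lambda>(t, X). (t, (\<lambda>s. (g \<circ> f) ` s) ` X)) ` s_chains S"
      unfolding g(3) T_def by (simp add: image_image case_prod_beta image_comp)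
    ultimately show "Q \<in> scheme_iso `` {S}"
      by (rule scheme_isoI)
  qed
  ultimately show ?thesis by blast
qed

theorem theorem4p8:
  fixes g l :: nat
  shows "finite (MS g l)"
proof -
  let ?n = "4 * nat (20036 * (5 * (4 * (2 * int g + int l)) + 18))"
  have "MS g l \<subseteq> (\<lambda>T. scheme_iso `` {T}) ` codes ?n"
  proof
    fix X assume "X \<in> MS g l"
    then obtain S M where S: "X = scheme_iso `` {S}" and M: "rooted_map M" "rooted_genus M = real g"
      "rooted_grade M = real l" "is_scheme_of S M"
      unfolding MS_def quotient_def by blast
    then show "X \<in> (\<lambda>T. scheme_iso `` {T}) ` codes ?n"
      using scheme_code[OF scheme_small[OF M]] by blast
  qed
  then show ?thesis by (rule finite_subset) (intro finite_imageI finite_codes)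
qed

end
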